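(* Let $p\in(0,\infty]$. For every convex body $K\subset\mathbb{R}^n$, $$\inf_{x\in\mathbb{R}^n}\mathcal{M}_p(K-x)\le \mathcal{M}_p(B_2^n),$$ where $B_2^n=\{x\in\mathbb{R}^n: x_1^2+\dots+x_n^2\le 1\}$ is the Euclidean unit ball.
   Context: A convex body is a compact convex subset of $\mathbb{R}^n$ with non-empty interior; $|\cdot|$ denotes Lebesgue measure and $\langle\cdot,\cdot\rangle$ the standard inner product. For $p\in(0,\infty)$ the $L^p$-support function of a convex body $K$ is $h_{p,K}(y)=\frac1p\log\left(\int_K e^{p\langle x,y\rangle}\frac{dx}{|K|}\right)$, $y\in\mathbb{R}^n$, and $h_{\infty,K}(y)=h_K(y)=\sup_{x\in K}\langle x,y\rangle$. The $L^p$-Mahler volume is $\mathcal{M}_p(K)=|K|\int_{\mathbb{R}^n}e^{-h_{p,K}(y)}\,dy\in(0,\infty]$. *)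

theory Defs
  imports "HOL-Analysis.Analysis"
begin

definition convex_body :: "(real ^ 'n) set \<Rightarrow> bool" where
  "convex_body K \<longleftrightarrow> compact K \<and> convex K \<and> interior K \<noteq> {}"

text \<open>The exponent ranges over the extended reals in order to include \<open>p = \<infinity>\<close>. Only
  \<open>0 < p\<close> and convex bodies \<open>K\<close> are meaningful; then the supremum is attained and the
  integral is finite and positive.\<close>

definition Lp_support :: "ereal \<Rightarrow> (real ^ 'n) set \<Rightarrow> real ^ 'n \<Rightarrow> real" where
  "Lp_support p K y =
     (if p = \<infinity> then (SUP x\<in>K. x \<bullet> y)
      else 1 / real_of_ereal p *
           ln (LINT x:K|lborel. exp (real_of_ereal p * (x \<bullet> y)) / measure lborel K))"

text \<open>The value is an extended nonnegative real because the integral is infinite when, for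
  example, \<open>K\<close> lies in a closed half-space whose bounding hyperplane contains the origin.\<close>

definition Lp_mahler :: "ereal \<Rightarrow> (real ^ 'n) set \<Rightarrow> ennreal" where
  "Lp_mahler p K =
     emeasure lborel K * (\<integral>\<^sup>+ y. ennreal (exp (- Lp_support p K y)) \<partial>lborel)"

definition euclidean_unit_ball :: "(real ^ 'n) set" where
  "euclidean_unit_ball = {x. (\<Sum>i\<in>UNIV. (x $ i)\<^sup>2) \<le> 1}"

lemma euclidean_unit_ball_eq_cball: "euclidean_unit_ball = cball 0 1"
  by (simp add: euclidean_unit_ball_def set_eq_iff norm_vec_def L2_set_def)

end

theory Submission
  imports Defs "HOL-Complex_Analysis.Great_Picard"
begin

text \<open>For finite \<open>p\<close> write \<open>M\<^sub>p(K) = |K|\<^bsup>1+1/p\<^esup> \<Phi>(K)\<close>, where \<open>\<Phi>(K)\<close> is the integral of \<open>(\<integral>\<^sub>K exp(p\<langle>x,y\<rangle>) dx)\<^bsup>-1/p\<^esup>\<close>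
  over \<open>y\<close>. Steiner symmetrization in a coordinate direction \<open>e\<close> does not decrease \<open>\<Phi>\<close>, provided that
  \<open>K\<close> is translated along \<open>e\<close> so that both half-spaces \<open>\<langle>y,e\<rangle> > 0\<close> and \<open>\<langle>y,e\<rangle> < 0\<close> carry the same part of
  the integral: convexity of \<open>exp\<close> on the fibres of \<open>K\<close> gives a multiplicative inequality between the
  integrands, which the Prekopa-Leindler inequality on hyperplanes and a harmonic-mean inequality of
  Ball on the half-line turn into an inequality of integrals (the scheme of Meyer and Pajor).
  Symmetrizing in all coordinate directions makes the body origin-symmetric, after which no
  translation is needed. Among the symmetric bodies of the same volume with at least the same \<open>\<Phi>\<close>,
  lying between two fixed balls, a compactness argument yields one that maximizes the volume of its
  intersection with the ball \<open>B\<close> of equal volume. If it were not \<open>B\<close>, a rotation followed by a further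
  symmetrization would enlarge this intersection. The case \<open>p = \<infinity>\<close> follows from \<open>M\<^sub>\<infinity> \<le> M\<^sub>p\<close> and
  \<open>M\<^sub>p(B) \<rightarrow> M\<^sub>\<infinity>(B)\<close>.\<close>

section \<open>Transport inequalities on the line\<close>

text \<open>The shape of the inequalities is dictated by the fibres. Let \<open>y\<close> have
  height \<open>t > 0\<close> along \<open>e\<close> and \<open>y'\<close> height
  \<open>- s < 0\<close>. A fibre of \<open>K\<close> with midpoint \<open>m\<close> adds
  \<open>m * (l * t - (1 - l) * s)\<close> to the combined exponent, and this vanishes on all fibres
  at once only for \<open>l = s / (s + t)\<close>. The combined point then has height
  \<open>2 * s * t / (s + t)\<close>, the harmonic mean of \<open>t\<close> and \<open>s\<close>;
  this is why the height variable calls for Ball's inequality, while Prekopa-Leindler handles the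
  hyperplanes. Equal integrals over the two half-lines are what balancing provides. Balancing is
  possible because translating \<open>K\<close> by \<open>t\<close> along \<open>e\<close>
  multiplies the integrand by \<open>exp (t * (y \<bullet> e))\<close>. One half-space integral
  grows with \<open>t\<close>, the other shrinks, and each becomes infinite at one end of the chord
  of \<open>K\<close>, so they cross in between. The right translation depends on the bodies
  produced later, hence translations are traced backwards from the final symmetric body to
  \<open>K\<close>. Rotations and symmetrizations keep both fixed balls inside and outside the body.
  The inner ball gives an integrable bound for all integrands, the outer one bounds the
  bodies.\<close>

lemma nn_integral_incseq_Icc:
  fixes h :: "real \<Rightarrow> ennreal"
  assumes [measurable]: "h \<in> borel_measurable borel"
    and mono: "decseq a" "incseq b" and cover: "\<And>x. x \<in> S \<longleftrightarrow> (\<exists>n::nat. a n \<le> x \<and> x \<le> b n)"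
  shows "(\<integral>\<^sup>+x\<in>S. h x \<partial>lborel) = (SUP n. \<integral>\<^sup>+x. h x * indicator {a n..b n} x \<partial>lborel)"
proof -
  have eq: "h x * indicator S x = (SUP n. h x * indicator {a n..b n} x)" for x
  proof (cases "x \<in> S")
    case True
    then obtain n where n: "a n \<le> x" "x \<le> b n" using cover by auto
    have "(SUP n. h x * indicator {a n..b n} x) = h x"
    proof (rule antisym)
      show "(SUP n. h x * indicator {a n..b n} x) \<le> h x"
        by (rule SUP_least) (simp add: indicator_def)
      show "h x \<le> (SUP n. h x * indicator {a n..b n} x)"
        by (rule SUP_upper2[of n]) (use n in auto)
    qed
    then show ?thesis using True by simp
  next
    case False
    then have "indicator {a n..b n} x = (0::ennreal)" for n using cover by (auto simp: indicator_def)
    then show ?thesis using False by simp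
  qed
  have "(\<integral>\<^sup>+x\<in>S. h x \<partial>lborel) = (\<integral>\<^sup>+x. (SUP n. h x * indicator {a n..b n} x) \<partial>lborel)"
    unfolding eq ..
  also have "\<dots> = (SUP n. \<integral>\<^sup>+x. h x * indicator {a n..b n} x \<partial>lborel)"
  proof (rule nn_integral_monotone_convergence_SUP)
    show "incseq (\<lambda>n x. h x * indicator {a n..b n} x)"
    proof (rule incseq_SucI, rule le_funI)
      fix n x
      have "a (Suc n) \<le> a n" "b n \<le> b (Suc n)" using mono by (auto simp: decseq_def incseq_def)
      then show "h x * indicator {a n..b n} x \<le> h x * indicator {a (Suc n)..b (Suc n)} x"
        by (auto simp: indicator_def)
    qed
  qed simp
  finally show ?thesis .
qed

text \<open>The integrand may take the value infinity. It is the supremum of the finite truncations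
  \<open>min (h x) n\<close>; substitution for real-valued functions applies to each of them and
  monotone convergence does the rest.\<close>

lemma nn_integral_substitution_Icc:
  fixes h :: "real \<Rightarrow> ennreal" and z z' :: "real \<Rightarrow> real"
  assumes [measurable]: "h \<in> borel_measurable borel"
    and d: "\<And>x. (z has_real_derivative z' x) (at x)" and c: "continuous_on UNIV z'"
    and nn: "\<And>x. 0 \<le> z' x" and ab: "a \<le> b"
  shows "(\<integral>\<^sup>+x\<in>{z a..z b}. h x \<partial>lborel)
       = (\<integral>\<^sup>+x\<in>{a..b}. h (z x) * ennreal (z' x) \<partial>lborel)"
proof -
  define k where "k n x = enn2real (min (h x) (of_nat n))" for n :: nat and x
  have kfin: "min (h x) (of_nat n) < \<infinity>" for n x
    by (metis ennreal_of_nat_neq_top infinity_ennreal_def min.strict_coboundedI2 top.not_eq_extremum)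
  have kmin: "ennreal (k n x) = min (h x) (of_nat n)" for n x
    unfolding k_def using kfin[of x n] by simp
  have [measurable]: "k n \<in> borel_measurable borel" for n
    unfolding k_def by measurable
  have hk: "h x = (SUP n. ennreal (k n x))" for x
  proof -
    have "(SUP n. min (h x) (of_nat n :: ennreal)) = min (h x) (SUP n. of_nat n)"
      by (simp add: inf_min[symmetric] inf_SUP)
    then show ?thesis by (simp add: kmin ennreal_SUP_of_nat_eq_top)
  qed
  have inck: "k n x \<le> k (Suc n) x" for n x
    unfolding k_def by (rule enn2real_mono) (use kfin[of x "Suc n"] in \<open>auto intro: min.coboundedI2 simp: min_le_iff_disj\<close>)
  have [measurable]: "z \<in> borel_measurable borel"
    by (rule borel_measurable_continuous_onI, rule DERIV_continuous_on) (use d in auto)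
  have [measurable]: "z' \<in> borel_measurable borel"
    by (rule borel_measurable_continuous_onI) (rule c)
  have n1: "(\<integral>\<^sup>+x\<in>{z a..z b}. ennreal (k n x) \<partial>lborel)
       = (\<integral>\<^sup>+x\<in>{a..b}. ennreal (k n (z x)) * ennreal (z' x) \<partial>lborel)" for n
  proof -
    have "(\<integral>\<^sup>+x. ennreal (k n x * indicator {z a..z b} x) \<partial>lborel)
       = (\<integral>\<^sup>+x. ennreal (k n (z x) * z' x * indicator {a..b} x) \<partial>lborel)"
      by (rule nn_integral_substitution)
         (use d nn ab in \<open>auto intro: continuous_on_subset[OF c] simp: set_borel_measurable_def\<close>)
    then show ?thesis
      using nn by (simp add: ennreal_mult'' k_def ennreal_indicator)
  qed
  have eq1: "h x * indicator {z a..z b} x = (SUP n. ennreal (k n x) * indicator {z a..z b} x)" for x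
    unfolding hk by (rule SUP_mult_right_ennreal)
  have eq2: "h (z x) * ennreal (z' x) * indicator {a..b} x
      = (SUP n. ennreal (k n (z x)) * ennreal (z' x) * indicator {a..b} x)" for x
    unfolding hk by (simp add: SUP_mult_right_ennreal mult.assoc)
  have "(\<integral>\<^sup>+x\<in>{z a..z b}. h x \<partial>lborel)
     = (SUP n. (\<integral>\<^sup>+x\<in>{z a..z b}. ennreal (k n x) \<partial>lborel))"
    unfolding eq1
    by (rule nn_integral_monotone_convergence_SUP)
       (auto intro!: incseq_SucI le_funI mult_right_mono ennreal_leI inck)
  also have "\<dots> = (\<integral>\<^sup>+x\<in>{a..b}. h (z x) * ennreal (z' x) \<partial>lborel)"
    unfolding eq2 n1
    by (rule nn_integral_monotone_convergence_SUP[symmetric])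
       (auto intro!: incseq_SucI le_funI mult_right_mono ennreal_leI inck)
  finally show ?thesis .
qed

lemma real_in_Icc_nat: "\<exists>n::nat. - real n \<le> x \<and> x \<le> real n"
proof -
  obtain n where "\<bar>x\<bar> \<le> real n" using real_arch_simple by blast
  then show ?thesis by (intro exI[of _ n]) auto
qed

text \<open>Equality can fail because the range of \<open>z\<close> may be a proper subinterval of
  the line: the images of the intervals from \<open>-n\<close> to \<open>n\<close> exhaust only that
  range.\<close>

lemma nn_integral_substitution_le:
  fixes h :: "real \<Rightarrow> ennreal" and z z' :: "real \<Rightarrow> real"
  assumes h[measurable]: "h \<in> borel_measurable borel"
    and d: "\<And>x. (z has_real_derivative z' x) (at x)" and c: "continuous_on UNIV z'"
    and nn: "\<And>x. 0 \<le> z' x"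
  shows "(\<integral>\<^sup>+x. h (z x) * ennreal (z' x) \<partial>lborel) \<le> (\<integral>\<^sup>+x. h x \<partial>lborel)"
proof -
  have [measurable]: "z \<in> borel_measurable borel"
    by (rule borel_measurable_continuous_onI, rule DERIV_continuous_on) (use d in auto)
  have [measurable]: "z' \<in> borel_measurable borel"
    by (rule borel_measurable_continuous_onI) (rule c)
  have "(\<integral>\<^sup>+x. h (z x) * ennreal (z' x) \<partial>lborel)
     = (SUP n::nat. \<integral>\<^sup>+x. h (z x) * ennreal (z' x) * indicator {-real n..real n} x \<partial>lborel)"
    by (subst nn_integral_incseq_Icc[symmetric, where S=UNIV])
       (use real_in_Icc_nat in \<open>auto simp: decseq_def incseq_def\<close>)
  also have "\<dots> = (SUP n::nat. \<integral>\<^sup>+x. h x * indicator {z (-real n)..z (real n)} x \<partial>lborel)"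
    by (intro SUP_cong refl nn_integral_substitution_Icc[symmetric] h d c nn) simp
  also have "\<dots> \<le> (\<integral>\<^sup>+x. h x \<partial>lborel)"
    by (intro SUP_least nn_integral_mono) (simp add: indicator_def)
  finally show ?thesis .
qed

lemma nn_integral_exp_substitution:
  fixes h :: "real \<Rightarrow> ennreal"
  assumes h[measurable]: "h \<in> borel_measurable borel"
  shows "(\<integral>\<^sup>+u. h (exp u) * ennreal (exp u) \<partial>lborel) = (\<integral>\<^sup>+t\<in>{0<..}. h t \<partial>lborel)"
proof -
  have "(\<integral>\<^sup>+x. h (exp x) * ennreal (exp x) \<partial>lborel)
     = (SUP n::nat. \<integral>\<^sup>+x. h (exp x) * ennreal (exp x) * indicator {-real n..real n} x \<partial>lborel)"
    by (subst nn_integral_incseq_Icc[symmetric, where S=UNIV])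
       (use real_in_Icc_nat in \<open>auto simp: decseq_def incseq_def\<close>)
  also have "\<dots> = (SUP n::nat. \<integral>\<^sup>+x. h x * indicator {exp (-real n)..exp (real n)} x \<partial>lborel)"
    by (intro SUP_cong refl nn_integral_substitution_Icc[symmetric] h)
       (auto intro!: derivative_eq_intros continuous_intros)
  also have "\<dots> = (\<integral>\<^sup>+t\<in>{0<..}. h t \<partial>lborel)"
  proof (rule nn_integral_incseq_Icc[symmetric])
    fix x :: real
    show "(x \<in> {0<..}) = (\<exists>n::nat. exp (- real n) \<le> x \<and> x \<le> exp (real n))"
    proof
      assume "x \<in> {0<..}"
      then have x: "0 < x" by simp
      obtain n :: nat where "- real n \<le> ln x \<and> ln x \<le> real n" using real_in_Icc_nat by blast
      then have "exp (- real n) \<le> exp (ln x)" "exp (ln x) \<le> exp (real n)" by (auto simp del: exp_ln)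
      then show "\<exists>n::nat. exp (- real n) \<le> x \<and> x \<le> exp (real n)" using x by auto
    qed (auto intro: less_le_trans[OF exp_gt_zero])
  qed (auto simp: decseq_def incseq_def)
  finally show ?thesis .
qed

text \<open>With the cumulative functions \<open>F\<close> and \<open>G\<close>, the map
  \<open>T\<close> is defined by equality of mass fractions, \<open>F x / A = G (T x) / B\<close>.
  Differentiating gives the stated equation. Continuity and positivity of the densities make it hold
  at every point and not only almost everywhere, so \<open>T\<close> is usable in an ordinary
  substitution.\<close>

lemma transport_map_exists:
  fixes f g :: "real \<Rightarrow> real"
  assumes f: "continuous_on UNIV f" "\<And>x. 0 < f x" "(\<integral>\<^sup>+x. ennreal (f x) \<partial>lborel) = ennreal A" "0 < A"
    and g: "continuous_on UNIV g" "\<And>x. 0 < g x" "(\<integral>\<^sup>+x. ennreal (g x) \<partial>lborel) = ennreal B" "0 < B"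
  shows "\<exists>T. \<forall>x. (T has_real_derivative (f x * B / (A * g (T x)))) (at x)"
proof -
  \<comment> \<open>Applied to both densities: the cumulative function is a primitive whose range is
    exactly the open interval from 0 to the total mass.\<close>
  have cum: "\<exists>F. (\<forall>x. (F has_real_derivative f x) (at x)) \<and> (\<forall>x. 0 < F x \<and> F x < A)
      \<and> (\<forall>y. 0 < y \<longrightarrow> y < A \<longrightarrow> (\<exists>x. F x = y))"
    if f: "continuous_on UNIV f" "\<And>x. 0 < f x" "(\<integral>\<^sup>+x. ennreal (f x) \<partial>lborel) = ennreal A" "0 < A"
    for f :: "real \<Rightarrow> real" and A
  proof -
    have [measurable]: "f \<in> borel_measurable borel"
      by (rule borel_measurable_continuous_onI) (rule f)
    have int: "integrable lborel f"
      by (rule integrableI_nonneg) (use f in \<open>auto intro: less_imp_le\<close>)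
    have tot: "integral\<^sup>L lborel f = A"
      by (subst integral_eq_nn_integral) (use f in \<open>auto intro: less_imp_le\<close>)
    define F where "F x = (LINT t:{..x}|lborel. f t)" for x
    have sint: "set_integrable lborel S f" if "S \<in> sets borel" for S
      unfolding set_integrable_def
      by (rule integrable_mult_indicator) (use int that in auto)
    have F_diff: "F y - F x = integral {x..y} f" if "x \<le> y" for x y
    proof -
      have e: "{..y} = {..x} \<union> {x<..y}" using that by auto
      have "F y = F x + (LINT t:{x<..y}|lborel. f t)"
        unfolding F_def e by (rule set_integral_Un) (auto intro: sint)
      moreover have "(LINT t:{x<..y}|lborel. f t) = (LINT t:{x..y}|lborel. f t)"
        unfolding set_lebesgue_integral_def
      proof (rule integral_cong_AE)
        show "AE t in lborel. indicat_real {x<..y} t *\<^sub>R f t = indicat_real {x..y} t *\<^sub>R f t"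
          using AE_lborel_singleton[of x] by eventually_elim (auto simp: indicator_def)
      qed auto
      moreover have "(LINT t:{x..y}|lborel. f t) = integral {x..y} f"
        by (rule set_borel_integral_eq_integral) (auto intro: sint)
      ultimately show ?thesis by simp
    qed
    have deriv: "(F has_real_derivative f x) (at x)" for x
    proof -
      have "((\<lambda>u. integral {x - 1..u} f) has_real_derivative f x) (at x within {x - 1..x + 1})"
        by (rule integral_has_real_derivative) (auto intro: continuous_on_subset[OF f(1)])
      then have "((\<lambda>u. integral {x - 1..u} f) has_real_derivative f x) (at x)"
        by (simp add: at_within_Icc_at)
      then have "((\<lambda>u. F (x-1) + integral {x - 1..u} f) has_real_derivative f x) (at x)"
        by (auto intro!: derivative_eq_intros)
      then show ?thesis
      proof (rule has_field_derivative_transform_within_open[where S="{x-1<..<x+1}"])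
        fix u assume "u \<in> {x-1<..<x+1}"
        then show "F (x-1) + integral {x - 1..u} f = F u" using F_diff[of "x-1" u] by simp
      qed auto
    qed
    have mono: "F x < F y" if "x < y" for x y
      by (rule DERIV_pos_imp_increasing[OF that]) (use deriv f(2) in auto)
    have lim: "((\<lambda>x. LINT t:{a..x}|lborel. f t) \<longlongrightarrow> (LINT t:{a..}|lborel. f t)) at_top" for a
      by (rule tendsto_set_lebesgue_integral_at_top) (auto intro: sint)
    have split: "A = F a + (LINT t:{a..}|lborel. f t)" for a
    proof -
      have "(LINT t:{..a} \<union> {a<..}|lborel. f t) = F a + (LINT t:{a<..}|lborel. f t)"
        unfolding F_def by (rule set_integral_Un) (auto intro: sint)
      moreover have "{..a} \<union> {a<..} = (UNIV :: real set)" by auto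
      moreover have "(LINT t:{a<..}|lborel. f t) = (LINT t:{a..}|lborel. f t)"
        unfolding set_lebesgue_integral_def
      proof (rule integral_cong_AE)
        show "AE t in lborel. indicat_real {a<..} t *\<^sub>R f t = indicat_real {a..} t *\<^sub>R f t"
          using AE_lborel_singleton[of a] by eventually_elim (auto simp: indicator_def)
      qed auto
      ultimately show ?thesis using tot by (simp add: set_lebesgue_integral_def)
    qed
    have top: "(F \<longlongrightarrow> A) at_top"
    proof -
      have "((\<lambda>x. F 0 + (LINT t:{0..x}|lborel. f t)) \<longlongrightarrow> A) at_top"
        using tendsto_add[OF tendsto_const lim[of 0], of "F 0"] split[of 0] by simp
      then show ?thesis
      proof (rule Lim_transform_eventually)
        show "\<forall>\<^sub>F x in at_top. F 0 + (LINT t:{0..x}|lborel. f t) = F x"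
          using eventually_ge_at_top[of 0]
        proof eventually_elim
          case (elim x)
          have "(LINT t:{0..x}|lborel. f t) = integral {0..x} f"
            by (rule set_borel_integral_eq_integral) (auto intro: sint)
          with F_diff[OF elim] show ?case by simp
        qed
      qed
    qed
    have bot: "(F \<longlongrightarrow> 0) at_bot"
    proof -
      have "((\<lambda>a. LINT t:{a..0}|lborel. f t) \<longlongrightarrow> (LINT t:{..0}|lborel. f t)) at_bot"
        by (rule tendsto_set_lebesgue_integral_at_bot) (auto intro: sint)
      then have "((\<lambda>a. F 0 - (LINT t:{a..0}|lborel. f t)) \<longlongrightarrow> 0) at_bot"
        unfolding F_def by (auto intro!: tendsto_eq_intros)
      then show ?thesis
      proof (rule Lim_transform_eventually)
        show "\<forall>\<^sub>F x in at_bot. F 0 - (LINT t:{x..0}|lborel. f t) = F x"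
          using eventually_le_at_bot[of 0]
        proof eventually_elim
          case (elim x)
          have "(LINT t:{x..0}|lborel. f t) = integral {x..0} f"
            by (rule set_borel_integral_eq_integral) (auto intro: sint)
          with F_diff[OF elim] show ?case by simp
        qed
      qed
    qed
    have F_ge: "0 \<le> F x" for x
      unfolding F_def set_lebesgue_integral_def by (rule Bochner_Integration.integral_nonneg) (simp add: less_imp_le[OF f(2)])
    have F_le: "F x \<le> A" for x
    proof -
      have "0 \<le> (LINT t:{x..}|lborel. f t)"
        unfolding set_lebesgue_integral_def by (rule Bochner_Integration.integral_nonneg) (simp add: less_imp_le[OF f(2)])
      with split[of x] show ?thesis by simp
    qed
    have rng: "0 < F x \<and> F x < A" for x
      using mono[of "x-1" x] mono[of x "x+1"] F_ge[of "x-1"] F_le[of "x+1"] by auto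
    have "\<exists>x. F x = y" if y: "0 < y" "y < A" for y
    proof -
      obtain b where b: "y < F b"
        using order_tendstoD(1)[OF top y(2)] eventually_happens'[OF trivial_limit_at_top_linorder] by blast
      obtain a where a: "F a < y"
        using order_tendstoD(2)[OF bot y(1)] eventually_happens'[OF trivial_limit_at_bot_linorder] by blast
      have "a \<le> b" using a b mono[of b a] by (smt (verit))
      then have "\<exists>x\<ge>a. x \<le> b \<and> F x = y"
        by (intro IVT) (use a b deriv DERIV_isCont in auto)
      then show ?thesis by blast
    qed
    then show ?thesis using deriv rng by blast
  qed
  obtain F where F: "\<And>x. (F has_real_derivative f x) (at x)" "\<And>x. 0 < F x \<and> F x < A"
    using cum[OF f] by blast
  obtain G where G: "\<And>x. (G has_real_derivative g x) (at x)" "\<And>x. 0 < G x \<and> G x < B"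
      "\<And>y. 0 < y \<Longrightarrow> y < B \<Longrightarrow> \<exists>x. G x = y"
    using cum[OF g] by blast
  have Gmono: "G x < G y" if "x < y" for x y
    by (rule DERIV_pos_imp_increasing[OF that]) (use G(1) g(2) in blast)
  then have Ginj: "inj G" by (intro strict_mono_imp_inj_on) (simp add: strict_mono_def)
  define H where "H = inv G"
  have HG: "H (G x) = x" for x unfolding H_def using Ginj by (rule inv_f_f)
  have GH: "G (H y) = y" if "0 < y" "y < B" for y
    unfolding H_def using G(3)[OF that] by (auto intro: f_inv_into_f)
  have Hcont: "isCont H (G x)" for x
    by (rule isCont_inverse_function[where f=G and d=1]) (use HG DERIV_isCont[OF G(1)] in auto)
  have Hd: "(H has_real_derivative inverse (g (H y))) (at y)" if "0 < y" "y < B" for y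
  proof (rule DERIV_inverse_function[where f=G and a=0 and b=B])
    show "isCont H y" using Hcont[of "H y"] GH[OF that] by simp
  qed (use G(1) g(2)[of "H y"] that GH in auto)
  define T where "T x = H (F x * (B / A))" for x
  have "(T has_real_derivative (f x * B / (A * g (T x)))) (at x)" for x
  proof -
    have r: "0 < F x * (B / A)" "F x * (B / A) < B"
      using F(2)[of x] f(4) g(4) by (auto simp: field_simps)
    have "((\<lambda>x. H (F x * (B / A))) has_real_derivative inverse (g (H (F x * (B / A)))) * (f x * (B / A))) (at x)"
      by (rule DERIV_chain2[where f=H and g="\<lambda>x. F x * (B / A)", OF Hd[OF r]]) (use f(4) in \<open>auto intro!: derivative_eq_intros F\<close>)
    then show ?thesis unfolding T_def by (simp add: field_simps)
  qed
  then show ?thesis by blast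
qed

text \<open>The common scheme behind the arithmetic and the harmonic inequality.
  \<open>m x y\<close> is the mean in question and \<open>D x y q\<close> the derivative of
  \<open>m x (T x)\<close> when \<open>T\<close> has value \<open>y\<close> and slope
  \<open>q\<close> at \<open>x\<close>. The pointwise bound \<open>key\<close> is required only for
  triples related by the transport equation; integrating it and substituting
  \<open>m x (T x)\<close> yields the claim.\<close>

lemma transport_inequality:
  fixes f g :: "real \<Rightarrow> real" and h :: "real \<Rightarrow> ennreal" and m :: "real \<Rightarrow> real \<Rightarrow> real"
    and D :: "real \<Rightarrow> real \<Rightarrow> real \<Rightarrow> real"
  assumes f: "continuous_on UNIV f" "\<And>x. 0 < f x" "(\<integral>\<^sup>+x. ennreal (f x) \<partial>lborel) = ennreal A" "0 < A"
    and g: "continuous_on UNIV g" "\<And>x. 0 < g x" "(\<integral>\<^sup>+x. ennreal (g x) \<partial>lborel) = ennreal B" "0 < B"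
    and h[measurable]: "h \<in> borel_measurable borel"
    and deriv: "\<And>T T' x. (T has_real_derivative T') (at x) \<Longrightarrow>
        ((\<lambda>x. m x (T x)) has_real_derivative D x (T x) T') (at x)"
    and cont: "\<And>T T'. continuous_on UNIV T \<Longrightarrow> continuous_on UNIV T' \<Longrightarrow>
        continuous_on UNIV (\<lambda>x. D x (T x) (T' x))"
    and nonneg: "\<And>x y q. 0 < q \<Longrightarrow> 0 \<le> D x y q" and c: "0 \<le> c"
    and key: "\<And>x y q. 0 < q \<Longrightarrow> f x * B = q * (A * g y) \<Longrightarrow>
        ennreal (c * f x) \<le> h (m x y) * ennreal (D x y q)"
  shows "ennreal (c * A) \<le> (\<integral>\<^sup>+x. h x \<partial>lborel)"
proof -
  obtain T where T: "\<And>x. (T has_real_derivative (f x * B / (A * g (T x)))) (at x)"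
    using transport_map_exists[OF f g] by blast
  define T' where "T' x = f x * B / (A * g (T x))" for x
  have T'pos: "0 < T' x" for x
    unfolding T'_def using f g by simp
  have Tc: "continuous_on UNIV T"
    by (rule DERIV_continuous_on) (use T in auto)
  have T'c: "continuous_on UNIV T'"
    unfolding T'_def using f(4) g(2)
    by (intro continuous_intros f continuous_on_compose2[OF g(1) Tc]) (auto simp: less_imp_neq[symmetric])
  have [measurable]: "f \<in> borel_measurable borel"
    by (rule borel_measurable_continuous_onI) (rule f)
  have "ennreal (c * A) = (\<integral>\<^sup>+x. ennreal (c * f x) \<partial>lborel)"
    using c f by (simp add: ennreal_mult nn_integral_cmult less_imp_le)
  also have "\<dots> \<le> (\<integral>\<^sup>+x. h (m x (T x)) * ennreal (D x (T x) (T' x)) \<partial>lborel)"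
    by (intro nn_integral_mono key T'pos) (use f g in \<open>simp add: T'_def less_imp_neq[symmetric]\<close>)
  also have "\<dots> \<le> (\<integral>\<^sup>+x. h x \<partial>lborel)"
    by (intro nn_integral_substitution_le h cont Tc T'c nonneg T'pos deriv)
       (use T in \<open>simp add: T'_def\<close>)
  finally show ?thesis .
qed

lemma prekopa_leindler_real:
  fixes f g :: "real \<Rightarrow> real" and h :: "real \<Rightarrow> ennreal"
  assumes f: "continuous_on UNIV f" "\<And>x. 0 < f x" "(\<integral>\<^sup>+x. ennreal (f x) \<partial>lborel) = ennreal A" "0 < A"
    and g: "continuous_on UNIV g" "\<And>x. 0 < g x" "(\<integral>\<^sup>+x. ennreal (g x) \<partial>lborel) = ennreal B" "0 < B"
    and h: "h \<in> borel_measurable borel" and l: "0 < l" "l < 1"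
    and fgh: "\<And>x y. ennreal (f x powr l * g y powr (1 - l)) \<le> h (l * x + (1 - l) * y)"
  shows "ennreal (A powr l * B powr (1 - l)) \<le> (\<integral>\<^sup>+x. h x \<partial>lborel)"
proof -
  \<comment> \<open>The constant is the value of \<open>c\<close> for which the pointwise bound
    holds with equality in the powers of \<open>A\<close> and \<open>B\<close>; multiplied by
    \<open>A\<close> it is the geometric mean of the integrals.\<close>
  have "ennreal ((B / A) powr (1 - l) * A) \<le> (\<integral>\<^sup>+x. h x \<partial>lborel)"
  proof (rule transport_inequality[OF f g h, where m="\<lambda>x y. l * x + (1 - l) * y" and D="\<lambda>x y q. l + (1 - l) * q"])
    fix x y q :: real assume q: "0 < q" and eq: "f x * B = q * (A * g y)"
    \<comment> \<open>Weighted AM-GM for the slopes 1 and \<open>q\<close> of the two maps; the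
      transport equation then expresses \<open>q\<close> through \<open>f x / g y\<close>, which
      leaves \<open>f x\<close> on the left.\<close>
    have "q powr (1 - l) \<le> l + (1 - l) * q"
      using Youngs_inequality_0[of l "1 - l" 1 q] l q by simp
    moreover have "(B / A) powr (1 - l) * f x = f x powr l * g y powr (1 - l) * q powr (1 - l)"
    proof -
      have q': "q = f x * (B / A) / g y" using eq f(4) g(2)[of y] by (simp add: field_simps)
      have "q powr (1 - l) = f x powr (1 - l) * (B / A) powr (1 - l) / g y powr (1 - l)"
        unfolding q' using f(2,4) g(2,4) by (simp add: powr_mult powr_divide less_imp_le)
      moreover have "f x powr l * f x powr (1 - l) = f x"
        using f(2)[of x] by (simp flip: powr_add)
      moreover have "0 < g y powr (1 - l)" using g(2)[of y] by simp
      ultimately show ?thesis by (simp add: field_simps)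
    qed
    ultimately have "(B / A) powr (1 - l) * f x \<le> f x powr l * g y powr (1 - l) * (l + (1 - l) * q)"
      by (simp add: mult_left_mono)
    then have "ennreal ((B / A) powr (1 - l) * f x) \<le> ennreal (f x powr l * g y powr (1 - l)) * ennreal (l + (1 - l) * q)"
      using l q by (subst ennreal_mult[symmetric]) (auto intro!: ennreal_leI)
    also have "\<dots> \<le> h (l * x + (1 - l) * y) * ennreal (l + (1 - l) * q)"
      by (intro mult_right_mono fgh) simp
    finally show "ennreal ((B / A) powr (1 - l) * f x) \<le> h (l * x + (1 - l) * y) * ennreal (l + (1 - l) * q)" .
  qed (use l in \<open>auto intro!: derivative_eq_intros continuous_intros\<close>)
  moreover have "(B / A) powr (1 - l) * A = A powr l * B powr (1 - l)"
  proof -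
    have "A powr l * A powr (1 - l) = A" using f(4) by (simp flip: powr_add)
    moreover have "0 < A powr (1 - l)" using f(4) by simp
    ultimately show ?thesis using f(4) g(4) by (simp add: powr_divide field_simps)
  qed
  ultimately show ?thesis by simp
qed

text \<open>The entropy of the distribution with weights \<open>l\<close> and \<open>1 - l\<close>
  is at most \<open>ln 2\<close>. The factor 2 is the one in the harmonic mean, and this estimate is
  where Ball's inequality consumes it.\<close>

lemma half_le_powr_self:
  fixes l :: real assumes "0 < l" "l < 1"
  shows "1 \<le> 2 * (l powr l * (1 - l) powr (1 - l))"
proof -
  have "(1 / l) powr l * (1 / (1 - l)) powr (1 - l) \<le> l * (1 / l) + (1 - l) * (1 / (1 - l))"
    by (rule Youngs_inequality_0) (use assms in auto)
  also have "\<dots> = 2" using assms by simp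
  finally have "1 / (l powr l) * (1 / (1 - l) powr (1 - l)) \<le> 2"
    using assms by (simp add: powr_divide)
  moreover have "0 < l powr l" "0 < (1 - l) powr (1 - l)" using assms by auto
  ultimately show ?thesis by (simp add: field_simps)
qed

text \<open>Only the case of equal integrals is needed; substituting \<open>t = exp u\<close> brings it into the scope of
  the transport inequality on the whole line.\<close>
lemma ball_harmonic_inequality:
  fixes f g :: "real \<Rightarrow> real" and h :: "real \<Rightarrow> ennreal"
  assumes f: "continuous_on UNIV f" "\<And>x. 0 < f x"
    "(\<integral>\<^sup>+x\<in>{0<..}. ennreal (f x) \<partial>lborel) = ennreal A" "0 < A"
    and g: "continuous_on UNIV g" "\<And>x. 0 < g x"
    "(\<integral>\<^sup>+x\<in>{0<..}. ennreal (g x) \<partial>lborel) = ennreal A"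
    and h[measurable]: "h \<in> borel_measurable borel"
    and fgh: "\<And>t s. 0 < t \<Longrightarrow> 0 < s \<Longrightarrow>
        ennreal (f t powr (s / (s + t)) * g s powr (t / (s + t))) \<le> h (2 * s * t / (s + t))"
  shows "ennreal A \<le> (\<integral>\<^sup>+x\<in>{0<..}. h x \<partial>lborel)"
proof -
  have [measurable]: "f \<in> borel_measurable borel" "g \<in> borel_measurable borel"
    using f(1) g(1) by (auto intro: borel_measurable_continuous_onI)
  have fi: "(\<integral>\<^sup>+u. ennreal (f (exp u) * exp u) \<partial>lborel) = ennreal A"
    using nn_integral_exp_substitution[of "\<lambda>x. ennreal (f x)"] f by (simp add: ennreal_mult less_imp_le)
  have gi: "(\<integral>\<^sup>+u. ennreal (g (exp u) * exp u) \<partial>lborel) = ennreal A"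
    using nn_integral_exp_substitution[of "\<lambda>x. ennreal (g x)"] g by (simp add: ennreal_mult less_imp_le)
  \<comment> \<open>In logarithmic coordinates \<open>t = exp u\<close>, \<open>s = exp v\<close>
    the value \<open>exp (m u v)\<close> is \<open>2 * s * t / (s + t)\<close>. The slope
    \<open>D u v q\<close> equals \<open>l + (1 - l) * q\<close> with
    \<open>l = s / (s + t)\<close>, the same weight that occurs in the hypothesis on
    \<open>f\<close>, \<open>g\<close> and \<open>h\<close>.\<close>
  define m :: "real \<Rightarrow> real \<Rightarrow> real" where "m u v = ln 2 - ln (exp (- u) + exp (- v))" for u v
  define D :: "real \<Rightarrow> real \<Rightarrow> real \<Rightarrow> real"
    where "D u v q = (exp (- u) + q * exp (- v)) / (exp (- u) + exp (- v))" for u v q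
  have pos: "0 < exp (- u) + exp (- v)" for u v :: real by (simp add: add_pos_pos)
  have ne: "exp (- u) + exp (- v) \<noteq> 0" for u v :: real using pos[of u v] by simp
  have "ennreal (1 * A) \<le> (\<integral>\<^sup>+w. h (exp w) * ennreal (exp w) \<partial>lborel)"
  proof (rule transport_inequality[OF _ _ fi f(4) _ _ gi f(4), where m=m and D=D])
    fix T T' x assume [derivative_intros]: "(T has_real_derivative T') (at x)"
    show "((\<lambda>x. m x (T x)) has_real_derivative D x (T x) T') (at x)"
      unfolding m_def D_def by (rule derivative_eq_intros refl pos | simp)+ (simp add: divide_simps)
  next
    fix T T' :: "real \<Rightarrow> real" assume "continuous_on UNIV T" "continuous_on UNIV T'"
    then show "continuous_on UNIV (\<lambda>x. D x (T x) (T' x))"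
      unfolding D_def by (auto intro!: continuous_intros simp: ne)
  next
    fix x y q :: real assume "0 < q" then show "0 \<le> D x y q"
      unfolding D_def using pos[of x y] by (auto intro!: divide_nonneg_pos add_nonneg_nonneg)
  next
    fix u v q :: real assume q: "0 < q" and eq: "f (exp u) * exp u * A = q * (A * (g (exp v) * exp v))"
    define t s where "t = exp u" and "s = exp v"
    have ts: "0 < t" "0 < s" by (auto simp: t_def s_def)
    define l where "l = s / (s + t)"
    have l: "0 < l" "l < 1" using ts by (auto simp: l_def field_simps)
    have l1: "1 - l = t / (s + t)" using ts by (simp add: l_def field_simps)
    have em: "exp (m u v) = 2 * s * t / (s + t)"
      using ts by (simp add: m_def exp_diff pos exp_minus flip: t_def s_def) (simp add: field_simps)
    have D: "D u v q = l + (1 - l) * q"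
      unfolding l1 unfolding D_def l_def exp_minus t_def[symmetric] s_def[symmetric] using ts
      by (simp add: divide_simps)
    have q': "q = f t / g s * (t / s)" using eq f(4) g(2)[of s] ts by (simp add: field_simps flip: t_def s_def)
    have young: "q powr (1 - l) \<le> l + (1 - l) * q"
      using Youngs_inequality_0[of l "1 - l" 1 q] l q by simp
    have tl: "2 * s * t / (s + t) = 2 * l * t" by (simp add: l_def)
    have tds: "t / s = (1 - l) / l" unfolding l1 using ts by (simp add: l_def)
    have fp: "f t powr l * f t powr (1 - l) = f t"
      using f(2)[of t] by (simp flip: powr_add)
    have lp: "l powr l * l powr (1 - l) = l" using l by (simp flip: powr_add)
    have qp: "q powr (1 - l) = f t powr (1 - l) / g s powr (1 - l) * ((1 - l) powr (1 - l) / l powr (1 - l))"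
      unfolding q' tds using f(2)[of t] g(2)[of s] l by (simp add: powr_mult powr_divide less_imp_le)
    \<comment> \<open>By the transport equation the powers of \<open>g s\<close> cancel and those of
      \<open>f t\<close> combine to \<open>f t\<close>, so the product on the right reduces to
      \<open>f t * t\<close> times the entropy factor, which is at least 1.\<close>
    have "f t * t \<le> f t * t * (2 * (l powr l * (1 - l) powr (1 - l)))"
      using mult_left_mono[OF half_le_powr_self[OF l], of "f t * t"] f(2)[of t] ts by simp
    also have "\<dots> = (f t powr l * g s powr (1 - l)) * (2 * l * t) * q powr (1 - l)"
    proof -
      have "(f t powr l * g s powr (1 - l)) * (2 * l * t) * q powr (1 - l)
        = (f t powr l * f t powr (1 - l)) * (2 * (l / l powr (1 - l)) * t) * (1 - l) powr (1 - l)"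
        unfolding qp using g(2)[of s] by (simp add: field_simps)
      also have "l / l powr (1 - l) = l powr l" using lp l by (simp add: field_simps)
      finally show ?thesis unfolding fp by argo
    qed
    also have "\<dots> \<le> (f t powr l * g s powr (1 - l)) * (2 * l * t) * (l + (1 - l) * q)"
      using young l ts by (intro mult_left_mono) auto
    finally have "ennreal (f t * t) \<le> ennreal ((f t powr l * g s powr (1 - l)) * (2 * l * t) * (l + (1 - l) * q))"
      by (rule ennreal_leI)
    also have "\<dots> = ennreal (f t powr l * g s powr (1 - l)) * (ennreal (2 * l * t) * ennreal (l + (1 - l) * q))"
      using l q ts by (simp add: ennreal_mult mult.assoc del: ennreal_plus)
    also have "\<dots> \<le> h (2 * l * t) * (ennreal (2 * l * t) * ennreal (l + (1 - l) * q))"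
      using fgh[OF ts] unfolding tl l_def[symmetric] l1[symmetric] by (intro mult_right_mono) auto
    finally show "ennreal (1 * (f (exp u) * exp u)) \<le> h (exp (m u v)) * ennreal (exp (m u v)) * ennreal (D u v q)"
      unfolding em D tl by (simp add: mult.assoc flip: t_def)
  qed (use f g in \<open>auto intro!: continuous_intros continuous_on_compose2[of UNIV f] continuous_on_compose2[of UNIV g]\<close>)
  then show ?thesis by (simp add: nn_integral_exp_substitution)
qed

section \<open>The Prekopa-Leindler inequality\<close>

text \<open>Positive functions with Lipschitz logarithm have the advantage that all their marginals are
  again such functions: they are finite and continuous at every point once the integral is finite.\<close>

lemma loglip_continuous:
  fixes f :: "real \<Rightarrow> real"
  assumes ll: "\<And>t s. f t \<le> exp (C * \<bar>t - s\<bar>) * f s"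
  shows "continuous_on UNIV f"
proof (rule continuous_at_imp_continuous_on, rule ballI)
  fix s
  have "(f \<longlongrightarrow> f s) (at s)"
  proof (rule tendsto_sandwich)
    show "\<forall>\<^sub>F t in at s. exp (- C * \<bar>t - s\<bar>) * f s \<le> f t"
    proof (rule always_eventually, rule allI)
      fix t
      have "exp (- C * \<bar>t - s\<bar>) * f s \<le> exp (- C * \<bar>t - s\<bar>) * (exp (C * \<bar>s - t\<bar>) * f t)"
        by (intro mult_left_mono ll) simp
      also have "\<dots> = f t"
        by (simp add: abs_minus_commute[of s t] mult.assoc[symmetric] flip: exp_add)
      finally show "exp (- C * \<bar>t - s\<bar>) * f s \<le> f t" .
    qed
    show "\<forall>\<^sub>F t in at s. f t \<le> exp (C * \<bar>t - s\<bar>) * f s" by (simp add: ll)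
    have "((\<lambda>t. exp (c * \<bar>t - s\<bar>) * f s) \<longlongrightarrow> exp (c * \<bar>s - s\<bar>) * f s) (at s)" for c
      by (intro tendsto_intros)
    from this[of "- C"] this[of C]
    show "((\<lambda>t. exp (- C * \<bar>t - s\<bar>) * f s) \<longlongrightarrow> f s) (at s)"
      "((\<lambda>t. exp (C * \<bar>t - s\<bar>) * f s) \<longlongrightarrow> f s) (at s)" by simp_all
  qed
  then show "isCont f s" by (simp add: isCont_def)
qed

text \<open>The factor \<open>exp (C * \<bar>t - s\<bar>)\<close> does not depend on
  \<open>x\<close> and can be taken out of the integral. Hence one finite value makes all values
  finite, and a finite value exists since the integral over the set \<open>S\<close> of infinite
  measure is finite.\<close>

lemma loglip_marginal:
  fixes F :: "'b \<Rightarrow> real \<Rightarrow> real"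
  assumes meas[measurable]: "\<And>t. (\<lambda>x. F x t) \<in> borel_measurable N"
    and pos: "\<And>x t. 0 < F x t" and ll: "\<And>x t s. F x t \<le> exp (C * \<bar>t - s\<bar>) * F x s"
    and N: "emeasure N (space N) \<noteq> 0"
    and fin: "(\<integral>\<^sup>+t\<in>S. (\<integral>\<^sup>+x. ennreal (F x t) \<partial>N) \<partial>lborel) < \<infinity>"
    and S: "S \<in> sets borel" "emeasure lborel S = \<infinity>"
  obtains f where "continuous_on UNIV f" "\<And>t. 0 < f t" "\<And>t. (\<integral>\<^sup>+x. ennreal (F x t) \<partial>N) = ennreal (f t)"
    "\<And>t s. f t \<le> exp (C * \<bar>t - s\<bar>) * f s"
proof -
  define G where "G t = (\<integral>\<^sup>+x. ennreal (F x t) \<partial>N)" for t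
  have Gll: "G t \<le> ennreal (exp (C * \<bar>t - s\<bar>)) * G s" for t s
  proof -
    have "G t \<le> (\<integral>\<^sup>+x. ennreal (exp (C * \<bar>t - s\<bar>)) * ennreal (F x s) \<partial>N)"
      unfolding G_def using ll pos by (intro nn_integral_mono) (simp add: less_imp_le ennreal_leI flip: ennreal_mult)
    then show ?thesis unfolding G_def by (simp add: nn_integral_cmult)
  qed
  have "\<exists>t0. G t0 < \<infinity>"
  proof (rule ccontr)
    assume "\<not> ?thesis"
    then have "G t = \<infinity>" for t by (metis infinity_ennreal_def top.not_eq_extremum)
    then have "(\<integral>\<^sup>+t\<in>S. G t \<partial>lborel) = \<infinity> * emeasure lborel S"
      using S by (simp add: nn_integral_cmult_indicator)
    also have "\<dots> = \<infinity>" using S by (simp add: ennreal_mult_top)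
    finally show False using fin unfolding G_def by simp
  qed
  then obtain t0 where t0: "G t0 < \<infinity>" by blast
  have Gfin: "G t < \<infinity>" for t
    using le_less_trans[OF Gll[of t t0]] t0 by (simp add: ennreal_mult_less_top)
  have Gpos: "0 < G t" for t
  proof -
    have "G t \<noteq> 0"
    proof
      assume "G t = 0"
      then have "AE x in N. ennreal (F x t) = 0" unfolding G_def by (simp add: nn_integral_0_iff_AE)
      then have "AE x in N. False"
      proof eventually_elim
        case (elim x)
        then show False using pos[of x t] by (simp add: ennreal_eq_0_iff)
      qed
      then show False using N by (simp add: AE_iff_measurable[OF _ refl])
    qed
    then show ?thesis by (simp add: zero_less_iff_neq_zero)
  qed
  define f where "f t = enn2real (G t)" for t
  have Gf: "G t = ennreal (f t)" for t unfolding f_def using Gfin[of t] by simp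
  have fpos: "0 < f t" for t unfolding f_def using Gfin[of t] Gpos[of t] by (simp add: enn2real_positive_iff)
  have fll: "f t \<le> exp (C * \<bar>t - s\<bar>) * f s" for t s
    using Gll[of t s] fpos[of s] unfolding Gf by (simp add: less_imp_le flip: ennreal_mult)
  show ?thesis
    by (rule that[of f]) (use fpos fll Gf loglip_continuous[of f C] in \<open>auto simp: G_def\<close>)
qed

text \<open>The usual induction on the dimension: the induction hypothesis for the slices at heights
  \<open>t\<close> and \<open>s\<close> is the pointwise hypothesis of the one-dimensional
  inequality for the marginals. The sum of coordinate distances restricts to slices and passes to
  marginals with the same constant \<open>C\<close>.\<close>

lemma prekopa_leindler_PiM:
  fixes f g :: "('i \<Rightarrow> real) \<Rightarrow> real" and h :: "('i \<Rightarrow> real) \<Rightarrow> ennreal"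
  assumes "finite I" and l: "0 < l" "l < 1"
    and "f \<in> borel_measurable (\<Pi>\<^sub>M i\<in>I. lborel)" "\<And>x. 0 < f x"
      "\<And>x y. f x \<le> exp (C * (\<Sum>i\<in>I. \<bar>x i - y i\<bar>)) * f y"
    and "g \<in> borel_measurable (\<Pi>\<^sub>M i\<in>I. lborel)" "\<And>x. 0 < g x"
      "\<And>x y. g x \<le> exp (C * (\<Sum>i\<in>I. \<bar>x i - y i\<bar>)) * g y"
    and "h \<in> borel_measurable (\<Pi>\<^sub>M i\<in>I. lborel)"
    and "\<And>x y. ennreal (f x powr l * g y powr (1 - l)) \<le> h (\<lambda>i. l * x i + (1 - l) * y i)"
    and "(\<integral>\<^sup>+x. ennreal (f x) \<partial>(\<Pi>\<^sub>M i\<in>I. lborel)) = ennreal A" "0 < A"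
    and "(\<integral>\<^sup>+x. ennreal (g x) \<partial>(\<Pi>\<^sub>M i\<in>I. lborel)) = ennreal B" "0 < B"
  shows "ennreal (A powr l * B powr (1 - l)) \<le> (\<integral>\<^sup>+x. h x \<partial>(\<Pi>\<^sub>M i\<in>I. lborel))"
  using assms(1,4-)
proof (induction I arbitrary: f g h A B rule: finite_induct)
  \<comment> \<open>The empty product measure is a unit mass at the function that is everywhere
    \<open>undefined\<close>, so all three integrals are values at this one point.\<close>
  case (empty f g h A B)
  interpret product_sigma_finite "\<lambda>_::'i. lborel :: real measure" by standard
  have *: "(\<integral>\<^sup>+x. \<phi> x \<partial>(\<Pi>\<^sub>M i\<in>{}. lborel)) = \<phi> (\<lambda>_. undefined)" for \<phi> :: "('i \<Rightarrow> real) \<Rightarrow> ennreal"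
    by (rule nn_integral_empty) (simp)
  define u where "u = (\<lambda>_::'i. undefined :: real)"
  have "f u = A" using empty(9,10) empty(2)[of u] by (simp add: * u_def[symmetric] less_imp_le)
  moreover have "g u = B" using empty(11,12) empty(5)[of u] by (simp add: * u_def[symmetric] less_imp_le)
  moreover have "(\<lambda>i. l * u i + (1 - l) * u i) = u" by (simp add: algebra_simps)
  ultimately show ?case using empty(8)[of u u] by (simp add: * u_def[symmetric])
next
  case (insert i I f g h A B)
  interpret product_sigma_finite "\<lambda>_::'i. lborel :: real measure" by standard
  interpret sigma_finite_measure "\<Pi>\<^sub>M i\<in>I. lborel :: real measure"
    by (rule sigma_finite) (rule insert)
  note [measurable] = insert.prems(1,4,7)
  let ?N = "\<Pi>\<^sub>M i\<in>I. lborel :: real measure"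
  have upd[measurable]: "(\<lambda>x. x(i := t)) \<in> ?N \<rightarrow>\<^sub>M (\<Pi>\<^sub>M i\<in>insert i I. lborel)" for t :: real
    by measurable
  have upd2[measurable]: "(\<lambda>(t, x). x(i := t)) \<in> borel \<Otimes>\<^sub>M ?N \<rightarrow>\<^sub>M (\<Pi>\<^sub>M i\<in>insert i I. lborel)"
    by measurable
  have Npos: "emeasure ?N (space ?N) \<noteq> 0"
  proof -
    have "emeasure ?N (\<Pi>\<^sub>E i\<in>I. UNIV) = (\<Prod>i\<in>I. emeasure lborel (UNIV :: real set))"
      by (rule emeasure_PiM) (use insert in auto)
    also have "\<dots> \<noteq> 0" using insert by simp
    finally show ?thesis by (simp add: space_PiM)
  qed
  have sum_upd: "(\<Sum>j\<in>insert i I. \<bar>(x(i := t)) j - (y(i := s)) j\<bar>) = \<bar>t - s\<bar> + (\<Sum>j\<in>I. \<bar>x j - y j\<bar>)"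
    for x y :: "'i \<Rightarrow> real" and t s
    using insert(1,2) by (subst sum.insert) (auto intro!: sum.cong)
  have fub: "(\<integral>\<^sup>+x. \<phi> x \<partial>(\<Pi>\<^sub>M i\<in>insert i I. lborel)) = (\<integral>\<^sup>+t. (\<integral>\<^sup>+x. \<phi> (x(i := t)) \<partial>?N) \<partial>lborel)"
    if "\<phi> \<in> borel_measurable (\<Pi>\<^sub>M i\<in>insert i I. lborel)" for \<phi> :: "('i \<Rightarrow> real) \<Rightarrow> ennreal"
    using product_nn_integral_insert_rev[OF insert(1,2) that] .
  obtain f1 where f1: "continuous_on UNIV f1" "\<And>t. 0 < f1 t" "\<And>t. (\<integral>\<^sup>+x. ennreal (f (x(i := t))) \<partial>?N) = ennreal (f1 t)"
  proof (rule loglip_marginal[of "\<lambda>x t. f (x(i := t))" ?N C UNIV])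
    show "f (x(i := t)) \<le> exp (C * \<bar>t - s\<bar>) * f (x(i := s))" for x t s
      using insert.prems(3)[of "x(i := t)" "x(i := s)"] unfolding sum_upd by (simp del: fun_upd_apply)
    show "(\<integral>\<^sup>+t. (\<integral>\<^sup>+x. ennreal (f (x(i := t))) \<partial>?N) * indicator UNIV t \<partial>lborel) < \<infinity>"
      using insert.prems(9) by (simp add: fub)
  qed (use insert.prems(2) Npos in auto)
  obtain g1 where g1: "continuous_on UNIV g1" "\<And>t. 0 < g1 t" "\<And>t. (\<integral>\<^sup>+x. ennreal (g (x(i := t))) \<partial>?N) = ennreal (g1 t)"
  proof (rule loglip_marginal[of "\<lambda>x t. g (x(i := t))" ?N C UNIV])
    show "g (x(i := t)) \<le> exp (C * \<bar>t - s\<bar>) * g (x(i := s))" for x t s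
      using insert.prems(6)[of "x(i := t)" "x(i := s)"] unfolding sum_upd by (simp del: fun_upd_apply)
    show "(\<integral>\<^sup>+t. (\<integral>\<^sup>+x. ennreal (g (x(i := t))) \<partial>?N) * indicator UNIV t \<partial>lborel) < \<infinity>"
      using insert.prems(11) by (simp add: fub)
  qed (use insert.prems(5) Npos in auto)
  have "ennreal (A powr l * B powr (1 - l)) \<le> (\<integral>\<^sup>+t. (\<integral>\<^sup>+x. h (x(i := t)) \<partial>?N) \<partial>lborel)"
  proof (rule prekopa_leindler_real[OF f1(1,2) _ _ g1(1,2) _ _ _ l])
    show "(\<integral>\<^sup>+t. ennreal (f1 t) \<partial>lborel) = ennreal A"
      using insert.prems(9) by (simp add: fub f1(3))
    show "(\<integral>\<^sup>+t. ennreal (g1 t) \<partial>lborel) = ennreal B"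
      using insert.prems(11) by (simp add: fub g1(3))
    show "(\<lambda>t. \<integral>\<^sup>+x. h (x(i := t)) \<partial>?N) \<in> borel_measurable borel"
      by measurable
    fix t s
    show "ennreal (f1 t powr l * g1 s powr (1 - l)) \<le> (\<integral>\<^sup>+x. h (x(i := l * t + (1 - l) * s)) \<partial>?N)"
    proof (rule insert.IH[OF _ _ _ _ _ _ _ _ f1(3) f1(2) g1(3) g1(2)])
      show "f (x(i := t)) \<le> exp (C * (\<Sum>i\<in>I. \<bar>x i - y i\<bar>)) * f (y(i := t))" for x y
        using insert.prems(3)[of "x(i := t)" "y(i := t)"] unfolding sum_upd by (simp del: fun_upd_apply)
      show "g (x(i := s)) \<le> exp (C * (\<Sum>i\<in>I. \<bar>x i - y i\<bar>)) * g (y(i := s))" for x y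
        using insert.prems(6)[of "x(i := s)" "y(i := s)"] unfolding sum_upd by (simp del: fun_upd_apply)
      fix x y
      have eq: "(\<lambda>j. l * (x(i := t)) j + (1 - l) * (y(i := s)) j) = (\<lambda>j. l * x j + (1 - l) * y j)(i := l * t + (1 - l) * s)"
        by auto
      show "ennreal (f (x(i := t)) powr l * g (y(i := s)) powr (1 - l))
          \<le> h ((\<lambda>j. l * x j + (1 - l) * y j)(i := l * t + (1 - l) * s))"
        using insert.prems(8)[of "x(i := t)" "y(i := s)"] unfolding eq .
    qed (use insert.prems(2,5) in \<open>auto simp del: fun_upd_apply\<close>)
  qed (use insert.prems(10,12) in auto)
  then show ?case by (simp add: fub)
qed

text \<open>Lebesgue measure on the hyperplane orthogonal to \<open>e\<close>, as a measure on the whole space. This avoids a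
  separate type for the hyperplane, which would not exist in dimension one.\<close>
definition perp_measure :: "'a \<Rightarrow> 'a::euclidean_space measure" where
  "perp_measure e = distr (\<Pi>\<^sub>M b\<in>Basis - {e}. lborel) borel (\<lambda>x. \<Sum>b\<in>Basis - {e}. x b *\<^sub>R b)"

section \<open>Slicing Lebesgue measure along a coordinate direction\<close>

lemma sets_perp_measure[measurable_cong, simp]: "sets (perp_measure e) = sets borel"
  and space_perp_measure[simp]: "space (perp_measure e) = UNIV"
  by (simp_all add: perp_measure_def)

lemma perp_sum_measurable[measurable]:
  "(\<lambda>x. \<Sum>b\<in>Basis - {e}. x b *\<^sub>R b :: 'a::euclidean_space) \<in> (\<Pi>\<^sub>M b\<in>Basis - {e}. lborel) \<rightarrow>\<^sub>M borel"
  by measurable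

lemma nn_integral_perp_measure:
  assumes [measurable]: "\<phi> \<in> borel_measurable borel"
  shows "(\<integral>\<^sup>+x. \<phi> x \<partial>perp_measure e)
    = (\<integral>\<^sup>+x. \<phi> (\<Sum>b\<in>Basis - {e}. x b *\<^sub>R b) \<partial>(\<Pi>\<^sub>M b\<in>Basis - {e}. lborel))"
  unfolding perp_measure_def by (subst nn_integral_distr) auto

lemma sum_perp_update:
  assumes "e \<in> Basis"
  shows "(\<Sum>b\<in>insert e (Basis - {e}). (x(e := t)) b *\<^sub>R b)
    = (\<Sum>b\<in>Basis - {e}. x b *\<^sub>R b) + t *\<^sub>R (e :: 'a::euclidean_space)"
proof -
  have "(\<Sum>b\<in>Basis - {e}. (x(e := t)) b *\<^sub>R b) = (\<Sum>b\<in>Basis - {e}. x b *\<^sub>R b)"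
    by (rule sum.cong) auto
  then show ?thesis by (subst sum.insert) (auto simp: add.commute)
qed

lemma borel_measurable_perp_integral[measurable]:
  fixes e :: "'a::euclidean_space"
  assumes [measurable]: "case_prod \<phi> \<in> borel_measurable (M \<Otimes>\<^sub>M borel)"
  shows "(\<lambda>t. \<integral>\<^sup>+x. \<phi> t x \<partial>perp_measure e) \<in> borel_measurable M"
proof -
  interpret product_sigma_finite "\<lambda>_::'a. lborel :: real measure" by standard
  interpret sigma_finite_measure "\<Pi>\<^sub>M b\<in>Basis - {e}. lborel :: real measure"
    by (rule sigma_finite) auto
  have "(\<lambda>t. \<integral>\<^sup>+x. \<phi> t (\<Sum>b\<in>Basis - {e}. x b *\<^sub>R b) \<partial>(\<Pi>\<^sub>M b\<in>Basis - {e}. lborel)) \<in> borel_measurable M"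
    by measurable
  then show ?thesis
    by (subst measurable_cong[OF nn_integral_perp_measure]) (use measurable_Pair2[OF assms] in simp_all)
qed

text \<open>Both orders of integration occur later: heights outside for comparing parallel
  hyperplanes, base points outside for the fibres of a body.\<close>

lemma nn_integral_lborel_slices:
  fixes e :: "'a::euclidean_space"
  assumes e: "e \<in> Basis" and [measurable]: "\<phi> \<in> borel_measurable borel"
  shows "(\<integral>\<^sup>+x. \<phi> x \<partial>lborel) = (\<integral>\<^sup>+t. (\<integral>\<^sup>+x. \<phi> (x + t *\<^sub>R e) \<partial>perp_measure e) \<partial>lborel)"
    and "(\<integral>\<^sup>+x. \<phi> x \<partial>lborel) = (\<integral>\<^sup>+x. (\<integral>\<^sup>+t. \<phi> (x + t *\<^sub>R e) \<partial>lborel) \<partial>perp_measure e)"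
proof -
  interpret product_sigma_finite "\<lambda>_::'a. lborel :: real measure" by standard
  have Bas: "insert e (Basis - {e}) = Basis" using e by auto
  have [measurable]: "(\<lambda>f. \<Sum>b\<in>insert e (Basis - {e}). f b *\<^sub>R b :: 'a) \<in> (\<Pi>\<^sub>M b\<in>insert e (Basis - {e}). lborel) \<rightarrow>\<^sub>M borel"
    by measurable
  have *: "(\<integral>\<^sup>+x. \<phi> x \<partial>lborel) = (\<integral>\<^sup>+f. \<phi> (\<Sum>b\<in>insert e (Basis - {e}). f b *\<^sub>R b) \<partial>(\<Pi>\<^sub>M b\<in>insert e (Basis - {e}). lborel))"
    unfolding Bas by (subst lborel_eq) (subst nn_integral_distr, auto)
  have m: "(\<lambda>f. \<phi> (\<Sum>b\<in>insert e (Basis - {e}). f b *\<^sub>R b)) \<in> borel_measurable (\<Pi>\<^sub>M b\<in>insert e (Basis - {e}). lborel)"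
    by measurable
  have np: "(\<integral>\<^sup>+x. \<phi> (x + t *\<^sub>R e) \<partial>perp_measure e)
      = (\<integral>\<^sup>+x. \<phi> ((\<Sum>b\<in>Basis - {e}. x b *\<^sub>R b) + t *\<^sub>R e) \<partial>(\<Pi>\<^sub>M b\<in>Basis - {e}. lborel))" for t
    by (rule nn_integral_perp_measure) measurable
  have np2: "(\<integral>\<^sup>+x. (\<integral>\<^sup>+t. \<phi> (x + t *\<^sub>R e) \<partial>lborel) \<partial>perp_measure e)
      = (\<integral>\<^sup>+x. (\<integral>\<^sup>+t. \<phi> ((\<Sum>b\<in>Basis - {e}. x b *\<^sub>R b) + t *\<^sub>R e) \<partial>lborel) \<partial>(\<Pi>\<^sub>M b\<in>Basis - {e}. lborel))"
    by (rule nn_integral_perp_measure) measurable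
  show "(\<integral>\<^sup>+x. \<phi> x \<partial>lborel) = (\<integral>\<^sup>+t. (\<integral>\<^sup>+x. \<phi> (x + t *\<^sub>R e) \<partial>perp_measure e) \<partial>lborel)"
    unfolding * np sum_perp_update[OF e, symmetric]
    by (rule product_nn_integral_insert_rev[OF _ _ m]) auto
  show "(\<integral>\<^sup>+x. \<phi> x \<partial>lborel) = (\<integral>\<^sup>+x. (\<integral>\<^sup>+t. \<phi> (x + t *\<^sub>R e) \<partial>lborel) \<partial>perp_measure e)"
    unfolding * np2 sum_perp_update[OF e, symmetric]
    by (rule product_nn_integral_insert[OF _ _ m]) auto
qed

lemma perp_sum_inner:
  assumes "e \<in> Basis"
  shows "(\<Sum>b\<in>Basis - {e}. x b *\<^sub>R b) \<bullet> (e :: 'a::euclidean_space) = 0"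
  unfolding inner_sum_left by (rule sum.neutral) (use assms in \<open>auto simp: inner_Basis\<close>)

lemma AE_perp_measure:
  fixes e :: "'a::euclidean_space"
  assumes "e \<in> Basis" shows "AE x in perp_measure e. x \<bullet> e = 0"
  unfolding perp_measure_def by (subst AE_distr_iff) (auto simp: perp_sum_inner[OF assms])

text \<open>The cylinder over \<open>U\<close> in direction \<open>e\<close> is open and nonempty,
  hence not a null set, whereas slicing would give it measure zero.\<close>

lemma emeasure_perp_measure_open:
  fixes e :: "'a::euclidean_space"
  assumes e: "e \<in> Basis" and U: "open U" "x \<in> U" "x \<bullet> e = 0"
  shows "emeasure (perp_measure e) U \<noteq> 0"
proof
  assume 0: "emeasure (perp_measure e) U = 0"
  have [measurable]: "U \<in> sets borel" using U by auto
  define V where "V = (\<lambda>y. y - (y \<bullet> e) *\<^sub>R e) -` U"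
  have "open V" unfolding V_def
    by (rule open_vimage[OF U(1)]) (intro continuous_intros)
  have [measurable]: "V \<in> sets borel" using \<open>open V\<close> by auto
  have "(\<integral>\<^sup>+y. indicator V y \<partial>lborel) = (\<integral>\<^sup>+t. (\<integral>\<^sup>+x. indicator V (x + t *\<^sub>R e) \<partial>perp_measure e) \<partial>lborel)"
    by (rule nn_integral_lborel_slices(1)[OF e]) measurable
  also have "\<dots> = (\<integral>\<^sup>+t. (\<integral>\<^sup>+x. indicator U x \<partial>perp_measure e) \<partial>(lborel :: real measure))"
  proof (rule nn_integral_cong, rule nn_integral_cong_AE)
    fix t :: real
    show "AE x in perp_measure e. indicator V (x + t *\<^sub>R e) = (indicator U x :: ennreal)"
      using AE_perp_measure[OF e]
      by eventually_elim (use e in \<open>auto simp: V_def indicator_def inner_add_left\<close>)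
  qed
  also have "\<dots> = 0" using 0 by simp
  finally have "V \<in> null_sets lborel" by (intro null_setsI) auto
  moreover have "x \<in> V" using U by (simp add: V_def)
  ultimately show False
    using \<open>open V\<close> open_not_negligible[of V] by (auto simp: negligible_iff_null_sets null_sets_completion_iff)
qed

lemma prekopa_leindler_perp:
  fixes f g :: "'a::euclidean_space \<Rightarrow> real" and h :: "'a \<Rightarrow> ennreal"
  assumes e: "e \<in> Basis" and l: "0 < l" "l < 1" and C: "0 \<le> C"
    and f[measurable]: "f \<in> borel_measurable borel" "\<And>x. 0 < f x" "\<And>x y. f x \<le> exp (C * norm (x - y)) * f y"
    and g[measurable]: "g \<in> borel_measurable borel" "\<And>x. 0 < g x" "\<And>x y. g x \<le> exp (C * norm (x - y)) * g y"
    and [measurable]: "h \<in> borel_measurable borel"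
    and fgh: "\<And>x y. x \<bullet> e = 0 \<Longrightarrow> y \<bullet> e = 0 \<Longrightarrow>
        ennreal (f x powr l * g y powr (1 - l)) \<le> h (l *\<^sub>R x + (1 - l) *\<^sub>R y)"
    and A: "(\<integral>\<^sup>+x. ennreal (f x) \<partial>perp_measure e) = ennreal A" "0 < A"
    and B: "(\<integral>\<^sup>+x. ennreal (g x) \<partial>perp_measure e) = ennreal B" "0 < B"
  shows "ennreal (A powr l * B powr (1 - l)) \<le> (\<integral>\<^sup>+x. h x \<partial>perp_measure e)"
proof -
  let ?W = "\<lambda>x. \<Sum>b\<in>Basis - {e}. x b *\<^sub>R b :: 'a"
  \<comment> \<open>A logarithmic Lipschitz bound in the Euclidean norm implies one in the sum of
    coordinate distances, which is the form used on the product measure.\<close>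
  have nW: "norm (?W x - ?W y) \<le> (\<Sum>b\<in>Basis - {e}. \<bar>x b - y b\<bar>)" for x y
  proof -
    have "norm (?W x - ?W y) = norm (\<Sum>b\<in>Basis - {e}. (x b - y b) *\<^sub>R b)"
      by (simp add: sum_subtractf scaleR_left_diff_distrib)
    also have "\<dots> \<le> (\<Sum>b\<in>Basis - {e}. norm ((x b - y b) *\<^sub>R b))" by (rule norm_sum)
    finally show ?thesis by simp
  qed
  have ll: "\<phi> (?W x) \<le> exp (C * (\<Sum>b\<in>Basis - {e}. \<bar>x b - y b\<bar>)) * \<phi> (?W y)"
    if "\<And>x. 0 < \<phi> x" "\<And>x y. \<phi> x \<le> exp (C * norm (x - y)) * \<phi> y" for \<phi> :: "'a \<Rightarrow> real" and x y
  proof -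
    have "exp (C * norm (?W x - ?W y)) \<le> exp (C * (\<Sum>b\<in>Basis - {e}. \<bar>x b - y b\<bar>))"
      using nW[of x y] C by (simp add: mult_left_mono)
    then show ?thesis
      by (rule order_trans[OF that(2) mult_right_mono[OF _ less_imp_le[OF that(1)]]])
  qed
  have "ennreal (A powr l * B powr (1 - l)) \<le> (\<integral>\<^sup>+x. h (?W x) \<partial>(\<Pi>\<^sub>M b\<in>Basis - {e}. lborel))"
  proof (rule prekopa_leindler_PiM[where f="\<lambda>x. f (?W x)" and g="\<lambda>x. g (?W x)" and C=C])
    fix x y :: "'a \<Rightarrow> real"
    have "?W (\<lambda>i. l * x i + (1 - l) * y i) = l *\<^sub>R ?W x + (1 - l) *\<^sub>R ?W y"
      by (simp add: scaleR_right.sum scaleR_sum_right sum.distrib scaleR_left_distrib)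
    then show "ennreal (f (?W x) powr l * g (?W y) powr (1 - l)) \<le> h (?W (\<lambda>i. l * x i + (1 - l) * y i))"
      using fgh[OF perp_sum_inner[OF e] perp_sum_inner[OF e], of x y] by simp
  next
    show "(\<integral>\<^sup>+x. ennreal (f (?W x)) \<partial>(\<Pi>\<^sub>M b\<in>Basis - {e}. lborel)) = ennreal A"
      "(\<integral>\<^sup>+x. ennreal (g (?W x)) \<partial>(\<Pi>\<^sub>M b\<in>Basis - {e}. lborel)) = ennreal B"
      using A(1) B(1) by (simp_all add: nn_integral_perp_measure)
  qed (use l A B f(2) g(2) ll[OF f(2,3)] ll[OF g(2,3)] in simp_all)
  then show ?thesis by (simp add: nn_integral_perp_measure)
qed

section \<open>Symmetrization of balanced functions\<close>

definition reflect :: "'a \<Rightarrow> 'a \<Rightarrow> 'a::euclidean_space" where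
  "reflect e x = x - (2 * (x \<bullet> e)) *\<^sub>R e"

lemma linear_reflect: "linear (reflect e)"
  unfolding reflect_def by (rule linearI) (auto simp: inner_add_left algebra_simps)

lemma continuous_on_reflect[continuous_intros]:
  "continuous_on S f \<Longrightarrow> continuous_on S (\<lambda>x. reflect e (f x))"
  unfolding reflect_def by (intro continuous_intros)

lemma reflect_reflect[simp]: "e \<in> Basis \<Longrightarrow> reflect e (reflect e x) = x"
  by (simp add: reflect_def inner_diff_left algebra_simps)

lemma reflect_inner: "e \<in> Basis \<Longrightarrow> reflect e x \<bullet> e = - (x \<bullet> e)"
  by (simp add: reflect_def inner_diff_left)

lemma reflect_add: "reflect e (x + y) = reflect e x + reflect e y"
  and reflect_diff: "reflect e (x - y) = reflect e x - reflect e y"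
  and reflect_scaleR: "reflect e (c *\<^sub>R x) = c *\<^sub>R reflect e x"
  and reflect_minus: "reflect e (- x) = - reflect e x"
  using linear_reflect[of e] by (auto simp: linear_add linear_diff linear_cmul linear_neg)

lemma reflect_perp: "x \<bullet> e = 0 \<Longrightarrow> reflect e x = x"
  by (simp add: reflect_def)

lemma reflect_self: "e \<in> Basis \<Longrightarrow> reflect e e = - e"
  by (simp add: reflect_def scaleR_2)

lemma reflect_inner_reflect: "e \<in> Basis \<Longrightarrow> reflect e x \<bullet> reflect e y = x \<bullet> y"
  by (simp add: reflect_def inner_diff_left inner_diff_right inner_commute[of e y] algebra_simps)

lemma norm_reflect[simp]: "e \<in> Basis \<Longrightarrow> norm (reflect e x) = norm x"
  by (simp add: norm_eq_sqrt_inner reflect_inner_reflect)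

lemma inner_reflect_left: "reflect e x \<bullet> y = x \<bullet> reflect e y"
  by (simp add: reflect_def inner_diff_left inner_diff_right inner_commute[of e y])

lemma nn_integral_real_halves:
  fixes \<phi> :: "real \<Rightarrow> ennreal"
  assumes [measurable]: "\<phi> \<in> borel_measurable borel"
  shows "(\<integral>\<^sup>+t. \<phi> t \<partial>lborel)
    = (\<integral>\<^sup>+t\<in>{0<..}. \<phi> t \<partial>lborel) + (\<integral>\<^sup>+t\<in>{0<..}. \<phi> (- t) \<partial>lborel)"
proof -
  have "(\<integral>\<^sup>+t. \<phi> t \<partial>lborel)
    = (\<integral>\<^sup>+t. \<phi> t * indicator {0<..} t + \<phi> t * indicator {..<0} t \<partial>lborel)"
  proof (rule nn_integral_cong_AE)
    show "AE t in lborel. \<phi> t = \<phi> t * indicator {0<..} t + \<phi> t * indicator {..<0} t"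
      using AE_lborel_singleton[of 0] by eventually_elim (auto simp: indicator_def)
  qed
  also have "\<dots> = (\<integral>\<^sup>+t\<in>{0<..}. \<phi> t \<partial>lborel) + (\<integral>\<^sup>+t\<in>{..<0}. \<phi> t \<partial>lborel)"
    by (rule nn_integral_add) auto
  also have "(\<integral>\<^sup>+t\<in>{..<0}. \<phi> t \<partial>lborel) = (\<integral>\<^sup>+t. \<phi> (0 + - 1 * t) * indicator {..<0} (0 + - 1 * t) \<partial>lborel)"
    by (subst nn_integral_real_affine[where c="- 1" and t=0]) auto
  also have "\<dots> = (\<integral>\<^sup>+t\<in>{0<..}. \<phi> (- t) \<partial>lborel)"
    by (rule nn_integral_cong) (auto simp: indicator_def)
  finally show ?thesis .
qed

lemma nn_integral_halfspaces:
  fixes e :: "'a::euclidean_space" and \<phi> :: "'a \<Rightarrow> ennreal"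
  assumes e: "e \<in> Basis" and [measurable]: "\<phi> \<in> borel_measurable borel"
  shows "(\<integral>\<^sup>+y\<in>{y. 0 < y \<bullet> e}. \<phi> y \<partial>lborel)
      = (\<integral>\<^sup>+t\<in>{0<..}. (\<integral>\<^sup>+x. \<phi> (x + t *\<^sub>R e) \<partial>perp_measure e) \<partial>lborel)"
    and "(\<integral>\<^sup>+y\<in>{y. y \<bullet> e < 0}. \<phi> y \<partial>lborel)
      = (\<integral>\<^sup>+t\<in>{0<..}. (\<integral>\<^sup>+x. \<phi> (x - t *\<^sub>R e) \<partial>perp_measure e) \<partial>lborel)"
proof -
  have sl: "(\<integral>\<^sup>+y\<in>{y. y \<bullet> e \<in> S}. \<phi> y \<partial>lborel)
      = (\<integral>\<^sup>+t\<in>S. (\<integral>\<^sup>+x. \<phi> (x + t *\<^sub>R e) \<partial>perp_measure e) \<partial>lborel)"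
    if [measurable]: "S \<in> sets borel" for S :: "real set"
  proof -
    have "(\<integral>\<^sup>+y\<in>{y. y \<bullet> e \<in> S}. \<phi> y \<partial>lborel)
      = (\<integral>\<^sup>+t. (\<integral>\<^sup>+x. \<phi> (x + t *\<^sub>R e) * indicator {y. y \<bullet> e \<in> S} (x + t *\<^sub>R e) \<partial>perp_measure e) \<partial>lborel)"
      by (rule nn_integral_lborel_slices(1)[OF e]) measurable
    also have "\<dots> = (\<integral>\<^sup>+t. (\<integral>\<^sup>+x. \<phi> (x + t *\<^sub>R e) * indicator S t \<partial>perp_measure e) \<partial>lborel)"
    proof (rule nn_integral_cong, rule nn_integral_cong_AE)
      fix t :: real
      show "AE x in perp_measure e. \<phi> (x + t *\<^sub>R e) * indicator {y. y \<bullet> e \<in> S} (x + t *\<^sub>R e)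
          = \<phi> (x + t *\<^sub>R e) * indicator S t"
        using AE_perp_measure[OF e]
        by eventually_elim (use e in \<open>auto simp: indicator_def inner_add_left\<close>)
    qed
    also have "\<dots> = (\<integral>\<^sup>+t\<in>S. (\<integral>\<^sup>+x. \<phi> (x + t *\<^sub>R e) \<partial>perp_measure e) \<partial>lborel)"
      by (rule nn_integral_cong, rule nn_integral_multc) measurable
    finally show ?thesis .
  qed
  show "(\<integral>\<^sup>+y\<in>{y. 0 < y \<bullet> e}. \<phi> y \<partial>lborel)
      = (\<integral>\<^sup>+t\<in>{0<..}. (\<integral>\<^sup>+x. \<phi> (x + t *\<^sub>R e) \<partial>perp_measure e) \<partial>lborel)"
    using sl[of "{0<..}"] by simp
  have "(\<integral>\<^sup>+y\<in>{y. y \<bullet> e < 0}. \<phi> y \<partial>lborel)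
      = (\<integral>\<^sup>+t\<in>{..<0}. (\<integral>\<^sup>+x. \<phi> (x + t *\<^sub>R e) \<partial>perp_measure e) \<partial>lborel)"
    using sl[of "{..<0}"] by simp
  also have "\<dots> = (\<integral>\<^sup>+t. (\<integral>\<^sup>+x. \<phi> (x + (0 + - 1 * t) *\<^sub>R e) \<partial>perp_measure e) * indicator {..<0} (0 + - 1 * t) \<partial>lborel)"
    by (subst nn_integral_real_affine[where c="- 1" and t=0]) auto
  also have "\<dots> = (\<integral>\<^sup>+t\<in>{0<..}. (\<integral>\<^sup>+x. \<phi> (x - t *\<^sub>R e) \<partial>perp_measure e) \<partial>lborel)"
    by (rule nn_integral_cong) (auto simp: indicator_def)
  finally show "(\<integral>\<^sup>+y\<in>{y. y \<bullet> e < 0}. \<phi> y \<partial>lborel)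
      = (\<integral>\<^sup>+t\<in>{0<..}. (\<integral>\<^sup>+x. \<phi> (x - t *\<^sub>R e) \<partial>perp_measure e) \<partial>lborel)" .
qed

text \<open>If \<open>y\<close> and \<open>reflect e y'\<close> have heights \<open>t\<close> and
  \<open>s\<close>, the linear constraint in \<open>key\<close> forces
  \<open>l = s / (s + t)\<close>, and the point on the right has height
  \<open>2 * s * t / (s + t)\<close>. Prekopa-Leindler on hyperplanes therefore turns
  \<open>key\<close> into the hypothesis of \<open>ball_harmonic_inequality\<close> for the
  marginals. Balance makes the two half-line integrals equal, and since \<Theta> is even, the
  estimate for one half-line counts twice.\<close>

lemma balanced_symmetrization:
  fixes \<Psi> \<Theta> :: "'a::euclidean_space \<Rightarrow> real"
  assumes e: "e \<in> Basis" and C: "0 \<le> C"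
    and [measurable]: "\<Psi> \<in> borel_measurable borel" "\<Theta> \<in> borel_measurable borel"
    and pos: "\<And>y. 0 < \<Psi> y" and ll: "\<And>x y. \<Psi> x \<le> exp (C * norm (x - y)) * \<Psi> y"
    and fin: "(\<integral>\<^sup>+y. ennreal (\<Psi> y) \<partial>lborel) < \<infinity>"
    and even: "\<And>y. \<Theta> (reflect e y) = \<Theta> y"
    and key: "\<And>y y' l. 0 < l \<Longrightarrow> l < 1 \<Longrightarrow> 0 < y \<bullet> e \<Longrightarrow> y' \<bullet> e < 0 \<Longrightarrow>
        l * (y \<bullet> e) + (1 - l) * (y' \<bullet> e) = 0 \<Longrightarrow>
        \<Psi> y powr l * \<Psi> y' powr (1 - l) \<le> \<Theta> (l *\<^sub>R y + (1 - l) *\<^sub>R reflect e y')"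
    and bal: "(\<integral>\<^sup>+y\<in>{y. 0 < y \<bullet> e}. ennreal (\<Psi> y) \<partial>lborel)
      = (\<integral>\<^sup>+y\<in>{y. y \<bullet> e < 0}. ennreal (\<Psi> y) \<partial>lborel)"
  shows "(\<integral>\<^sup>+y. ennreal (\<Psi> y) \<partial>lborel) \<le> (\<integral>\<^sup>+y. ennreal (\<Theta> y) \<partial>lborel)"
proof -
  have ne: "norm e = 1" using e by simp
  have Ppos: "emeasure (perp_measure e) (space (perp_measure e)) \<noteq> 0"
    using emeasure_perp_measure_open[OF e open_UNIV, of 0] by simp
  obtain f where f: "continuous_on UNIV f" "\<And>t. 0 < f t"
    "\<And>t. (\<integral>\<^sup>+x. ennreal (\<Psi> (x + t *\<^sub>R e)) \<partial>perp_measure e) = ennreal (f t)"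
  proof (rule loglip_marginal[of "\<lambda>x t. \<Psi> (x + t *\<^sub>R e)" "perp_measure e" C UNIV])
    show "\<Psi> (x + t *\<^sub>R e) \<le> exp (C * \<bar>t - s\<bar>) * \<Psi> (x + s *\<^sub>R e)" for x t s
      using ll[of "x + t *\<^sub>R e" "x + s *\<^sub>R e"] ne by (simp flip: scaleR_left_diff_distrib)
    show "(\<integral>\<^sup>+t. (\<integral>\<^sup>+x. ennreal (\<Psi> (x + t *\<^sub>R e)) \<partial>perp_measure e) * indicator UNIV t \<partial>lborel) < \<infinity>"
      using fin nn_integral_lborel_slices(1)[OF e, of "\<lambda>y. ennreal (\<Psi> y)"] by simp
  qed (use pos Ppos in auto)
  define h where "h t = (\<integral>\<^sup>+x. ennreal (\<Theta> (x + t *\<^sub>R e)) \<partial>perp_measure e)" for t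
  have [measurable]: "h \<in> borel_measurable borel" unfolding h_def by measurable
  have [measurable]: "f \<in> borel_measurable borel"
    by (rule borel_measurable_continuous_onI) (rule f)
  have fm: "(\<integral>\<^sup>+x. ennreal (\<Psi> (x - t *\<^sub>R e)) \<partial>perp_measure e) = ennreal (f (- t))" for t
    using f(3)[of "- t"] by simp
  define A where "A = enn2real (\<integral>\<^sup>+t\<in>{0<..}. ennreal (f t) \<partial>lborel)"
  have tot: "(\<integral>\<^sup>+y. ennreal (\<Psi> y) \<partial>lborel) = (\<integral>\<^sup>+t\<in>{0<..}. ennreal (f t) \<partial>lborel)
      + (\<integral>\<^sup>+t\<in>{0<..}. ennreal (f (- t)) \<partial>lborel)"
    using nn_integral_lborel_slices(1)[OF e, of "\<lambda>y. ennreal (\<Psi> y)"] nn_integral_real_halves[of "\<lambda>t. ennreal (f t)"]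
    by (simp add: f(3))
  then have "(\<integral>\<^sup>+t\<in>{0<..}. ennreal (f t) \<partial>lborel) < \<infinity>"
    using fin by simp
  then have A1: "(\<integral>\<^sup>+t\<in>{0<..}. ennreal (f t) \<partial>lborel) = ennreal A"
    unfolding A_def by simp
  have A2: "(\<integral>\<^sup>+t\<in>{0<..}. ennreal (f (- t)) \<partial>lborel) = ennreal A"
    using bal unfolding A1[symmetric] by (simp add: nn_integral_halfspaces[OF e] f(3) fm)
  have A0: "0 < A"
  proof -
    have "(\<integral>\<^sup>+t\<in>{0<..}. ennreal (f t) \<partial>lborel) \<noteq> 0"
    proof
      assume "(\<integral>\<^sup>+t\<in>{0<..}. ennreal (f t) \<partial>lborel) = 0"
      then have "AE t in lborel. ennreal (f t) * indicator {0<..} t = 0"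
        by (subst (asm) nn_integral_0_iff_AE) auto
      then have "AE t in lborel. t \<notin> {0<..<1::real}"
      proof eventually_elim
        case (elim t)
        then show ?case using f(2)[of t] by (auto simp: indicator_def ennreal_eq_0_iff split: if_splits)
      qed
      then have "{0<..<1::real} \<in> null_sets lborel"
        by (subst AE_iff_null_sets) auto
      then show False by (auto simp: null_sets_def)
    qed
    then show ?thesis unfolding A1 by (auto simp: ennreal_eq_0_iff)
  qed
  have "ennreal A \<le> (\<integral>\<^sup>+t\<in>{0<..}. h t \<partial>lborel)"
  proof (rule ball_harmonic_inequality[where f=f and g="\<lambda>t. f (- t)"])
    show "continuous_on UNIV (\<lambda>t. f (- t))"
      by (rule continuous_on_compose2[OF f(1)]) (auto intro!: continuous_intros)
    fix t s :: real assume ts: "0 < t" "0 < s"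
    define l where "l = s / (s + t)"
    have l: "0 < l" "l < 1" and l1: "t / (s + t) = 1 - l"
      using ts by (auto simp: l_def field_simps)
    have lt: "l * t = (1 - l) * s" unfolding l1[symmetric] by (simp add: l_def)
    have tau: "2 * s * t / (s + t) = l * t + (1 - l) * s"
      unfolding lt[symmetric] by (simp add: l_def)
    have "ennreal (f t powr l * f (- s) powr (1 - l)) \<le> (\<integral>\<^sup>+x. ennreal (\<Theta> (x + (l * t + (1 - l) * s) *\<^sub>R e)) \<partial>perp_measure e)"
    proof (rule prekopa_leindler_perp[OF e l C, where f="\<lambda>x. \<Psi> (x + t *\<^sub>R e)" and g="\<lambda>x. \<Psi> (x - s *\<^sub>R e)"])
      show "\<Psi> (x + t *\<^sub>R e) \<le> exp (C * norm (x - y)) * \<Psi> (y + t *\<^sub>R e)"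
        "\<Psi> (x - s *\<^sub>R e) \<le> exp (C * norm (x - y)) * \<Psi> (y - s *\<^sub>R e)" for x y
        using ll[of "x + t *\<^sub>R e" "y + t *\<^sub>R e"] ll[of "x - s *\<^sub>R e" "y - s *\<^sub>R e"] by simp_all
      fix x y assume xy: "x \<bullet> e = 0" "y \<bullet> e = 0"
      have "l *\<^sub>R (x + t *\<^sub>R e) + (1 - l) *\<^sub>R reflect e (y - s *\<^sub>R e)
        = l *\<^sub>R x + (1 - l) *\<^sub>R y + (l * t + (1 - l) * s) *\<^sub>R e"
        using e xy by (simp add: reflect_diff reflect_scaleR reflect_self reflect_perp scaleR_add_right scaleR_add_left)
      moreover have "\<Psi> (x + t *\<^sub>R e) powr l * \<Psi> (y - s *\<^sub>R e) powr (1 - l)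
        \<le> \<Theta> (l *\<^sub>R (x + t *\<^sub>R e) + (1 - l) *\<^sub>R reflect e (y - s *\<^sub>R e))"
        by (rule key[OF l]) (use e xy ts lt in \<open>auto simp: inner_add_left inner_diff_left\<close>)
      ultimately show "ennreal (\<Psi> (x + t *\<^sub>R e) powr l * \<Psi> (y - s *\<^sub>R e) powr (1 - l))
        \<le> ennreal (\<Theta> (l *\<^sub>R x + (1 - l) *\<^sub>R y + (l * t + (1 - l) * s) *\<^sub>R e))"
        by (simp add: ennreal_leI)
    qed (use pos f(2,3) fm in auto)
    then show "ennreal (f t powr (s / (s + t)) * f (- s) powr (t / (s + t))) \<le> h (2 * s * t / (s + t))"
      unfolding h_def tau l1 l_def[symmetric] .
  qed (use f A1 A2 A0 in auto)
  moreover have "h (- t) = h t" for t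
    unfolding h_def
  proof (rule nn_integral_cong_AE)
    show "AE x in perp_measure e. ennreal (\<Theta> (x + (- t) *\<^sub>R e)) = ennreal (\<Theta> (x + t *\<^sub>R e))"
      using AE_perp_measure[OF e]
    proof eventually_elim
      case (elim x)
      have "reflect e (x + t *\<^sub>R e) = x + (- t) *\<^sub>R e"
        using e elim by (simp add: reflect_add reflect_scaleR reflect_self reflect_perp)
      then show ?case using even[of "x + t *\<^sub>R e"] by simp
    qed
  qed
  moreover have "(\<integral>\<^sup>+y. ennreal (\<Theta> y) \<partial>lborel) = (\<integral>\<^sup>+t. h t \<partial>lborel)"
    unfolding h_def by (rule nn_integral_lborel_slices(1)[OF e]) measurable
  ultimately show ?thesis
    unfolding tot A1 A2 by (simp add: nn_integral_real_halves[of h] add_mono)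
qed

section \<open>Laplace transforms of bodies\<close>

lemma nn_integral_lborel_translate:
  fixes c :: "'a::euclidean_space"
  assumes [measurable]: "f \<in> borel_measurable borel"
  shows "(\<integral>\<^sup>+x. f (c + x) \<partial>lborel) = (\<integral>\<^sup>+x. f x \<partial>lborel)"
  by (subst (2) lborel_distr_plus[of c, symmetric]) (simp add: nn_integral_distr)

text \<open>The usual uniqueness proof for Haar measure: Fubini compares both measures of \<open>A\<close> through the
  unit ball, which the orthogonal map leaves invariant.\<close>
lemma lborel_distr_orthogonal:
  fixes Q :: "'a::euclidean_space \<Rightarrow> 'a"
  assumes Q: "orthogonal_transformation Q"
  shows "distr lborel borel Q = lborel"
proof (rule measure_eqI)
  show "sets (distr lborel borel Q) = sets lborel" by simp
  have lin: "linear Q" using Q by (rule orthogonal_transformation_linear)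
  have [measurable]: "Q \<in> borel_measurable borel"
    by (rule borel_measurable_continuous_onI) (rule linear_continuous_on[OF linear_conv_bounded_linear[THEN iffD1, OF lin]])
  fix A assume "A \<in> sets (distr lborel borel Q)"
  then have [measurable]: "A \<in> sets borel" by simp
  define B where "B = ball (0::'a) 1"
  have [measurable]: "B \<in> sets borel" by (simp add: B_def)
  have surj: "\<exists>x. Q x = y" for y
    using orthogonal_transformation_surj[OF Q] by (metis surjD)
  have "emeasure (distr lborel borel Q) A = (\<integral>\<^sup>+x. indicator A (Q x) \<partial>lborel)"
    by (subst nn_integral_distr[where f="indicator A" and M'=borel, symmetric]) auto
  then have "emeasure (distr lborel borel Q) A * emeasure lborel B
      = (\<integral>\<^sup>+x. indicator A (Q x) * (\<integral>\<^sup>+y. indicator B y \<partial>lborel) \<partial>lborel)"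
    by (simp add: nn_integral_multc)
  also have "\<dots> = (\<integral>\<^sup>+x. indicator A (Q x) * (\<integral>\<^sup>+y. indicator B (- Q x + y) \<partial>lborel) \<partial>lborel)"
    by (subst nn_integral_lborel_translate) auto
  also have "\<dots> = (\<integral>\<^sup>+x. (\<integral>\<^sup>+y. indicator A (Q x) * indicator B (- Q x + y) \<partial>lborel) \<partial>lborel)"
    by (intro nn_integral_cong nn_integral_cmult[symmetric]) measurable
  also have "\<dots> = (\<integral>\<^sup>+y. (\<integral>\<^sup>+x. indicator A (Q x) * indicator B (- Q x + y) \<partial>lborel) \<partial>lborel)"
    by (rule lborel_pair.Fubini') measurable
  also have "\<dots> = (\<integral>\<^sup>+y. (\<integral>\<^sup>+x. indicator A (Q x + y) * indicator B x \<partial>lborel) \<partial>lborel)"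
  proof (rule nn_integral_cong)
    fix y
    \<comment> \<open>Translating \<open>x\<close> by the preimage of \<open>y\<close> moves
      \<open>y\<close> from the ball factor to the factor of \<open>A\<close>; the ball factor
      becomes \<open>indicator B (- Q x)\<close>, which equals \<open>indicator B x\<close> because
      \<open>Q\<close> preserves the norm.\<close>
    obtain z where z: "Q z = y" using surj by blast
    have "(\<integral>\<^sup>+x. indicator A (Q x) * indicator B (- Q x + y) \<partial>lborel)
       = (\<integral>\<^sup>+x. indicator A (Q (z + x)) * indicator B (- Q (z + x) + y) \<partial>lborel)"
      by (subst nn_integral_lborel_translate[where c=z, symmetric]) auto
    also have "\<dots> = (\<integral>\<^sup>+x. indicator A (Q x + y) * indicator B x \<partial>lborel)"
      by (rule nn_integral_cong)
         (simp add: linear_add[OF lin] z B_def indicator_def orthogonal_transformation_norm[OF Q] add.commute)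
    finally show "(\<integral>\<^sup>+x. indicator A (Q x) * indicator B (- Q x + y) \<partial>lborel)
       = (\<integral>\<^sup>+x. indicator A (Q x + y) * indicator B x \<partial>(lborel :: 'a measure))" .
  qed
  also have "\<dots> = (\<integral>\<^sup>+x. (\<integral>\<^sup>+y. indicator A (Q x + y) * indicator B x \<partial>lborel) \<partial>lborel)"
    by (rule lborel_pair.Fubini') measurable
  also have "\<dots> = (\<integral>\<^sup>+x. (\<integral>\<^sup>+y. indicator A (Q x + y) \<partial>lborel) * indicator B x \<partial>lborel)"
    by (intro nn_integral_cong nn_integral_multc) measurable
  also have "\<dots> = (\<integral>\<^sup>+x\<in>B. emeasure lborel A \<partial>(lborel :: 'a measure))"
    by (subst nn_integral_lborel_translate) auto
  also have "\<dots> = emeasure lborel A * emeasure lborel B"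
    by (simp add: nn_integral_cmult)
  finally have eq: "emeasure (distr lborel borel Q) A * emeasure lborel B = emeasure lborel A * emeasure lborel B" .
  have "emeasure lborel B \<noteq> 0"
    using open_not_negligible[of B] by (auto simp: B_def negligible_iff_null_sets null_sets_completion_iff null_sets_def)
  moreover have "emeasure lborel B \<noteq> \<infinity>"
    using emeasure_lborel_ball_finite[of "0::'a" 1] by (auto simp: B_def)
  ultimately show "emeasure (distr lborel borel Q) A = emeasure lborel A"
    using eq by (simp add: ennreal_mult_cancel_left mult.commute[of _ "emeasure lborel B"])
qed

lemma nn_integral_lborel_orthogonal:
  fixes Q :: "'a::euclidean_space \<Rightarrow> 'a"
  assumes Q: "orthogonal_transformation Q" and [measurable]: "f \<in> borel_measurable borel"
  shows "(\<integral>\<^sup>+x. f (Q x) \<partial>lborel) = (\<integral>\<^sup>+x. f x \<partial>lborel)"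
proof -
  have [measurable]: "Q \<in> borel_measurable borel"
    using orthogonal_transformation_linear[OF Q] by (intro borel_measurable_continuous_onI linear_continuous_on) (simp add: linear_conv_bounded_linear)
  show ?thesis
    by (subst (2) lborel_distr_orthogonal[OF Q, symmetric]) (simp add: nn_integral_distr)
qed

lemma orthogonal_transformation_reflect: "e \<in> Basis \<Longrightarrow> orthogonal_transformation (reflect e)"
  by (simp add: orthogonal_transformation_def linear_reflect reflect_inner_reflect)

text \<open>Up to the sign of the argument, the Laplace transform of the indicator function of
  \<open>K\<close>. For compact \<open>K\<close> the integral is finite, so \<open>enn2real\<close>
  does not alter its value.\<close>

definition lap :: "'a::euclidean_space set \<Rightarrow> 'a \<Rightarrow> real" where
  "lap K y = enn2real (\<integral>\<^sup>+x\<in>K. ennreal (exp (x \<bullet> y)) \<partial>lborel)"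

declare borel_compact [measurable_dest, simp]

lemma borel_measurable_lap[measurable]:
  assumes [measurable]: "K \<in> sets borel"
  shows "lap K \<in> borel_measurable borel"
  unfolding lap_def by measurable

lemma nn_integral_lap:
  fixes K :: "'a::euclidean_space set"
  assumes K: "compact K"
  shows "(\<integral>\<^sup>+x\<in>K. ennreal (exp (x \<bullet> y)) \<partial>lborel) = ennreal (lap K y)"
proof -
  obtain R where R: "\<And>x. x \<in> K \<Longrightarrow> norm x \<le> R"
    using compact_imp_bounded[OF K] by (auto simp: bounded_iff)
  have "(\<integral>\<^sup>+x\<in>K. ennreal (exp (x \<bullet> y)) \<partial>lborel)
      \<le> (\<integral>\<^sup>+x\<in>K. ennreal (exp (R * norm y)) \<partial>lborel)"
  proof (intro nn_integral_mono)
    fix x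
    have "x \<bullet> y \<le> R * norm y" if "x \<in> K"
      by (rule order_trans[OF norm_cauchy_schwarz mult_right_mono[OF R[OF that]]]) simp
    then show "ennreal (exp (x \<bullet> y)) * indicator K x \<le> ennreal (exp (R * norm y)) * indicator K x"
      by (auto simp: indicator_def intro: ennreal_leI)
  qed
  also have "\<dots> = ennreal (exp (R * norm y)) * emeasure lborel K"
    using K by (simp add: nn_integral_cmult)
  also have "\<dots> < \<infinity>"
    using emeasure_compact_finite[OF K] by (simp add: ennreal_mult_less_top)
  finally show ?thesis unfolding lap_def by simp
qed

lemma emeasure_interior_pos:
  fixes K :: "'a::euclidean_space set"
  assumes "interior K \<noteq> {}" "K \<in> sets borel"
  shows "0 < emeasure lborel K"
proof -
  have "emeasure lborel (interior K) \<noteq> 0"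
    using open_not_negligible[of "interior K"] assms by (auto simp: negligible_iff_null_sets null_sets_completion_iff null_sets_def)
  moreover have "emeasure lborel (interior K) \<le> emeasure lborel K"
    using assms by (intro emeasure_mono interior_subset) auto
  ultimately show ?thesis by (metis le_zero_eq zero_less_iff_neq_zero)
qed

lemma lap_pos:
  assumes K: "compact K" "interior K \<noteq> {}"
  shows "0 < lap K y"
proof -
  have "(\<integral>\<^sup>+x\<in>K. ennreal (exp (x \<bullet> y)) \<partial>lborel) \<noteq> 0"
  proof
    assume "(\<integral>\<^sup>+x\<in>K. ennreal (exp (x \<bullet> y)) \<partial>lborel) = 0"
    then have "AE x in lborel. ennreal (exp (x \<bullet> y)) * indicator K x = 0"
      using K by (subst (asm) nn_integral_0_iff_AE) auto
    then have "AE x in lborel. x \<notin> K"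
      by eventually_elim (auto simp: indicator_def ennreal_eq_0_iff not_le split: if_splits)
    then have "K \<in> null_sets lborel"
      using K by (subst AE_iff_null_sets) auto
    then have "emeasure lborel K = 0" by auto
    then show False using emeasure_interior_pos[OF K(2)] K(1) by simp
  qed
  then show ?thesis using nn_integral_lap[OF K(1), of y] by (auto simp: ennreal_eq_0_iff not_le)
qed

lemma lap_nonneg: "0 \<le> lap K y"
  by (simp add: lap_def)

text \<open>Cauchy-Schwarz on each exponent. This is the origin of the logarithmic Lipschitz
  condition imposed throughout the integral inequalities.\<close>

lemma lap_loglip:
  assumes K: "compact K" and R: "\<And>x. x \<in> K \<Longrightarrow> norm x \<le> R"
  shows "lap K y \<le> exp (R * norm (y - z)) * lap K z"
proof -
  have "ennreal (lap K y) \<le> (\<integral>\<^sup>+x. ennreal (exp (R * norm (y - z))) * (ennreal (exp (x \<bullet> z)) * indicator K x) \<partial>lborel)"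
    unfolding nn_integral_lap[OF K, symmetric]
  proof (intro nn_integral_mono)
    fix x
    have "ennreal (exp (x \<bullet> y)) \<le> ennreal (exp (R * norm (y - z))) * ennreal (exp (x \<bullet> z))" if "x \<in> K"
    proof -
      have "x \<bullet> (y - z) \<le> R * norm (y - z)"
        by (rule order_trans[OF norm_cauchy_schwarz mult_right_mono[OF R[OF that]]]) simp
      then show ?thesis by (simp add: inner_diff_right flip: ennreal_mult exp_add)
    qed
    then show "ennreal (exp (x \<bullet> y)) * indicator K x \<le> ennreal (exp (R * norm (y - z))) * (ennreal (exp (x \<bullet> z)) * indicator K x)"
      by (auto simp: indicator_def)
  qed
  also have "\<dots> = ennreal (exp (R * norm (y - z)) * lap K z)"
    using K by (subst nn_integral_cmult) (auto simp: nn_integral_lap lap_nonneg ennreal_mult)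
  finally show ?thesis by (simp add: lap_nonneg)
qed

lemma lap_translate:
  assumes K: "compact K"
  shows "lap ((\<lambda>x. x - z) ` K) y = exp (- (z \<bullet> y)) * lap K y"
proof -
  have K': "compact ((\<lambda>x. x - z) ` K)" using compact_translation_subtract[OF K] .
  have "ennreal (lap ((\<lambda>x. x - z) ` K) y) = (\<integral>\<^sup>+x. ennreal (exp ((- z + x) \<bullet> y)) * indicator ((\<lambda>x. x - z) ` K) (- z + x) \<partial>lborel)"
    unfolding nn_integral_lap[OF K', symmetric] using K'
    by (subst nn_integral_lborel_translate[where c="- z", symmetric]) auto
  also have "\<dots> = (\<integral>\<^sup>+x. ennreal (exp (- (z \<bullet> y))) * (ennreal (exp (x \<bullet> y)) * indicator K x) \<partial>lborel)"
    by (rule nn_integral_cong) (auto simp: indicator_def inner_add_left inner_diff_left exp_add exp_diff exp_minus ennreal_mult divide_simps image_iff simp flip: ennreal_mult)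
  also have "\<dots> = ennreal (exp (- (z \<bullet> y)) * lap K y)"
    using K by (subst nn_integral_cmult) (auto simp: nn_integral_lap lap_nonneg ennreal_mult)
  finally show ?thesis by (simp add: lap_nonneg)
qed

lemma lap_orthogonal_image:
  fixes Q :: "'a::euclidean_space \<Rightarrow> 'a"
  assumes K: "compact K" and Q: "orthogonal_transformation Q"
  shows "lap (Q ` K) (Q y) = lap K y"
proof -
  have lin: "linear Q" using Q by (rule orthogonal_transformation_linear)
  have K': "compact (Q ` K)"
    using lin by (intro compact_continuous_image[OF linear_continuous_on K]) (simp add: linear_conv_bounded_linear)
  have "ennreal (lap (Q ` K) (Q y)) = (\<integral>\<^sup>+x. ennreal (exp (Q x \<bullet> Q y)) * indicator (Q ` K) (Q x) \<partial>lborel)"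
    unfolding nn_integral_lap[OF K', symmetric] using K'
    by (subst nn_integral_lborel_orthogonal[OF Q, symmetric]) auto
  also have "\<dots> = ennreal (lap K y)"
    unfolding nn_integral_lap[OF K, symmetric]
    by (rule nn_integral_cong)
       (use Q orthogonal_transformation_inj[OF Q] in \<open>auto simp: indicator_def inj_image_mem_iff orthogonal_transformation_def\<close>)
  finally show ?thesis by (simp add: lap_nonneg)
qed

section \<open>Steiner symmetrization\<close>

text \<open>If \<open>u\<close> and \<open>v\<close> lie on a common line in direction \<open>e\<close>, then \<open>(u + reflect e v) / 2\<close> is the point above
  the foot of this line at signed height half the difference of the heights of \<open>u\<close> and \<open>v\<close>.\<close>
definition steiner :: "'a::euclidean_space \<Rightarrow> 'a set \<Rightarrow> 'a set" where
  "steiner e K = (\<lambda>(u, v). (1 / 2) *\<^sub>R (u + reflect e v)) `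
     {(u, v) \<in> K \<times> K. u - (u \<bullet> e) *\<^sub>R e = v - (v \<bullet> e) *\<^sub>R e}"

lemma steinerI:
  assumes "u \<in> K" "v \<in> K" "u - (u \<bullet> e) *\<^sub>R e = v - (v \<bullet> e) *\<^sub>R e" "x = (1 / 2) *\<^sub>R (u + reflect e v)"
  shows "x \<in> steiner e K"
  using assms unfolding steiner_def by force

lemma steinerE:
  assumes "x \<in> steiner e K"
  obtains u v where "u \<in> K" "v \<in> K" "u - (u \<bullet> e) *\<^sub>R e = v - (v \<bullet> e) *\<^sub>R e" "x = (1 / 2) *\<^sub>R (u + reflect e v)"
  using assms unfolding steiner_def by force

lemma steiner_mono: "K \<subseteq> L \<Longrightarrow> steiner e K \<subseteq> steiner e L"
  unfolding steiner_def by auto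

lemma compact_steiner:
  assumes "compact K" shows "compact (steiner e K)"
proof -
  let ?S = "{(u, v) \<in> K \<times> K. u - (u \<bullet> e) *\<^sub>R e = v - (v \<bullet> e) *\<^sub>R e}"
  have "?S = (K \<times> K) \<inter> {p. fst p - (fst p \<bullet> e) *\<^sub>R e = snd p - (snd p \<bullet> e) *\<^sub>R e}" by auto
  moreover have "closed {p. fst p - (fst p \<bullet> e) *\<^sub>R e = snd p - (snd p \<bullet> e) *\<^sub>R e}"
    by (intro closed_Collect_eq continuous_intros)
  ultimately have "compact ?S" using assms by (simp add: compact_Int_closed compact_Times)
  then show ?thesis unfolding steiner_def split_beta
    by (intro compact_continuous_image continuous_intros)
qed

text \<open>Both the constraint and the map that define \<open>steiner\<close> are linear in the
  pair \<open>(u, v)\<close>, so convex combinations can be formed on the pairs; concavity of chord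
  lengths does not have to be formulated.\<close>

lemma convex_steiner:
  assumes K: "convex K" shows "convex (steiner e K)"
proof (rule convexI)
  fix x y and a b :: real
  assume xy: "x \<in> steiner e K" "y \<in> steiner e K" and ab: "0 \<le> a" "0 \<le> b" "a + b = 1"
  obtain u v where u: "u \<in> K" "v \<in> K" "u - (u \<bullet> e) *\<^sub>R e = v - (v \<bullet> e) *\<^sub>R e" "x = (1 / 2) *\<^sub>R (u + reflect e v)"
    using xy(1) by (rule steinerE)
  obtain u' v' where u': "u' \<in> K" "v' \<in> K" "u' - (u' \<bullet> e) *\<^sub>R e = v' - (v' \<bullet> e) *\<^sub>R e" "y = (1 / 2) *\<^sub>R (u' + reflect e v')"
    using xy(2) by (rule steinerE)
  show "a *\<^sub>R x + b *\<^sub>R y \<in> steiner e K"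
  proof (rule steinerI)
    show "a *\<^sub>R u + b *\<^sub>R u' \<in> K" "a *\<^sub>R v + b *\<^sub>R v' \<in> K"
      using K u u' ab by (auto simp: convex_def)
    have "a *\<^sub>R (u - (u \<bullet> e) *\<^sub>R e) + b *\<^sub>R (u' - (u' \<bullet> e) *\<^sub>R e)
        = a *\<^sub>R (v - (v \<bullet> e) *\<^sub>R e) + b *\<^sub>R (v' - (v' \<bullet> e) *\<^sub>R e)" using u u' by simp
    then show "a *\<^sub>R u + b *\<^sub>R u' - ((a *\<^sub>R u + b *\<^sub>R u') \<bullet> e) *\<^sub>R e
        = a *\<^sub>R v + b *\<^sub>R v' - ((a *\<^sub>R v + b *\<^sub>R v') \<bullet> e) *\<^sub>R e"
      by (simp add: inner_add_left algebra_simps)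
    show "a *\<^sub>R x + b *\<^sub>R y = (1 / 2) *\<^sub>R (a *\<^sub>R u + b *\<^sub>R u' + reflect e (a *\<^sub>R v + b *\<^sub>R v'))"
      unfolding u u' by (simp add: reflect_add reflect_scaleR algebra_simps)
  qed
qed

lemma steiner_fibre:
  assumes e: "e \<in> Basis" and x: "x \<bullet> e = 0"
  shows "x + t *\<^sub>R e \<in> steiner e K \<longleftrightarrow> (\<exists>r s. x + r *\<^sub>R e \<in> K \<and> x + s *\<^sub>R e \<in> K \<and> t = (r - s) / 2)"
proof
  have ee: "e \<bullet> e = 1" using e by simp
  assume "x + t *\<^sub>R e \<in> steiner e K"
  then obtain u v where u: "u \<in> K" "v \<in> K" "u - (u \<bullet> e) *\<^sub>R e = v - (v \<bullet> e) *\<^sub>R e"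
    "x + t *\<^sub>R e = (1 / 2) *\<^sub>R (u + reflect e v)" by (rule steinerE)
  define r s where "r = u \<bullet> e" and "s = v \<bullet> e"
  define z where "z = u - r *\<^sub>R e"
  have "z = v - s *\<^sub>R e" using u(3) by (simp add: z_def r_def s_def)
  then have "v = z + s *\<^sub>R e" by simp
  moreover have "u = z + r *\<^sub>R e" by (simp add: z_def)
  ultimately have uz: "u = z + r *\<^sub>R e" "v = z + s *\<^sub>R e" by blast+
  have ze: "z \<bullet> e = 0" using ee by (simp add: z_def r_def inner_diff_left)
  have "reflect e v = z - s *\<^sub>R e"
    using e ze by (simp add: uz reflect_add reflect_scaleR reflect_self reflect_perp)
  then have "x + t *\<^sub>R e = (1 / 2) *\<^sub>R (2 *\<^sub>R z + (r - s) *\<^sub>R e)"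
    unfolding u(4) uz(1) by (simp add: scaleR_2 scaleR_diff_left)
  then have "x + t *\<^sub>R e = z + ((r - s) / 2) *\<^sub>R e" by (simp add: scaleR_add_right)
  moreover from this have "t = (r - s) / 2" using x ze ee by (metis add_cancel_right_left inner_add_left inner_scaleR_left mult.right_neutral)
  ultimately show "\<exists>r s. x + r *\<^sub>R e \<in> K \<and> x + s *\<^sub>R e \<in> K \<and> t = (r - s) / 2"
    using u(1,2) uz by (intro exI[of _ r] exI[of _ s]) auto
next
  have ee: "e \<bullet> e = 1" using e by simp
  assume "\<exists>r s. x + r *\<^sub>R e \<in> K \<and> x + s *\<^sub>R e \<in> K \<and> t = (r - s) / 2"
  then obtain r s where rs: "x + r *\<^sub>R e \<in> K" "x + s *\<^sub>R e \<in> K" "t = (r - s) / 2" by blast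
  show "x + t *\<^sub>R e \<in> steiner e K"
  proof (rule steinerI[OF rs(1,2)])
    show "x + r *\<^sub>R e - ((x + r *\<^sub>R e) \<bullet> e) *\<^sub>R e = x + s *\<^sub>R e - ((x + s *\<^sub>R e) \<bullet> e) *\<^sub>R e"
      using x ee by (simp add: inner_add_left)
    have "reflect e (x + s *\<^sub>R e) = x - s *\<^sub>R e"
      using e x by (simp add: reflect_add reflect_scaleR reflect_self reflect_perp)
    then have "(1 / 2) *\<^sub>R (x + r *\<^sub>R e + reflect e (x + s *\<^sub>R e)) = (1 / 2) *\<^sub>R (2 *\<^sub>R x + (r - s) *\<^sub>R e)"
      by (simp add: scaleR_2 scaleR_diff_left)
    also have "\<dots> = x + t *\<^sub>R e" by (simp add: scaleR_add_right rs(3))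
    finally show "x + t *\<^sub>R e = (1 / 2) *\<^sub>R (x + r *\<^sub>R e + reflect e (x + s *\<^sub>R e))" ..
  qed
qed

text \<open>A line that misses \<open>K\<close> is covered as well: the interval is then empty, with
  \<open>b < a\<close>.\<close>

lemma fibre_interval:
  fixes e :: "'a::euclidean_space"
  assumes e: "e \<in> Basis" and K: "compact K" "convex K"
  obtains a b :: real where "{t. x + t *\<^sub>R e \<in> K} = {a..b}"
proof -
  have eq: "{t. x + t *\<^sub>R e \<in> K} = (\<lambda>y. (y - x) \<bullet> e) ` (K \<inter> {y. y - x = ((y - x) \<bullet> e) *\<^sub>R e})" (is "_ = ?f ` _")
  proof (intro equalityI subsetI)
    fix t assume "t \<in> {t. x + t *\<^sub>R e \<in> K}"
    then show "t \<in> ?f ` (K \<inter> {y. y - x = ((y - x) \<bullet> e) *\<^sub>R e})"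
      using e by (intro image_eqI[of _ _ "x + t *\<^sub>R e"]) auto
  next
    fix t assume "t \<in> ?f ` (K \<inter> {y. y - x = ((y - x) \<bullet> e) *\<^sub>R e})"
    then obtain y where y: "y \<in> K" "y - x = ((y - x) \<bullet> e) *\<^sub>R e" "t = (y - x) \<bullet> e" by blast
    then have "x + t *\<^sub>R e = y" by (metis add_diff_cancel_left' add_diff_eq)
    then show "t \<in> {t. x + t *\<^sub>R e \<in> K}" using y by simp
  qed
  have "closed {y. y - x = ((y - x) \<bullet> e) *\<^sub>R e}"
    by (intro closed_Collect_eq continuous_intros)
  then have "compact {t. x + t *\<^sub>R e \<in> K}"
    unfolding eq using K by (intro compact_continuous_image continuous_intros compact_Int_closed)
  moreover have "convex {t. x + t *\<^sub>R e \<in> K}"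
  proof (rule convexI)
    fix t s and u v :: real
    assume ts: "t \<in> {t. x + t *\<^sub>R e \<in> K}" "s \<in> {t. x + t *\<^sub>R e \<in> K}" and uv: "0 \<le> u" "0 \<le> v" "u + v = 1"
    have "u *\<^sub>R (x + t *\<^sub>R e) + v *\<^sub>R (x + s *\<^sub>R e) \<in> K"
      using K(2) ts uv by (auto simp: convex_def)
    also have "u *\<^sub>R (x + t *\<^sub>R e) + v *\<^sub>R (x + s *\<^sub>R e) = (u + v) *\<^sub>R x + (u * t + v * s) *\<^sub>R e"
      by (simp add: algebra_simps)
    finally show "u *\<^sub>R t + v *\<^sub>R s \<in> {t. x + t *\<^sub>R e \<in> K}" using uv by simp
  qed
  ultimately show ?thesis
    using that connected_compact_interval_1[of "{t. x + t *\<^sub>R e \<in> K}"] convex_connected by blast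
qed

lemma steiner_fibre_interval:
  assumes e: "e \<in> Basis" and x: "x \<bullet> e = 0" and f: "{t. x + t *\<^sub>R e \<in> K} = {a..b}"
  shows "{t. x + t *\<^sub>R e \<in> steiner e K} = {- (b - a) / 2..(b - a) / 2}"
proof (intro set_eqI iffI)
  fix t
  have mem: "x + s *\<^sub>R e \<in> K \<longleftrightarrow> a \<le> s \<and> s \<le> b" for s
    using f by (auto simp: set_eq_iff)
  {
    assume "t \<in> {t. x + t *\<^sub>R e \<in> steiner e K}"
    then show "t \<in> {- (b - a) / 2..(b - a) / 2}"
      by (auto simp: steiner_fibre[OF e x] mem divide_simps)
  }
  {
    assume "t \<in> {- (b - a) / 2..(b - a) / 2}"
    \<comment> \<open>The witnesses lie symmetrically at distance \<open>t\<close> from the midpoint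
      of the fibre. For an empty fibre the symmetrized interval is empty too, since then
      \<open>b - a\<close> is negative.\<close>
    then have "a \<le> (a + b) / 2 + t \<and> (a + b) / 2 + t \<le> b" "a \<le> (a + b) / 2 - t \<and> (a + b) / 2 - t \<le> b"
      by (auto simp: field_simps)
    moreover have "t = (((a + b) / 2 + t) - ((a + b) / 2 - t)) / 2" by simp
    ultimately show "t \<in> {t. x + t *\<^sub>R e \<in> steiner e K}"
      unfolding mem_Collect_eq steiner_fibre[OF e x] mem by blast
  }
qed

lemma nn_integral_fibres:
  fixes e :: "'a::euclidean_space"
  assumes e: "e \<in> Basis" and [measurable]: "K \<in> sets borel" "\<phi> \<in> borel_measurable borel"
  shows "(\<integral>\<^sup>+y\<in>K. \<phi> y \<partial>lborel)
    = (\<integral>\<^sup>+x. (\<integral>\<^sup>+t\<in>{t. x + t *\<^sub>R e \<in> K}. \<phi> (x + t *\<^sub>R e) \<partial>lborel) \<partial>perp_measure e)"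
proof -
  have "(\<integral>\<^sup>+y\<in>K. \<phi> y \<partial>lborel)
    = (\<integral>\<^sup>+x. (\<integral>\<^sup>+t. \<phi> (x + t *\<^sub>R e) * indicator K (x + t *\<^sub>R e) \<partial>lborel) \<partial>perp_measure e)"
    by (rule nn_integral_lborel_slices(2)[OF e]) measurable
  then show ?thesis by (simp add: indicator_def)
qed

lemma emeasure_steiner:
  assumes e: "e \<in> Basis" and K: "compact K" "convex K"
  shows "emeasure lborel (steiner e K) = emeasure lborel K"
proof -
  have "(\<integral>\<^sup>+y\<in>(steiner e K). 1 \<partial>lborel) = (\<integral>\<^sup>+y\<in>K. 1 \<partial>lborel)"
    unfolding nn_integral_fibres[OF e borel_compact[OF K(1)] borel_measurable_const]
      nn_integral_fibres[OF e borel_compact[OF compact_steiner[OF K(1)]] borel_measurable_const]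
  proof (rule nn_integral_cong_AE)
    show "AE x in perp_measure e. (\<integral>\<^sup>+t\<in>{t. x + t *\<^sub>R e \<in> steiner e K}. 1 \<partial>lborel)
      = (\<integral>\<^sup>+t\<in>{t. x + t *\<^sub>R e \<in> K}. 1 \<partial>lborel)"
      using AE_perp_measure[OF e]
    proof eventually_elim
      case (elim x)
      obtain a b where ab: "{t. x + t *\<^sub>R e \<in> K} = {a..b}" by (rule fibre_interval[OF e K])
      show ?case unfolding ab steiner_fibre_interval[OF e elim ab]
        by (simp add: emeasure_lborel_Icc_eq field_simps)
    qed
  qed
  then show ?thesis using K compact_steiner[of K e] by simp
qed

text \<open>On each fibre, with midpoint \<open>m\<close>, the substitutions \<open>t \<mapsto> m + t\<close> and \<open>t \<mapsto> m - t\<close> map the symmetrized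
  interval onto the original one, and \<open>m\<close> cancels by the hypothesis on \<open>y\<close> and \<open>y'\<close>.
  Weighting by a free parameter \<open>k\<close> and optimizing it replaces Hoelder's inequality.\<close>
lemma lap_steiner:
  fixes e :: "'a::euclidean_space"
  assumes e: "e \<in> Basis" and K: "compact K" "convex K" "interior K \<noteq> {}"
    and l: "0 < l" "l < 1" and bal: "l * (y \<bullet> e) + (1 - l) * (y' \<bullet> e) = 0"
  shows "lap (steiner e K) (l *\<^sub>R y + (1 - l) *\<^sub>R reflect e y') \<le> lap K y powr l * lap K y' powr (1 - l)"
proof -
  define w where "w = l *\<^sub>R y + (1 - l) *\<^sub>R reflect e y'"
  have S: "compact (steiner e K)" using compact_steiner[OF K(1)] .
  have lin: "lap (steiner e K) w \<le> l * exp ((1 - l) * k) * lap K y + (1 - l) * exp (- l * k) * lap K y'" for k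
  proof -
    define p where "p = l * exp ((1 - l) * k)"
    define q where "q = (1 - l) * exp (- l * k)"
    have pq: "0 \<le> p" "0 \<le> q" using l by (auto simp: p_def q_def)
    have [measurable]: "K \<in> sets borel" using K by simp
    have "ennreal (lap (steiner e K) w) = (\<integral>\<^sup>+x. (\<integral>\<^sup>+t\<in>{t. x + t *\<^sub>R e \<in> steiner e K}. ennreal (exp ((x + t *\<^sub>R e) \<bullet> w)) \<partial>lborel) \<partial>perp_measure e)"
      unfolding nn_integral_lap[OF S, symmetric] using S by (intro nn_integral_fibres[OF e]) auto
    also have "\<dots> \<le> (\<integral>\<^sup>+x. ennreal p * (\<integral>\<^sup>+t\<in>{t. x + t *\<^sub>R e \<in> K}. ennreal (exp ((x + t *\<^sub>R e) \<bullet> y)) \<partial>lborel)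
        + ennreal q * (\<integral>\<^sup>+t\<in>{t. x + t *\<^sub>R e \<in> K}. ennreal (exp ((x + t *\<^sub>R e) \<bullet> y')) \<partial>lborel) \<partial>perp_measure e)"
    proof (rule nn_integral_mono_AE)
      show "AE x in perp_measure e.
        (\<integral>\<^sup>+t\<in>{t. x + t *\<^sub>R e \<in> steiner e K}. ennreal (exp ((x + t *\<^sub>R e) \<bullet> w)) \<partial>lborel)
        \<le> ennreal p * (\<integral>\<^sup>+t\<in>{t. x + t *\<^sub>R e \<in> K}. ennreal (exp ((x + t *\<^sub>R e) \<bullet> y)) \<partial>lborel)
        + ennreal q * (\<integral>\<^sup>+t\<in>{t. x + t *\<^sub>R e \<in> K}. ennreal (exp ((x + t *\<^sub>R e) \<bullet> y')) \<partial>lborel)"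
        using AE_perp_measure[OF e]
      proof eventually_elim
        case (elim x)
        obtain a b where ab: "{t. x + t *\<^sub>R e \<in> K} = {a..b}" by (rule fibre_interval[OF e K(1,2)])
        define m where "m = (a + b) / 2"
        let ?I = "indicator {- (b - a) / 2..(b - a) / 2} :: real \<Rightarrow> ennreal"
        have i1: "(\<integral>\<^sup>+t\<in>{a..b}. ennreal (exp ((x + t *\<^sub>R e) \<bullet> y)) \<partial>lborel)
          = (\<integral>\<^sup>+t. ennreal (exp ((x + (m + 1 * t) *\<^sub>R e) \<bullet> y)) * ?I t \<partial>lborel)"
          by (subst nn_integral_real_affine[where c=1 and t=m])
             (auto intro!: nn_integral_cong simp: indicator_def m_def field_simps)
        have i2: "(\<integral>\<^sup>+t\<in>{a..b}. ennreal (exp ((x + t *\<^sub>R e) \<bullet> y')) \<partial>lborel)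
          = (\<integral>\<^sup>+t. ennreal (exp ((x + (m + - 1 * t) *\<^sub>R e) \<bullet> y')) * ?I t \<partial>lborel)"
          by (subst nn_integral_real_affine[where c="- 1" and t=m])
             (auto intro!: nn_integral_cong simp: indicator_def m_def field_simps)
        have "(\<integral>\<^sup>+t. ennreal (exp ((x + t *\<^sub>R e) \<bullet> w)) * ?I t \<partial>lborel)
          \<le> (\<integral>\<^sup>+t. ennreal p * (ennreal (exp ((x + (m + 1 * t) *\<^sub>R e) \<bullet> y)) * ?I t)
             + ennreal q * (ennreal (exp ((x + (m + - 1 * t) *\<^sub>R e) \<bullet> y')) * ?I t) \<partial>lborel)"
        proof (rule nn_integral_mono)
          fix t
          define U where "U = (x + (m + 1 * t) *\<^sub>R e) \<bullet> y"
          define V where "V = (x + (m + - 1 * t) *\<^sub>R e) \<bullet> y'"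
          have "(x + t *\<^sub>R e) \<bullet> w = l * ((x + t *\<^sub>R e) \<bullet> y) + (1 - l) * (reflect e (x + t *\<^sub>R e) \<bullet> y')"
            by (simp add: w_def inner_add_right inner_reflect_left)
          also have "reflect e (x + t *\<^sub>R e) = x - t *\<^sub>R e"
            using e elim by (simp add: reflect_add reflect_scaleR reflect_self reflect_perp)
          also have "l * ((x + t *\<^sub>R e) \<bullet> y) + (1 - l) * ((x - t *\<^sub>R e) \<bullet> y')
            = l * U + (1 - l) * V - m * (l * (y \<bullet> e) + (1 - l) * (y' \<bullet> e))"
            by (simp add: U_def V_def inner_add_left inner_diff_left inner_commute[of e y] inner_commute[of e y'] algebra_simps)
          also have "\<dots> = l * (U + (1 - l) * k) + (1 - l) * (V + - l * k)"
            unfolding bal by (simp add: algebra_simps)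
          finally have "exp ((x + t *\<^sub>R e) \<bullet> w) = exp (l * (U + (1 - l) * k) + (1 - l) * (V + - l * k))" by simp
          also have "\<dots> \<le> l * exp (U + (1 - l) * k) + (1 - l) * exp (V + - l * k)"
            using convex_onD[OF exp_convex, of "1 - l" "U + (1 - l) * k" "V + - l * k"] l by simp
          also have "\<dots> = p * exp U + q * exp V"
            unfolding p_def q_def exp_add by (simp add: mult_ac)
          finally have "ennreal (exp ((x + t *\<^sub>R e) \<bullet> w)) \<le> ennreal p * ennreal (exp U) + ennreal q * ennreal (exp V)"
            using pq by (simp add: ennreal_leI flip: ennreal_mult ennreal_plus)
          then show "ennreal (exp ((x + t *\<^sub>R e) \<bullet> w)) * ?I t
            \<le> ennreal p * (ennreal (exp ((x + (m + 1 * t) *\<^sub>R e) \<bullet> y)) * ?I t)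
             + ennreal q * (ennreal (exp ((x + (m + - 1 * t) *\<^sub>R e) \<bullet> y')) * ?I t)"
            unfolding U_def V_def by (auto simp: indicator_def)
        qed
        also have "\<dots> = ennreal p * (\<integral>\<^sup>+t. ennreal (exp ((x + (m + 1 * t) *\<^sub>R e) \<bullet> y)) * ?I t \<partial>lborel)
          + ennreal q * (\<integral>\<^sup>+t. ennreal (exp ((x + (m + - 1 * t) *\<^sub>R e) \<bullet> y')) * ?I t \<partial>lborel)"
          by (subst nn_integral_add) (auto simp: nn_integral_cmult)
        finally show ?case unfolding steiner_fibre_interval[OF e elim ab] ab i1 i2 .
      qed
    qed
    also have "\<dots> = ennreal p * ennreal (lap K y) + ennreal q * ennreal (lap K y')"
      unfolding nn_integral_lap[OF K(1), symmetric]
        nn_integral_fibres[OF e borel_compact[OF K(1)], where \<phi>="\<lambda>x. ennreal (exp (x \<bullet> y))", simplified]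
        nn_integral_fibres[OF e borel_compact[OF K(1)], where \<phi>="\<lambda>x. ennreal (exp (x \<bullet> y'))", simplified]
      by (subst nn_integral_add) (auto simp: nn_integral_cmult)
    finally show ?thesis
      unfolding p_def[symmetric] q_def[symmetric]
      using pq by (simp add: lap_nonneg flip: ennreal_mult ennreal_plus)
  qed
  have A: "0 < lap K y" "0 < lap K y'" using lap_pos[OF K(1,3)] by auto
  \<comment> \<open>This choice makes both terms equal to the geometric mean of the two transforms,
    so that their convex combination is this mean.\<close>
  define k where "k = ln (lap K y') - ln (lap K y)"
  have e1: "exp ((1 - l) * k) * lap K y = lap K y powr l * lap K y' powr (1 - l)"
  proof -
    have "exp ((1 - l) * k) * lap K y = exp ((1 - l) * k + ln (lap K y))" using A by (simp add: exp_add)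
    also have "(1 - l) * k + ln (lap K y) = l * ln (lap K y) + (1 - l) * ln (lap K y')"
      by (simp add: k_def algebra_simps)
    finally show ?thesis using A by (simp add: powr_def exp_add)
  qed
  have e2: "exp (- l * k) * lap K y' = lap K y powr l * lap K y' powr (1 - l)"
  proof -
    have "exp (- l * k) * lap K y' = exp (- l * k + ln (lap K y'))" using A unfolding exp_add by simp
    also have "- l * k + ln (lap K y') = l * ln (lap K y) + (1 - l) * ln (lap K y')"
      by (simp add: k_def algebra_simps)
    finally show ?thesis using A by (simp add: powr_def exp_add)
  qed
  have "lap (steiner e K) w \<le> l * (exp ((1 - l) * k) * lap K y) + (1 - l) * (exp (- l * k) * lap K y')"
    using lin[of k] by (simp add: mult.assoc)
  also have "\<dots> = lap K y powr l * lap K y' powr (1 - l)" unfolding e1 e2 by (simp add: algebra_simps)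
  finally show ?thesis unfolding w_def .
qed

section \<open>Monotonicity under symmetrization\<close>

lemma nn_integral_exp_norm_finite:
  assumes c: "0 < c"
  shows "(\<integral>\<^sup>+y. ennreal (exp (- c * norm (y :: 'a::euclidean_space))) \<partial>lborel) < \<infinity>"
proof -
  define n where "n = real DIM('a)"
  have n: "0 < n" by (simp add: n_def)
  \<comment> \<open>The norm is at least the average of the absolute coordinates; the rate
    \<open>c / n\<close> is what each coordinate retains, and the bound becomes a product of
    one-dimensional integrals.\<close>
  define d where "d = c / n"
  have d: "0 < d" using c n by (simp add: d_def)
  have "(\<integral>\<^sup>+t\<in>{0..}. ennreal (exp (- d * t)) \<partial>lborel) = ennreal (0 - (- exp (- d * 0) / d))"
  proof (rule nn_integral_FTC_atLeast)
    show "((\<lambda>t. - exp (- d * t) / d) \<longlongrightarrow> 0) at_top"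
    proof -
      have "filterlim (\<lambda>t. - d * t) at_bot at_top"
        by (rule filterlim_tendsto_neg_mult_at_bot[OF tendsto_const _ filterlim_ident]) (use d in simp)
      then have "((\<lambda>t. exp (- d * t)) \<longlongrightarrow> 0) at_top"
        by (rule filterlim_compose[OF exp_at_bot])
      then have "((\<lambda>t. - exp (- d * t) / d) \<longlongrightarrow> - 0 / d) at_top"
        using d by (intro tendsto_intros) auto
      then show ?thesis by simp
    qed
  qed (use d in \<open>auto intro!: derivative_eq_intros\<close>)
  then have "(\<integral>\<^sup>+t\<in>{0..}. ennreal (exp (- d * t)) \<partial>lborel) < \<infinity>" by simp
  moreover have "(\<integral>\<^sup>+t\<in>{0<..}. ennreal (exp (- d * \<bar>t\<bar>)) \<partial>lborel)
      \<le> (\<integral>\<^sup>+t\<in>{0..}. ennreal (exp (- d * t)) \<partial>lborel)"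
    by (rule nn_integral_mono) (auto simp: indicator_def)
  ultimately have fin: "(\<integral>\<^sup>+t\<in>{0<..}. ennreal (exp (- d * \<bar>t\<bar>)) \<partial>lborel) < \<infinity>"
    by (rule le_less_trans[rotated])
  have fin1: "(\<integral>\<^sup>+t. ennreal (exp (- d * \<bar>t\<bar>)) \<partial>lborel) < \<infinity>"
    by (subst nn_integral_real_halves) (use fin in auto)
  have "(\<integral>\<^sup>+y. ennreal (exp (- c * norm (y :: 'a))) \<partial>lborel)
      \<le> (\<integral>\<^sup>+y. (\<Prod>b\<in>(Basis :: 'a set). ennreal (exp (- d * \<bar>y \<bullet> b\<bar>))) \<partial>lborel)"
  proof (rule nn_integral_mono)
    fix y :: 'a
    have "(\<Sum>b\<in>Basis. \<bar>y \<bullet> b\<bar>) \<le> (\<Sum>b\<in>(Basis :: 'a set). norm y)"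
      by (intro sum_mono Basis_le_norm)
    then have "d * (\<Sum>b\<in>Basis. \<bar>y \<bullet> b\<bar>) \<le> d * (n * norm y)"
      using d by (intro mult_left_mono) (auto simp: n_def)
    moreover have "d * (n * norm y) = c * norm y" using n by (simp add: d_def)
    moreover have "(\<Sum>b\<in>Basis. - d * \<bar>y \<bullet> b\<bar>) = - (d * (\<Sum>b\<in>Basis. \<bar>y \<bullet> b\<bar>))"
      by (simp add: sum_distrib_left sum_negf)
    ultimately have "exp (- c * norm y) \<le> exp (\<Sum>b\<in>Basis. - d * \<bar>y \<bullet> b\<bar>)"
      by simp
    also have "\<dots> = (\<Prod>b\<in>Basis. exp (- d * \<bar>y \<bullet> b\<bar>))" by (rule exp_sum) simp
    finally show "ennreal (exp (- c * norm y)) \<le> (\<Prod>b\<in>Basis. ennreal (exp (- d * \<bar>y \<bullet> b\<bar>)))"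
      by (simp add: prod_ennreal ennreal_leI)
  qed
  also have "\<dots> = (\<Prod>b\<in>(Basis :: 'a set). (\<integral>\<^sup>+t. ennreal (exp (- d * \<bar>t\<bar>)) \<partial>lborel))"
    by (rule nn_integral_lborel_prod[where f="\<lambda>b t. ennreal (exp (- d * \<bar>t\<bar>))"]) auto
  also have "\<dots> < \<infinity>" using fin1 by (simp add: power_less_top_ennreal)
  finally show ?thesis .
qed

lemma lap_mono: "compact K \<Longrightarrow> compact L \<Longrightarrow> K \<subseteq> L \<Longrightarrow> lap K y \<le> lap L y"
proof -
  assume K: "compact K" "compact L" "K \<subseteq> L"
  have "ennreal (lap K y) \<le> ennreal (lap L y)"
    unfolding nn_integral_lap[OF K(1), symmetric] nn_integral_lap[OF K(2), symmetric]
    by (rule nn_integral_mono) (use K(3) in \<open>auto simp: indicator_def\<close>)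
  then show ?thesis by (simp add: lap_nonneg)
qed

text \<open>Restrict the integral to a ball of radius \<open>d / 2\<close> that touches the sphere
  of radius \<open>r\<close> from inside in direction \<open>y\<close>; on it
  \<open>x \<bullet> y\<close> is at least \<open>(r - d) * norm y\<close>. A fixed \<open>d\<close>
  suffices for integrability, while letting \<open>d\<close> tend to 0 recovers the full rate
  \<open>r\<close> in the limit of large exponents.\<close>

lemma lap_lower_bound:
  fixes K :: "'a::euclidean_space set"
  assumes K: "compact K" "cball 0 r \<subseteq> K" and d: "0 < d" "d \<le> r"
  shows "measure lborel (cball (0::'a) (d / 2)) * exp ((r - d) * norm y) \<le> lap K y"
proof -
  \<comment> \<open>For \<open>y = 0\<close> no direction is singled out; with \<open>u = 0\<close>
    the small ball is centred at the origin and the same estimates hold.\<close>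
  define u :: 'a where "u = (if y = 0 then 0 else y /\<^sub>R norm y)"
  have u: "norm u \<le> 1" "u \<bullet> y = norm y" by (auto simp: u_def dot_square_norm power2_eq_square)
  define B where "B = cball ((r - d / 2) *\<^sub>R u) (d / 2)"
  have "B \<subseteq> cball 0 r"
  proof
    fix x assume "x \<in> B"
    then have "norm (x - (r - d / 2) *\<^sub>R u) \<le> d / 2" by (simp add: B_def dist_norm norm_minus_commute)
    moreover have "norm ((r - d / 2) *\<^sub>R u) \<le> r - d / 2" using u(1) d by (simp add: mult_left_le)
    ultimately have "norm x \<le> r"
      using norm_triangle_ineq[of "x - (r - d / 2) *\<^sub>R u" "(r - d / 2) *\<^sub>R u"] by simp
    then show "x \<in> cball 0 r" by simp
  qed
  then have BK: "B \<subseteq> K" using K by auto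
  have in_B: "(r - d) * norm y \<le> x \<bullet> y" if "x \<in> B" for x
  proof -
    have "norm ((r - d / 2) *\<^sub>R u - x) \<le> d / 2" using that by (simp add: B_def dist_norm)
    then have "((r - d / 2) *\<^sub>R u - x) \<bullet> y \<le> d / 2 * norm y"
      by (intro order_trans[OF norm_cauchy_schwarz mult_right_mono]) auto
    then show ?thesis using u(2) by (simp add: inner_diff_left algebra_simps)
  qed
  have fin: "emeasure lborel B < \<infinity>" unfolding B_def by (rule emeasure_lborel_cball_finite)
  have mB: "measure lborel B = measure lborel (cball (0::'a) (d / 2))"
    unfolding B_def using d by (simp add: measure_def emeasure_cball)
  have "ennreal (measure lborel B * exp ((r - d) * norm y)) = (\<integral>\<^sup>+x\<in>B. ennreal (exp ((r - d) * norm y)) \<partial>lborel)"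
    using fin by (simp add: nn_integral_cmult_indicator B_def ennreal_mult' emeasure_eq_ennreal_measure mult.commute)
  also have "\<dots> \<le> (\<integral>\<^sup>+x\<in>K. ennreal (exp (x \<bullet> y)) \<partial>lborel)"
    by (rule nn_integral_mono) (use BK in_B in \<open>auto simp: indicator_def intro!: ennreal_leI\<close>)
  also have "\<dots> = ennreal (lap K y)" by (rule nn_integral_lap[OF K(1)])
  finally show ?thesis by (simp add: lap_nonneg mB)
qed

text \<open>Up to the factor \<open>measure lborel K powr (1 / p)\<close> this is the exponential of
  minus the support function of exponent \<open>p\<close>. Without the normalization by volume it is
  antitone in \<open>K\<close>.\<close>

definition psi :: "real \<Rightarrow> 'a::euclidean_space set \<Rightarrow> 'a \<Rightarrow> real" where
  "psi p K y = lap K (p *\<^sub>R y) powr (- (1 / p))"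

definition Phi :: "real \<Rightarrow> 'a::euclidean_space set \<Rightarrow> ennreal" where
  "Phi p K = (\<integral>\<^sup>+y. ennreal (psi p K y) \<partial>lborel)"

text \<open>The same notion as \<open>convex_body\<close>, but on an arbitrary Euclidean
  space.\<close>

definition body :: "'a::euclidean_space set \<Rightarrow> bool" where
  "body K \<longleftrightarrow> compact K \<and> convex K \<and> interior K \<noteq> {}"

lemma bodyD: "body K \<Longrightarrow> compact K" "body K \<Longrightarrow> convex K" "body K \<Longrightarrow> interior K \<noteq> {}"
  by (auto simp: body_def)

lemma borel_measurable_psi[measurable]:
  assumes [measurable]: "K \<in> sets borel"
  shows "psi p K \<in> borel_measurable borel"
  unfolding psi_def[abs_def] by measurable

lemma psi_pos: "body K \<Longrightarrow> 0 < psi p K y"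
  unfolding psi_def using lap_pos[of K "p *\<^sub>R y"] by (simp add: body_def)

lemma psi_antimono:
  assumes "body K" "compact L" "K \<subseteq> L" "0 < p" shows "psi p L y \<le> psi p K y"
  unfolding psi_def using assms lap_mono[of K L] lap_pos[of K] by (intro powr_mono2') (auto simp: body_def)

text \<open>The factor \<open>p\<close> in the argument of \<open>lap\<close> and the exponent
  \<open>1 / p\<close> cancel, so the constant is the radius \<open>R\<close> for every
  \<open>p\<close>.\<close>

lemma psi_loglip:
  assumes K: "body K" and R: "\<And>x. x \<in> K \<Longrightarrow> norm x \<le> R" and p: "0 < p"
  shows "psi p K x \<le> exp (R * norm (x - y)) * psi p K y"
proof -
  have L: "0 < lap K z" for z using K lap_pos by (auto simp: body_def)
  have eq: "R * norm (p *\<^sub>R y - p *\<^sub>R x) = p * (R * norm (x - y))"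
    using p by (simp add: norm_minus_commute flip: scaleR_diff_right)
  have "lap K (p *\<^sub>R y) \<le> exp (p * (R * norm (x - y))) * lap K (p *\<^sub>R x)"
    using lap_loglip[OF bodyD(1)[OF K] R, of "p *\<^sub>R y" "p *\<^sub>R x"] unfolding eq .
  then have "exp (- p * (R * norm (x - y))) * lap K (p *\<^sub>R y) \<le> lap K (p *\<^sub>R x)"
    by (simp add: exp_minus field_simps)
  then have "lap K (p *\<^sub>R x) powr (- (1 / p)) \<le> (exp (- p * (R * norm (x - y))) * lap K (p *\<^sub>R y)) powr (- (1 / p))"
    using L p by (intro powr_mono2') auto
  also have "\<dots> = exp (R * norm (x - y)) * lap K (p *\<^sub>R y) powr (- (1 / p))"
    using L[of "p *\<^sub>R y"] p by (simp add: powr_mult exp_powr_real less_imp_le)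
  finally show ?thesis unfolding psi_def .
qed

text \<open>The translation enters only through an exponential of a linear function. This makes
  half-space integrals monotone and convex in a translation along \<open>e\<close>, on which
  balancing rests.\<close>

lemma psi_translate:
  assumes K: "body K" and p: "0 < p"
  shows "psi p ((\<lambda>x. x - z) ` K) y = exp (z \<bullet> y) * psi p K y"
proof -
  have "0 < lap K (p *\<^sub>R y)" using K lap_pos by (auto simp: body_def)
  then show ?thesis using p
    by (simp add: psi_def lap_translate[OF bodyD(1)[OF K]] powr_mult exp_powr_real less_imp_le)
qed

lemma psi_orthogonal_image:
  fixes Q :: "'a::euclidean_space \<Rightarrow> 'a"
  assumes "compact K" "orthogonal_transformation Q"
  shows "psi p (Q ` K) (Q y) = psi p K y"
  using lap_orthogonal_image[OF assms, of "p *\<^sub>R y"] orthogonal_transformation_linear[OF assms(2)]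
  by (simp add: psi_def linear_cmul)

lemma compact_orthogonal_image:
  fixes Q :: "'a::euclidean_space \<Rightarrow> 'a"
  assumes "compact K" "orthogonal_transformation Q" shows "compact (Q ` K)"
  using orthogonal_transformation_linear[OF assms(2)]
  by (intro compact_continuous_image[OF linear_continuous_on assms(1)]) (simp add: linear_conv_bounded_linear)

lemma Phi_orthogonal_image:
  fixes Q :: "'a::euclidean_space \<Rightarrow> 'a"
  assumes K: "compact K" and Q: "orthogonal_transformation Q"
  shows "Phi p (Q ` K) = Phi p K"
proof -
  have "Phi p (Q ` K) = (\<integral>\<^sup>+y. ennreal (psi p (Q ` K) (Q y)) \<partial>lborel)"
    unfolding Phi_def
    by (rule nn_integral_lborel_orthogonal[OF Q, symmetric]) (use compact_orthogonal_image[OF K Q] in simp)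
  then show ?thesis unfolding psi_orthogonal_image[OF K Q] Phi_def .
qed

lemma psi_upper_bound:
  fixes K :: "'a::euclidean_space set"
  assumes K: "compact K" "cball 0 r \<subseteq> K" and d: "0 < d" "d \<le> r" and p: "0 < p"
  shows "psi p K y \<le> measure lborel (cball (0::'a) (d / 2)) powr (- (1 / p)) * exp (- (r - d) * norm y)"
proof -
  define c where "c = measure lborel (cball (0::'a) (d / 2))"
  have c: "0 < c" unfolding c_def using d by (simp add: content_cball_pos)
  have "c * exp (p * ((r - d) * norm y)) \<le> lap K (p *\<^sub>R y)"
    using lap_lower_bound[OF K d, of "p *\<^sub>R y"] p by (simp add: c_def mult_ac)
  then have "psi p K y \<le> (c * exp (p * ((r - d) * norm y))) powr (- (1 / p))"
    unfolding psi_def using c p by (intro powr_mono2') auto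
  also have "\<dots> = c powr (- (1 / p)) * exp (- (r - d) * norm y)"
    using c p by (simp add: powr_mult exp_powr_real less_imp_le algebra_simps)
  finally show ?thesis unfolding c_def .
qed

lemma Phi_finite:
  fixes K :: "'a::euclidean_space set"
  assumes K: "compact K" "cball 0 r \<subseteq> K" "0 < r" and p: "0 < p"
  shows "Phi p K < \<infinity>"
proof -
  define c where "c = measure lborel (cball (0::'a) (r / 2 / 2)) powr (- (1 / p))"
  have "Phi p K \<le> (\<integral>\<^sup>+y. ennreal c * ennreal (exp (- (r / 2) * norm (y :: 'a))) \<partial>lborel)"
    unfolding Phi_def
  proof (rule nn_integral_mono)
    fix y :: 'a
    have "psi p K y \<le> c * exp (- (r / 2) * norm y)"
      using psi_upper_bound[OF K(1,2), of "r / 2" p y] K(3) p by (simp add: c_def)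
    then show "ennreal (psi p K y) \<le> ennreal c * ennreal (exp (- (r / 2) * norm y))"
      by (simp add: c_def ennreal_leI flip: ennreal_mult)
  qed
  also have "\<dots> = ennreal c * (\<integral>\<^sup>+y. ennreal (exp (- (r / 2) * norm (y :: 'a))) \<partial>lborel)"
    by (rule nn_integral_cmult) measurable
  also have "\<dots> < \<infinity>"
    using nn_integral_exp_norm_finite[of "r / 2", where 'a='a] K(3) by (simp add: ennreal_mult_less_top)
  finally show ?thesis .
qed

text \<open>The points \<open>u\<close> and \<open>v\<close> are \<open>x\<close> and its mirror
  image raised by the height of \<open>c\<close>; both are as far from \<open>c\<close> as
  \<open>x\<close> is from the foot of \<open>c\<close>, because a ball is symmetric about the
  hyperplane through its centre.\<close>

lemma ball_subset_steiner:
  fixes e :: "'a::euclidean_space"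
  assumes e: "e \<in> Basis" and b: "ball c r \<subseteq> K"
  shows "ball (c - (c \<bullet> e) *\<^sub>R e) r \<subseteq> steiner e K"
proof
  fix x assume x: "x \<in> ball (c - (c \<bullet> e) *\<^sub>R e) r"
  define u v where "u = x + (c \<bullet> e) *\<^sub>R e" and "v = reflect e x + (c \<bullet> e) *\<^sub>R e"
  have ee: "e \<bullet> e = 1" using e by simp
  show "x \<in> steiner e K"
  proof (rule steinerI)
    have "dist c u = dist (c - (c \<bullet> e) *\<^sub>R e) x" by (simp add: u_def dist_norm algebra_simps)
    then show "u \<in> K" using x b by auto
    have "reflect e (c - (c \<bullet> e) *\<^sub>R e) = c - (c \<bullet> e) *\<^sub>R e"
      using ee by (subst reflect_perp) (auto simp: inner_diff_left)
    then have "c - v = reflect e (c - (c \<bullet> e) *\<^sub>R e - x)"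
      unfolding reflect_diff[of e "c - (c \<bullet> e) *\<^sub>R e" x] by (simp add: v_def)
    then have "dist c v = dist (c - (c \<bullet> e) *\<^sub>R e) x"
      using norm_reflect[OF e, of "c - (c \<bullet> e) *\<^sub>R e - x"] by (simp add: dist_norm)
    then show "v \<in> K" using x b by auto
    show "u - (u \<bullet> e) *\<^sub>R e = v - (v \<bullet> e) *\<^sub>R e"
      using ee by (simp add: u_def v_def reflect_def inner_add_left inner_diff_left algebra_simps)
        (simp only: mult_2 mult_2_right scaleR_add_left)
    have "reflect e v = x - (c \<bullet> e) *\<^sub>R e"
      using e by (simp add: v_def reflect_add reflect_scaleR reflect_self)
    then have "u + reflect e v = 2 *\<^sub>R x" by (simp add: u_def scaleR_2)
    then show "x = (1 / 2) *\<^sub>R (u + reflect e v)" by simp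
  qed
qed

lemma body_steiner:
  fixes e :: "'a::euclidean_space"
  assumes e: "e \<in> Basis" and K: "body K" shows "body (steiner e K)"
proof -
  obtain c r where "0 < r" "ball c r \<subseteq> K"
    using bodyD(3)[OF K] by (metis ex_in_conv mem_interior)
  then have "ball (c - (c \<bullet> e) *\<^sub>R e) r \<subseteq> interior (steiner e K)"
    using ball_subset_steiner[OF e] by (simp add: interior_maximal)
  then have "interior (steiner e K) \<noteq> {}" using \<open>0 < r\<close> by auto
  then show ?thesis using K by (simp add: body_def compact_steiner convex_steiner)
qed

text \<open>Reflecting \<open>(u + reflect e v) / 2\<close> exchanges the roles of \<open>u\<close>
  and \<open>v\<close>.\<close>

lemma reflect_steiner:
  assumes e: "e \<in> Basis" shows "reflect e ` steiner e K = steiner e K"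
proof -
  have sub: "reflect e x \<in> steiner e K" if "x \<in> steiner e K" for x
    using that
  proof (rule steinerE)
    fix u v assume u: "u \<in> K" "v \<in> K" "u - (u \<bullet> e) *\<^sub>R e = v - (v \<bullet> e) *\<^sub>R e" "x = (1 / 2) *\<^sub>R (u + reflect e v)"
    show ?thesis
      by (rule steinerI[OF u(2,1) u(3)[symmetric]]) (use e u(4) in \<open>simp add: reflect_add reflect_scaleR add.commute\<close>)
  qed
  then have "x \<in> reflect e ` steiner e K" if "x \<in> steiner e K" for x
    using that e by (intro image_eqI[of _ _ "reflect e x"]) auto
  with sub show ?thesis by blast
qed

text \<open>The negative exponent reverses \<open>lap_steiner\<close>; the result is hypothesis
  \<open>key\<close> of \<open>balanced_symmetrization\<close>.\<close>

lemma psi_steiner: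
  fixes e :: "'a::euclidean_space"
  assumes e: "e \<in> Basis" and K: "body K" and p: "0 < p" and l: "0 < l" "l < 1"
    and bal: "l * (y \<bullet> e) + (1 - l) * (y' \<bullet> e) = 0"
  shows "psi p K y powr l * psi p K y' powr (1 - l) \<le> psi p (steiner e K) (l *\<^sub>R y + (1 - l) *\<^sub>R reflect e y')"
proof -
  have eq: "l *\<^sub>R (p *\<^sub>R y) + (1 - l) *\<^sub>R reflect e (p *\<^sub>R y') = p *\<^sub>R (l *\<^sub>R y + (1 - l) *\<^sub>R reflect e y')"
    by (simp add: reflect_scaleR scaleR_add_right mult.commute)
  have "l * (p *\<^sub>R y \<bullet> e) + (1 - l) * (p *\<^sub>R y' \<bullet> e) = p * (l * (y \<bullet> e) + (1 - l) * (y' \<bullet> e))"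
    by (simp add: algebra_simps)
  then have "lap (steiner e K) (p *\<^sub>R (l *\<^sub>R y + (1 - l) *\<^sub>R reflect e y')) \<le> lap K (p *\<^sub>R y) powr l * lap K (p *\<^sub>R y') powr (1 - l)"
    using lap_steiner[OF e _ _ _ l, of K "p *\<^sub>R y" "p *\<^sub>R y'"] K bal unfolding eq by (simp add: body_def)
  then have "(lap K (p *\<^sub>R y) powr l * lap K (p *\<^sub>R y') powr (1 - l)) powr (- (1 / p))
      \<le> psi p (steiner e K) (l *\<^sub>R y + (1 - l) *\<^sub>R reflect e y')"
    unfolding psi_def using lap_pos[of "steiner e K"] body_steiner[OF e K] p
    by (intro powr_mono2') (auto simp: body_def)
  then show ?thesis
    unfolding psi_def by (simp add: powr_mult powr_powr mult.commute)
qed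

lemma Phi_steiner_balanced:
  fixes e :: "'a::euclidean_space"
  assumes e: "e \<in> Basis" and K: "body K" and p: "0 < p" and fin: "Phi p K < \<infinity>"
    and bal: "(\<integral>\<^sup>+y\<in>{y. 0 < y \<bullet> e}. ennreal (psi p K y) \<partial>lborel)
      = (\<integral>\<^sup>+y\<in>{y. y \<bullet> e < 0}. ennreal (psi p K y) \<partial>lborel)"
  shows "Phi p K \<le> Phi p (steiner e K)"
proof -
  obtain R where R: "0 < R" "\<And>x. x \<in> K \<Longrightarrow> norm x \<le> R"
    using compact_imp_bounded[OF bodyD(1)[OF K]] bounded_pos by blast
  have S: "body (steiner e K)" by (rule body_steiner[OF e K])
  show ?thesis
    unfolding Phi_def
  proof (rule balanced_symmetrization[OF e, where C=R])
    show "psi p (steiner e K) (reflect e y) = psi p (steiner e K) y" for y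
      using psi_orthogonal_image[OF bodyD(1)[OF S] orthogonal_transformation_reflect[OF e], of p y]
      unfolding reflect_steiner[OF e] .
  qed (use R K S p fin bal psi_pos[OF K] psi_loglip[OF K R(2) p] psi_steiner[OF e K p]
      borel_compact[OF bodyD(1)[OF K]] borel_compact[OF bodyD(1)[OF S]] in
      \<open>auto simp: Phi_def intro: borel_measurable_psi\<close>)
qed

text \<open>Origin symmetry makes the integrand even, and \<open>y \<mapsto> - y\<close> exchanges
  the two half-spaces, so balance is automatic.\<close>

lemma Phi_steiner_symmetric:
  fixes e :: "'a::euclidean_space"
  assumes e: "e \<in> Basis" and K: "body K" and p: "0 < p" and fin: "Phi p K < \<infinity>"
    and sym: "uminus ` K = K"
  shows "Phi p K \<le> Phi p (steiner e K)"
proof (rule Phi_steiner_balanced[OF e K p fin])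
  have O: "orthogonal_transformation (uminus :: 'a \<Rightarrow> 'a)"
    by (simp add: orthogonal_transformation_def linear_uminus)
  have [measurable]: "K \<in> sets borel" using bodyD(1)[OF K] by simp
  have "psi p K (- y) = psi p K y" for y
    using psi_orthogonal_image[OF bodyD(1)[OF K] O, of p y] unfolding sym .
  then have "(\<integral>\<^sup>+y. ennreal (psi p K (- y)) * indicator {y. 0 < y \<bullet> e} (- y) \<partial>lborel)
      = (\<integral>\<^sup>+y\<in>{y. y \<bullet> e < 0}. ennreal (psi p K y) \<partial>lborel)"
    by (intro nn_integral_cong) (auto simp: indicator_def)
  then show "(\<integral>\<^sup>+y\<in>{y. 0 < y \<bullet> e}. ennreal (psi p K y) \<partial>lborel)
      = (\<integral>\<^sup>+y\<in>{y. y \<bullet> e < 0}. ennreal (psi p K y) \<partial>lborel)"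
    using nn_integral_lborel_orthogonal[OF O, of "\<lambda>y. ennreal (psi p K y) * indicator {y. 0 < y \<bullet> e} y"] by simp
qed

section \<open>Balancing by translation\<close>

text \<open>The component of the translation along \<open>e\<close> disappears. Hence a body may be
  shifted along \<open>e\<close> in order to balance it without changing its symmetral.\<close>

lemma steiner_translate:
  fixes e :: "'a::euclidean_space"
  assumes e: "e \<in> Basis"
  shows "steiner e ((\<lambda>x. x - z) ` K) = (\<lambda>x. x - (z - (z \<bullet> e) *\<^sub>R e)) ` steiner e K"
proof -
  have sub: "steiner e ((\<lambda>x. x - z) ` K) \<subseteq> (\<lambda>x. x - (z - (z \<bullet> e) *\<^sub>R e)) ` steiner e K" for z :: 'a and K
  proof
    fix x assume "x \<in> steiner e ((\<lambda>x. x - z) ` K)"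
    then obtain u v where u: "u \<in> K" "v \<in> K" "(u - z) - ((u - z) \<bullet> e) *\<^sub>R e = (v - z) - ((v - z) \<bullet> e) *\<^sub>R e"
      "x = (1 / 2) *\<^sub>R (u - z + reflect e (v - z))"
      by (elim steinerE imageE) simp
    have mem: "(1 / 2) *\<^sub>R (u + reflect e v) \<in> steiner e K"
      by (rule steinerI[OF u(1,2)]) (use u(3) in \<open>simp_all add: inner_diff_left algebra_simps\<close>)
    have z2: "z + reflect e z = 2 *\<^sub>R (z - (z \<bullet> e) *\<^sub>R e)"
      by (simp add: reflect_def scaleR_2 algebra_simps)
    have z1: "(1 / 2) *\<^sub>R (z + reflect e z) = z - (z \<bullet> e) *\<^sub>R e"
      unfolding z2 by simp
    have "x = (1 / 2) *\<^sub>R (u + reflect e v) - (1 / 2) *\<^sub>R (z + reflect e z)"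
      unfolding u(4) reflect_diff by (simp add: scaleR_diff_right scaleR_add_right)
    then have "x = (1 / 2) *\<^sub>R (u + reflect e v) - (z - (z \<bullet> e) *\<^sub>R e)"
      unfolding z1 .
    then show "x \<in> (\<lambda>x. x - (z - (z \<bullet> e) *\<^sub>R e)) ` steiner e K" by (rule image_eqI[OF _ mem])
  qed
  show ?thesis
  proof (rule equalityI[OF sub])
    have "(\<lambda>x. x - (- z)) ` (\<lambda>x. x - z) ` K = K" by (simp add: image_image)
    then have "steiner e K \<subseteq> (\<lambda>x. x - (- z - (- z \<bullet> e) *\<^sub>R e)) ` steiner e ((\<lambda>x. x - z) ` K)"
      using sub[of "- z" "(\<lambda>x. x - z) ` K"] by simp
    then have "(\<lambda>x. x - (z - (z \<bullet> e) *\<^sub>R e)) ` steiner e K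
      \<subseteq> (\<lambda>x. x - (z - (z \<bullet> e) *\<^sub>R e)) ` (\<lambda>x. x - (- z - (- z \<bullet> e) *\<^sub>R e)) ` steiner e ((\<lambda>x. x - z) ` K)"
      by (rule image_mono)
    then show "(\<lambda>x. x - (z - (z \<bullet> e) *\<^sub>R e)) ` steiner e K \<subseteq> steiner e ((\<lambda>x. x - z) ` K)"
      by (simp add: image_image)
  qed
qed

lemma interior_translate:
  fixes K :: "'a::euclidean_space set"
  shows "interior ((\<lambda>x. x - z) ` K) = (\<lambda>x. x - z) ` interior K"
  using interior_translation[of "- z" K] by simp

lemma body_translate: "body K \<Longrightarrow> body ((\<lambda>x. x - z) ` K)"
  by (auto simp: body_def interior_translate compact_translation_subtract convex_translation_subtract)

text \<open>The integral of \<open>psi\<close> over the half-space \<open>0 < y \<bullet> e\<close>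
  for the body translated by \<open>t\<close> along \<open>e\<close>, written so that only the
  exponential depends on \<open>t\<close>. The opposite half-space is obtained by replacing
  \<open>e\<close> and \<open>t\<close> with their negatives.\<close>

definition tilted_half :: "real \<Rightarrow> 'a set \<Rightarrow> 'a::euclidean_space \<Rightarrow> real \<Rightarrow> ennreal" where
  "tilted_half p K e t = (\<integral>\<^sup>+y\<in>{y. 0 < y \<bullet> e}. ennreal (exp (t * (y \<bullet> e)) * psi p K y) \<partial>lborel)"

lemma tilted_half_mono:
  assumes "s \<le> t" shows "tilted_half p K e s \<le> tilted_half p K e t"
  unfolding tilted_half_def
proof (rule nn_integral_mono)
  fix y
  have "exp (s * (y \<bullet> e)) * psi p K y \<le> exp (t * (y \<bullet> e)) * psi p K y" if "0 < y \<bullet> e"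
    using that assms by (intro mult_right_mono) (auto simp: psi_def)
  then show "ennreal (exp (s * (y \<bullet> e)) * psi p K y) * indicator {y. 0 < y \<bullet> e} y
    \<le> ennreal (exp (t * (y \<bullet> e)) * psi p K y) * indicator {y. 0 < y \<bullet> e} y"
    by (auto simp: indicator_def intro!: ennreal_leI)
qed

lemma Phi_interior_finite:
  assumes K: "body K" and p: "0 < p" and z: "z \<in> interior K"
  shows "Phi p ((\<lambda>x. x - z) ` K) < \<infinity>"
proof -
  have "0 \<in> interior ((\<lambda>x. x - z) ` K)" unfolding interior_translate using z by auto
  then obtain r where "0 < r" "cball 0 r \<subseteq> (\<lambda>x. x - z) ` K" using mem_interior_cball by blast
  then show ?thesis using Phi_finite bodyD(1)[OF body_translate[OF K]] p by blast
qed

lemma tilted_half_finite: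
  assumes K: "body K" and p: "0 < p" and t: "t *\<^sub>R e \<in> interior K"
  shows "tilted_half p K e t < \<infinity>"
proof -
  have "tilted_half p K e t \<le> Phi p ((\<lambda>x. x - t *\<^sub>R e) ` K)"
    unfolding tilted_half_def Phi_def
    by (rule nn_integral_mono) (auto simp: psi_translate[OF K p] indicator_def inner_commute)
  then show ?thesis using Phi_interior_finite[OF K p t] by (rule le_less_trans)
qed

text \<open>At a boundary point the integrand increases along an outer normal \<open>u\<close>. Shifting the half-space
  by \<open>u\<close> therefore does not decrease the integral, although it removes a slab; so it is infinite.\<close>
lemma tilted_half_boundary:
  assumes K: "body K" and p: "0 < p" and t0: "t0 *\<^sub>R e \<in> interior K" and t: "t0 < t" "t *\<^sub>R e \<notin> interior K"
  shows "tilted_half p K e t = \<infinity>"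
proof (rule ccontr)
  assume "tilted_half p K e t \<noteq> \<infinity>"
  then have fin: "tilted_half p K e t \<noteq> \<infinity>" .
  define k where "k = t *\<^sub>R e"
  have Kb: "K \<in> sets borel" using bodyD(1)[OF K] by simp
  obtain u b where u: "u \<noteq> 0" "\<And>x. x \<in> interior K \<Longrightarrow> u \<bullet> x \<le> b" "b \<le> u \<bullet> k"
    using separating_hyperplane_sets[of "interior K" "{k}"] K t by (auto simp: body_def convex_interior k_def)
  have uK: "u \<bullet> x \<le> u \<bullet> k" if "x \<in> K" for x
  proof -
    have "closure (interior K) = closure K" using K by (intro convex_closure_interior) (auto simp: body_def)
    moreover have "closure (interior K) \<subseteq> {x. u \<bullet> x \<le> b}"
      by (rule closure_minimal) (use u(2) closed_halfspace_le in auto)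
    ultimately show ?thesis using that closure_subset[of K] u(3) by force
  qed
  \<comment> \<open>A small ball around the interior point shows that it lies strictly below the
    supporting hyperplane at \<open>k\<close>. Since \<open>k\<close> is reached from it in
    direction \<open>e\<close>, the outer normal satisfies \<open>0 < u \<bullet> e\<close>, so the
    shift by \<open>u\<close> points into the half-space.\<close>
  obtain r where r: "0 < r" "cball (t0 *\<^sub>R e) r \<subseteq> interior K"
    using t0 open_interior open_contains_cball by blast
  have "t0 *\<^sub>R e + (r / norm u) *\<^sub>R u \<in> interior K"
    using r u(1) by (intro subsetD[OF r(2)]) (simp add: dist_norm)
  then have "u \<bullet> (t0 *\<^sub>R e) + (r / norm u) * (u \<bullet> u) \<le> u \<bullet> k"
    using u(2)[of "t0 *\<^sub>R e + (r / norm u) *\<^sub>R u"] u(3) by (simp add: inner_add_right)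
  moreover have "0 < (r / norm u) * (u \<bullet> u)" using r u(1) by simp
  ultimately have "0 < (t - t0) * (u \<bullet> e)" by (simp add: k_def algebra_simps)
  then have ue: "0 < u \<bullet> e" using t(1) by (simp add: zero_less_mult_iff)
  have L: "body ((\<lambda>x. x - k) ` K)" using body_translate[OF K] .
  define \<Theta> where "\<Theta> y = psi p ((\<lambda>x. x - k) ` K) y" for y
  have [measurable]: "\<Theta> \<in> borel_measurable borel"
    unfolding \<Theta>_def using bodyD(1)[OF L] by measurable
  have \<Theta>pos: "0 < \<Theta> y" for y unfolding \<Theta>_def by (rule psi_pos[OF L])
  have th: "tilted_half p K e t = (\<integral>\<^sup>+y\<in>{y. 0 < y \<bullet> e}. ennreal (\<Theta> y) \<partial>lborel)"
    unfolding tilted_half_def \<Theta>_def psi_translate[OF K p] by (simp add: k_def inner_commute)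
  have \<Theta>u: "\<Theta> y \<le> \<Theta> (u + y)" for y
  proof -
    have "ennreal (lap ((\<lambda>x. x - k) ` K) (p *\<^sub>R (u + y))) \<le> ennreal (lap ((\<lambda>x. x - k) ` K) (p *\<^sub>R y))"
      unfolding nn_integral_lap[OF bodyD(1)[OF L], symmetric]
    proof (rule nn_integral_mono)
      fix x
      have "x \<bullet> (p *\<^sub>R (u + y)) \<le> x \<bullet> (p *\<^sub>R y)" if "x \<in> (\<lambda>x. x - k) ` K"
      proof -
        have "x \<bullet> u \<le> 0" using that uK by (auto simp: inner_diff_right inner_commute[of _ u])
        then show ?thesis using p by (simp add: inner_add_right mult_le_0_iff algebra_simps)
      qed
      then show "ennreal (exp (x \<bullet> (p *\<^sub>R (u + y)))) * indicator ((\<lambda>x. x - k) ` K) x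
        \<le> ennreal (exp (x \<bullet> (p *\<^sub>R y))) * indicator ((\<lambda>x. x - k) ` K) x"
        by (simp add: indicator_def ennreal_leI)
    qed
    then have "lap ((\<lambda>x. x - k) ` K) (p *\<^sub>R (u + y)) \<le> lap ((\<lambda>x. x - k) ` K) (p *\<^sub>R y)"
      by (simp add: lap_nonneg)
    then show ?thesis unfolding \<Theta>_def psi_def
      using L lap_pos p by (intro powr_mono2') (auto simp: body_def)
  qed
  let ?S = "{y. 0 < y \<bullet> e \<and> y \<bullet> e < u \<bullet> e}"
  have "open ?S" by (intro open_Collect_conj open_Collect_less continuous_intros)
  then have [measurable]: "?S \<in> sets borel" by simp
  have "(\<integral>\<^sup>+y\<in>{y. 0 < y \<bullet> e}. ennreal (\<Theta> y) \<partial>lborel)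
    \<le> (\<integral>\<^sup>+y. ennreal (\<Theta> (u + y)) * indicator {y. u \<bullet> e < y \<bullet> e} (u + y) \<partial>lborel)"
    by (rule nn_integral_mono) (auto simp: indicator_def inner_add_left intro!: ennreal_leI \<Theta>u)
  also have "\<dots> = (\<integral>\<^sup>+y\<in>{y. u \<bullet> e < y \<bullet> e}. ennreal (\<Theta> y) \<partial>lborel)"
    by (rule nn_integral_lborel_translate) measurable
  finally have le: "(\<integral>\<^sup>+y\<in>{y. 0 < y \<bullet> e}. ennreal (\<Theta> y) \<partial>lborel)
    \<le> (\<integral>\<^sup>+y\<in>{y. u \<bullet> e < y \<bullet> e}. ennreal (\<Theta> y) \<partial>lborel)" .
  have "(\<integral>\<^sup>+y\<in>{y. u \<bullet> e < y \<bullet> e}. ennreal (\<Theta> y) \<partial>lborel)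
      + (\<integral>\<^sup>+y\<in>?S. ennreal (\<Theta> y) \<partial>lborel)
    = (\<integral>\<^sup>+y. ennreal (\<Theta> y) * indicator {y. u \<bullet> e < y \<bullet> e} y + ennreal (\<Theta> y) * indicator ?S y \<partial>lborel)"
    by (rule nn_integral_add[symmetric]) measurable
  also have "\<dots> \<le> (\<integral>\<^sup>+y\<in>{y. 0 < y \<bullet> e}. ennreal (\<Theta> y) \<partial>lborel)"
    by (rule nn_integral_mono) (use ue in \<open>auto simp: indicator_def\<close>)
  finally have sum_le: "(\<integral>\<^sup>+y\<in>{y. u \<bullet> e < y \<bullet> e}. ennreal (\<Theta> y) \<partial>lborel)
      + (\<integral>\<^sup>+y\<in>?S. ennreal (\<Theta> y) \<partial>lborel)
    \<le> (\<integral>\<^sup>+y\<in>{y. 0 < y \<bullet> e}. ennreal (\<Theta> y) \<partial>lborel)" .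
  have "(\<integral>\<^sup>+y\<in>{y. u \<bullet> e < y \<bullet> e}. ennreal (\<Theta> y) \<partial>lborel) \<noteq> top"
    using fin sum_le unfolding th by (auto simp: top_unique)
  moreover have "(\<integral>\<^sup>+y\<in>{y. u \<bullet> e < y \<bullet> e}. ennreal (\<Theta> y) \<partial>lborel)
      + (\<integral>\<^sup>+y\<in>?S. ennreal (\<Theta> y) \<partial>lborel)
    \<le> (\<integral>\<^sup>+y\<in>{y. u \<bullet> e < y \<bullet> e}. ennreal (\<Theta> y) \<partial>lborel) + 0"
    using order_trans[OF sum_le le] by simp
  ultimately have "(\<integral>\<^sup>+y\<in>?S. ennreal (\<Theta> y) \<partial>lborel) = 0"
    unfolding ennreal_add_left_cancel_le by simp
  then have "AE y in lborel. ennreal (\<Theta> y) * indicator ?S y = 0"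
    by (subst (asm) nn_integral_0_iff_AE) auto
  then have "AE y in lborel. y \<notin> ?S"
  proof eventually_elim
    case (elim y)
    then show ?case using \<Theta>pos[of y] by (auto simp: indicator_def ennreal_eq_0_iff split: if_splits)
  qed
  then have "?S \<in> null_sets lborel" by (subst AE_iff_null_sets) auto
  moreover have "(1 / 2) *\<^sub>R u \<in> ?S" using ue by simp
  then have "?S \<noteq> {}" by blast
  ultimately show False
    using open_not_negligible[OF \<open>open ?S\<close>] by (simp add: negligible_iff_null_sets null_sets_completion_iff)
qed

text \<open>At the endpoint \<open>t1\<close> of the chord the value is infinite. Parameters of
  interior points that increase to \<open>t1\<close> reach arbitrarily large finite values by
  monotone convergence.\<close>

lemma tilted_half_unbounded:
  fixes e :: "'a::euclidean_space"
  assumes K: "body K" and p: "0 < p" and e: "e \<noteq> 0" and t0: "t0 *\<^sub>R e \<in> interior K"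
    and M: "M < \<infinity>"
  obtains t where "t0 \<le> t" "t *\<^sub>R e \<in> interior K" "M < tilted_half p K e t"
proof -
  define J where "J = {t. t *\<^sub>R e \<in> interior K}"
  have J_eq: "J = (\<lambda>t. t *\<^sub>R e) -` interior K" by (auto simp: J_def)
  have oJ: "open J" unfolding J_eq by (rule open_vimage) (auto intro!: continuous_intros)
  have cJ: "convex J"
    unfolding J_eq by (rule convex_linear_vimage) (auto intro!: linearI simp: scaleR_add_left convex_interior bodyD[OF K])
  obtain R where R: "\<And>x. x \<in> K \<Longrightarrow> norm x \<le> R"
    using compact_imp_bounded[OF bodyD(1)[OF K]] by (auto simp: bounded_iff)
  have bJ: "t \<le> R / norm e" if "t \<in> J" for t
  proof -
    have "norm (t *\<^sub>R e) \<le> R" using that interior_subset[of K] by (intro R) (auto simp: J_def)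
    then show ?thesis using e by (simp add: field_simps) (smt (verit) mult_right_mono norm_ge_zero)
  qed
  define t1 where "t1 = Sup J"
  have t0J: "t0 \<in> J" using t0 by (simp add: J_def)
  have bdd: "bdd_above J" using bJ by (rule bdd_aboveI)
  have t1: "t \<le> t1" if "t \<in> J" for t unfolding t1_def using that bdd by (rule cSup_upper)
  have t1J: "t1 \<notin> J"
  proof
    assume "t1 \<in> J"
    then obtain r where "0 < r" "cball t1 r \<subseteq> J" using oJ open_contains_cball by blast
    then have "t1 + r \<in> J" by (auto simp: dist_real_def)
    then show False using t1[of "t1 + r"] \<open>0 < r\<close> by simp
  qed
  have lt: "t0 < t1" using t1[OF t0J] t0J t1J by (cases "t0 = t1") auto
  define s where "s n = t1 - (t1 - t0) / (real n + 1)" for n :: nat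
  have s_ge: "t0 \<le> s n" for n
  proof -
    have "(t1 - t0) / (real n + 1) \<le> t1 - t0" using lt by (simp add: divide_le_eq mult_le_cancel_left1)
    then show ?thesis by (simp add: s_def)
  qed
  have s_lt: "s n < t1" for n using lt by (simp add: s_def)
  have s_inc: "s n \<le> s (Suc n)" for n using lt by (simp add: s_def frac_le)
  have s_lim: "s \<longlonglongrightarrow> t1"
  proof -
    have "(\<lambda>n. t1 - (t1 - t0) * inverse (real (Suc n))) \<longlonglongrightarrow> t1 - (t1 - t0) * 0"
      by (intro tendsto_intros LIMSEQ_inverse_real_of_nat)
    then show ?thesis by (simp add: s_def[abs_def] divide_inverse add.commute)
  qed
  have sJ: "s n \<in> J" for n
  proof -
    obtain x where x: "x \<in> J" "s n < x"
      using s_lt[of n] less_cSup_iff[OF _ bdd] t0J unfolding t1_def by blast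
    have "closed_segment t0 x \<subseteq> J" using cJ t0J x(1) by (simp add: closed_segment_subset)
    then show ?thesis using s_ge[of n] x(2) by (auto simp: closed_segment_eq_real_ivl split: if_splits)
  qed
  have [measurable]: "K \<in> sets borel" using bodyD(1)[OF K] by simp
  have "\<infinity> = tilted_half p K e t1"
    by (rule tilted_half_boundary[OF K p t0 lt, symmetric]) (use t1J in \<open>simp add: J_def\<close>)
  also have "\<dots> = (\<integral>\<^sup>+y. (SUP n. ennreal (exp (s n * (y \<bullet> e)) * psi p K y) * indicator {y. 0 < y \<bullet> e} y) \<partial>lborel)"
    unfolding tilted_half_def
  proof (rule nn_integral_cong)
    fix y
    show "ennreal (exp (t1 * (y \<bullet> e)) * psi p K y) * indicator {y. 0 < y \<bullet> e} y
      = (SUP n. ennreal (exp (s n * (y \<bullet> e)) * psi p K y) * indicator {y. 0 < y \<bullet> e} y)"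
    proof (cases "0 < y \<bullet> e")
      case True
      have "(\<lambda>n. ennreal (exp (s n * (y \<bullet> e)) * psi p K y)) \<longlonglongrightarrow> ennreal (exp (t1 * (y \<bullet> e)) * psi p K y)"
        by (intro tendsto_ennrealI tendsto_intros s_lim)
      moreover have "incseq (\<lambda>n. ennreal (exp (s n * (y \<bullet> e)) * psi p K y))"
        using True by (intro incseq_SucI ennreal_leI mult_right_mono) (auto simp: s_inc psi_def)
      ultimately have "(SUP n. ennreal (exp (s n * (y \<bullet> e)) * psi p K y)) = ennreal (exp (t1 * (y \<bullet> e)) * psi p K y)"
        using LIMSEQ_unique LIMSEQ_SUP by blast
      then show ?thesis using True by simp
    qed simp
  qed
  also have "\<dots> = (SUP n. tilted_half p K e (s n))"
    unfolding tilted_half_def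
  proof (rule nn_integral_monotone_convergence_SUP)
    show "incseq (\<lambda>n y. ennreal (exp (s n * (y \<bullet> e)) * psi p K y) * indicator {y. 0 < y \<bullet> e} y)"
    proof (rule incseq_SucI, rule le_funI)
      fix n y
      show "ennreal (exp (s n * (y \<bullet> e)) * psi p K y) * indicator {y. 0 < y \<bullet> e} y
        \<le> ennreal (exp (s (Suc n) * (y \<bullet> e)) * psi p K y) * indicator {y. 0 < y \<bullet> e} y"
        using s_inc[of n] by (auto simp: indicator_def psi_def intro!: ennreal_leI mult_right_mono)
    qed
  qed measurable
  finally have "M < (SUP n. tilted_half p K e (s n))" using M by simp
  then obtain n where "M < tilted_half p K e (s n)" by (auto simp: less_SUP_iff)
  then show ?thesis using that[of "s n"] s_ge sJ by (simp add: J_def)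
qed

text \<open>Inherited from the convexity of the exponential in \<open>t\<close>. Its purpose is
  continuity: a finite convex function on an open interval is continuous.\<close>

lemma tilted_half_convex:
  assumes K: "body K" and p: "0 < p" and J: "convex J" "\<And>t. t \<in> J \<Longrightarrow> t *\<^sub>R e \<in> interior K"
  shows "convex_on J (\<lambda>t. enn2real (tilted_half p K e t))"
proof (rule convex_onI[OF _ J(1)])
  fix u s t :: real assume u: "0 < u" "u < 1" and st: "s \<in> J" "t \<in> J"
  have [measurable]: "K \<in> sets borel" using bodyD(1)[OF K] by simp
  have fin: "tilted_half p K e s < \<infinity>" "tilted_half p K e t < \<infinity>"
    using tilted_half_finite[OF K p] J st by auto
  have "tilted_half p K e ((1 - u) * s + u * t)
    \<le> (\<integral>\<^sup>+y. ennreal (1 - u) * (ennreal (exp (s * (y \<bullet> e)) * psi p K y) * indicator {y. 0 < y \<bullet> e} y)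
      + ennreal u * (ennreal (exp (t * (y \<bullet> e)) * psi p K y) * indicator {y. 0 < y \<bullet> e} y) \<partial>lborel)"
    unfolding tilted_half_def
  proof (rule nn_integral_mono)
    fix y
    have "exp (((1 - u) * s + u * t) * (y \<bullet> e)) = exp ((1 - u) * (s * (y \<bullet> e)) + u * (t * (y \<bullet> e)))"
      by (simp add: algebra_simps)
    also have "\<dots> \<le> (1 - u) * exp (s * (y \<bullet> e)) + u * exp (t * (y \<bullet> e))"
      using convex_onD[OF exp_convex, of u "s * (y \<bullet> e)" "t * (y \<bullet> e)"] u by simp
    finally have "exp (((1 - u) * s + u * t) * (y \<bullet> e)) * psi p K y
      \<le> (1 - u) * (exp (s * (y \<bullet> e)) * psi p K y) + u * (exp (t * (y \<bullet> e)) * psi p K y)"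
      using psi_pos[OF K, of p y] by (auto dest: mult_right_mono[where c="psi p K y"] simp: algebra_simps)
    then have "ennreal (exp (((1 - u) * s + u * t) * (y \<bullet> e)) * psi p K y)
      \<le> ennreal (1 - u) * ennreal (exp (s * (y \<bullet> e)) * psi p K y) + ennreal u * ennreal (exp (t * (y \<bullet> e)) * psi p K y)"
      using u psi_pos[OF K, of p y] by (simp add: ennreal_leI flip: ennreal_mult ennreal_plus)
    then show "ennreal (exp (((1 - u) * s + u * t) * (y \<bullet> e)) * psi p K y) * indicator {y. 0 < y \<bullet> e} y
      \<le> ennreal (1 - u) * (ennreal (exp (s * (y \<bullet> e)) * psi p K y) * indicator {y. 0 < y \<bullet> e} y)
      + ennreal u * (ennreal (exp (t * (y \<bullet> e)) * psi p K y) * indicator {y. 0 < y \<bullet> e} y)"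
      by (auto simp: indicator_def)
  qed
  also have "\<dots> = ennreal (1 - u) * tilted_half p K e s + ennreal u * tilted_half p K e t"
    unfolding tilted_half_def by (subst nn_integral_add) (auto simp: nn_integral_cmult)
  also have "\<dots> = ennreal ((1 - u) * enn2real (tilted_half p K e s) + u * enn2real (tilted_half p K e t))"
    using fin u by (simp add: ennreal_mult)
  finally show "enn2real (tilted_half p K e ((1 - u) *\<^sub>R s + u *\<^sub>R t))
    \<le> (1 - u) * enn2real (tilted_half p K e s) + u * enn2real (tilted_half p K e t)"
    using u by (intro enn2real_leI) auto
qed

text \<open>Otherwise a hyperplane separates the line from the interior, and its normal
  \<open>a\<close> is orthogonal to \<open>e\<close>. Points of the symmetral average the values of
  \<open>a\<close> at two points of \<open>K\<close>, so the symmetral would lie in the half-space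
  \<open>a \<bullet> x \<le> 0\<close>, although it contains a ball around the origin.\<close>

lemma line_meets_interior:
  fixes e :: "'a::euclidean_space"
  assumes e: "e \<in> Basis" and K: "body K" and z: "0 \<in> interior (steiner e K)"
  shows "\<exists>t. t *\<^sub>R e \<in> interior K"
proof (rule ccontr)
  assume no: "\<nexists>t. t *\<^sub>R e \<in> interior K"
  have "convex (range (\<lambda>t. t *\<^sub>R e))"
    by (intro convex_linear_image[of _ UNIV, simplified]) (auto intro!: linearI simp: scaleR_add_left)
  moreover have "interior K \<inter> range (\<lambda>t. t *\<^sub>R e) = {}" using no by auto
  moreover have "convex (interior K)" using K by (simp add: body_def convex_interior)
  ultimately obtain a b where a0: "a \<noteq> 0" "\<forall>x\<in>interior K. a \<bullet> x \<le> b" "\<forall>x\<in>range (\<lambda>t. t *\<^sub>R e). b \<le> a \<bullet> x"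
    using separating_hyperplane_sets[of "interior K" "range (\<lambda>t. t *\<^sub>R e)"] bodyD(3)[OF K] by auto
  then have a: "a \<noteq> 0" "\<And>x. x \<in> interior K \<Longrightarrow> a \<bullet> x \<le> b" "\<And>t. b \<le> a \<bullet> (t *\<^sub>R e)"
    by blast+
  have ae: "a \<bullet> e = 0"
  proof (rule ccontr)
    assume "a \<bullet> e \<noteq> 0"
    then show False using a(3)[of "(b - 1) / (a \<bullet> e)"] by simp
  qed
  then have b: "b \<le> 0" using a(3)[of 0] by simp
  have aK: "a \<bullet> x \<le> 0" if "x \<in> K" for x
  proof -
    have "closure (interior K) = closure K" using K by (intro convex_closure_interior) (auto simp: body_def)
    moreover have "closure (interior K) \<subseteq> {x. a \<bullet> x \<le> b}"
      by (rule closure_minimal) (use a(2) closed_halfspace_le in auto)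
    ultimately show ?thesis using that closure_subset[of K] b by force
  qed
  obtain r where r: "0 < r" "cball 0 r \<subseteq> steiner e K" using z mem_interior_cball by blast
  have "(r / norm a) *\<^sub>R a \<in> steiner e K" using r a(1) by (intro subsetD[OF r(2)]) simp
  then obtain u v where u: "u \<in> K" "v \<in> K" "(r / norm a) *\<^sub>R a = (1 / 2) *\<^sub>R (u + reflect e v)"
    by (rule steinerE)
  have "a \<bullet> ((r / norm a) *\<^sub>R a) = (1 / 2) * (a \<bullet> u + a \<bullet> v)"
    unfolding u(3) using ae by (simp add: inner_add_right reflect_def inner_diff_right)
  also have "\<dots> \<le> 0" using aK[OF u(1)] aK[OF u(2)] by simp
  finally have "a \<bullet> ((r / norm a) *\<^sub>R a) \<le> 0" .
  moreover have "0 < a \<bullet> ((r / norm a) *\<^sub>R a)" using r(1) a(1) by simp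
  ultimately show False by linarith
qed

text \<open>The difference \<open>D\<close> of the two half-space integrals is continuous along the
  chord of interior points and takes both signs, so some translation balances the body. The
  symmetral is the same for all translations along \<open>e\<close>.\<close>

lemma balancing_translation:
  fixes e :: "'a::euclidean_space"
  assumes e: "e \<in> Basis" and K: "body K" and p: "0 < p" and z: "0 \<in> interior (steiner e K)"
  shows "\<exists>t. t *\<^sub>R e \<in> interior K \<and> Phi p ((\<lambda>x. x - t *\<^sub>R e) ` K) \<le> Phi p (steiner e K)"
proof -
  define J where "J = {t. t *\<^sub>R e \<in> interior K}"
  have e0: "e \<noteq> 0" "- e \<noteq> 0" using e by auto
  have J_eq: "J = (\<lambda>t. t *\<^sub>R e) -` interior K" by (auto simp: J_def)
  have oJ: "open J" unfolding J_eq by (rule open_vimage) (auto intro!: continuous_intros)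
  have cJ: "convex J"
    unfolding J_eq by (rule convex_linear_vimage) (auto intro!: linearI convex_interior bodyD[OF K] simp: scaleR_add_left)
  obtain t0 where t0: "t0 \<in> J" using line_meets_interior[OF e K z] by (auto simp: J_def)
  define P where "P t = tilted_half p K e t" for t
  define N where "N t = tilted_half p K (- e) (- t)" for t
  have Pfin: "P t < \<infinity>" and Nfin: "N t < \<infinity>" if "t \<in> J" for t
    unfolding P_def N_def using that by (auto intro!: tilted_half_finite[OF K p, unfolded infinity_ennreal_def] simp: J_def)
  have contP: "continuous_on J (\<lambda>t. enn2real (P t))"
    unfolding P_def by (rule convex_on_continuous[OF oJ tilted_half_convex[OF K p cJ]]) (simp add: J_def)
  have contN: "continuous_on J (\<lambda>t. enn2real (N t))"
  proof -
    have "continuous_on (uminus ` J) (\<lambda>t. enn2real (tilted_half p K (- e) t))"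
      by (rule convex_on_continuous[OF open_negations[OF oJ] tilted_half_convex[OF K p convex_negations[OF cJ]]]) (auto simp: J_def)
    then show ?thesis unfolding N_def
      by (rule continuous_on_compose2) (auto intro!: continuous_intros)
  qed
  define D where "D t = enn2real (P t) - enn2real (N t)" for t
  have contD: "continuous_on J D" unfolding D_def by (intro continuous_intros contP contN)
  have real_less: "P t \<le> N t" if "t \<in> J" "D t \<le> 0" for t
  proof -
    have "P t = ennreal (enn2real (P t))" "N t = ennreal (enn2real (N t))"
      using Pfin[OF that(1)] Nfin[OF that(1)] by simp_all
    moreover have "ennreal (enn2real (P t)) \<le> ennreal (enn2real (N t))"
      using that(2) by (intro ennreal_leI) (simp add: D_def)
    ultimately show ?thesis by metis
  qed
  have real_greater: "N t \<le> P t" if "t \<in> J" "0 \<le> D t" for t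
  proof -
    have "P t = ennreal (enn2real (P t))" "N t = ennreal (enn2real (N t))"
      using Pfin[OF that(1)] Nfin[OF that(1)] by simp_all
    moreover have "ennreal (enn2real (N t)) \<le> ennreal (enn2real (P t))"
      using that(2) by (intro ennreal_leI) (simp add: D_def)
    ultimately show ?thesis by metis
  qed
  \<comment> \<open>To the right of \<open>t0\<close> the integral \<open>N\<close> stays below
    \<open>N t0\<close>, while \<open>P\<close> eventually exceeds this value. The opposite sign is
    found to the left of \<open>t0\<close> in the same way.\<close>
  have "\<exists>t\<in>J. D t \<ge> 0"
  proof -
    obtain t where t: "t0 \<le> t" "t *\<^sub>R e \<in> interior K" "N t0 < P t"
      using tilted_half_unbounded[OF K p e0(1) _ Nfin[OF t0]] t0 unfolding P_def J_def by auto
    have "N t \<le> N t0" unfolding N_def by (rule tilted_half_mono) (use t(1) in simp)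
    then have "\<not> P t \<le> N t" using t(3) by auto
    then have "0 \<le> D t" using real_less[of t] t(2) by (metis J_def le_cases mem_Collect_eq)
    then show ?thesis using t(2) by (auto simp: J_def)
  qed
  then obtain b where b: "b \<in> J" "0 \<le> D b" by blast
  have "\<exists>t\<in>J. D t \<le> 0"
  proof -
    have "(- t0) *\<^sub>R (- e) \<in> interior K" using t0 by (simp add: J_def)
    then obtain s where s: "- t0 \<le> s" "s *\<^sub>R (- e) \<in> interior K" "P t0 < tilted_half p K (- e) s"
      by (rule tilted_half_unbounded[OF K p e0(2) _ Pfin[OF t0]])
    define t where "t = - s"
    have t: "t \<le> t0" "t \<in> J" "P t0 < N t" using s by (auto simp: t_def J_def N_def)
    have "P t \<le> P t0" unfolding P_def by (rule tilted_half_mono) (rule t(1))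
    then have "\<not> N t \<le> P t" using t(3) by auto
    then have "D t \<le> 0" using real_greater[of t] t(2) by (metis le_cases)
    then show ?thesis using t(2) by blast
  qed
  then obtain a where a: "a \<in> J" "D a \<le> 0" by blast
  have "connected (D ` J)"
    using contD convex_connected[OF cJ] by (rule connected_continuous_image)
  then have "{D a..D b} \<subseteq> D ` J" using a b by (intro connected_contains_Icc) auto
  then obtain t where t: "t \<in> J" "D t = 0" using a b by fastforce
  have PN: "P t = N t" using real_less[of t] real_greater[of t] t by (intro antisym) auto
  let ?K = "(\<lambda>x. x - t *\<^sub>R e) ` K"
  have "Phi p ?K \<le> Phi p (steiner e ?K)"
  proof (rule Phi_steiner_balanced[OF e body_translate[OF K] p])
    show "Phi p ?K < \<infinity>" by (rule Phi_interior_finite[OF K p]) (use t in \<open>simp add: J_def\<close>)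
    have "(\<integral>\<^sup>+y\<in>{y. 0 < y \<bullet> e}. ennreal (psi p ?K y) \<partial>lborel) = P t"
      unfolding P_def tilted_half_def psi_translate[OF K p] by (simp add: inner_commute)
    moreover have "(\<integral>\<^sup>+y\<in>{y. y \<bullet> e < 0}. ennreal (psi p ?K y) \<partial>lborel) = N t"
      unfolding N_def tilted_half_def psi_translate[OF K p] by (simp add: inner_commute)
    ultimately show "(\<integral>\<^sup>+y\<in>{y. 0 < y \<bullet> e}. ennreal (psi p ?K y) \<partial>lborel)
      = (\<integral>\<^sup>+y\<in>{y. y \<bullet> e < 0}. ennreal (psi p ?K y) \<partial>lborel)" using PN by simp
  qed
  also have "steiner e ?K = steiner e K"
    unfolding steiner_translate[OF e] using e by simp
  finally show ?thesis using t(1) by (auto simp: J_def)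
qed

section \<open>Reduction to symmetric bodies\<close>

lemma reflect_commute:
  assumes "i \<in> Basis" "e \<in> Basis" "i \<noteq> e"
  shows "reflect i (reflect e x) = reflect e (reflect i x)"
  using assms by (simp add: reflect_def inner_diff_left inner_Basis algebra_simps)

text \<open>Reflections in two different coordinate directions commute, and the one along
  \<open>i\<close> fixes \<open>e\<close> and heights along \<open>e\<close>. Thus symmetries
  already gained survive later symmetrizations.\<close>

lemma reflect_steiner_other:
  assumes i: "i \<in> Basis" and e: "e \<in> Basis" and ne: "i \<noteq> e" and K: "reflect i ` K = K"
  shows "reflect i ` steiner e K = steiner e K"
proof -
  have inn: "reflect i w \<bullet> e = w \<bullet> e" for w
    using i e ne by (simp add: reflect_def inner_diff_left inner_Basis)
  have fe: "reflect i e = e" using i e ne by (simp add: reflect_def inner_Basis)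
  have sub: "reflect i x \<in> steiner e K" if "x \<in> steiner e K" for x
    using that
  proof (rule steinerE)
    fix u v assume u: "u \<in> K" "v \<in> K" "u - (u \<bullet> e) *\<^sub>R e = v - (v \<bullet> e) *\<^sub>R e" "x = (1 / 2) *\<^sub>R (u + reflect e v)"
    have "reflect i (u - (u \<bullet> e) *\<^sub>R e) = reflect i (v - (v \<bullet> e) *\<^sub>R e)" using u(3) by simp
    then have "reflect i u - (reflect i u \<bullet> e) *\<^sub>R e = reflect i v - (reflect i v \<bullet> e) *\<^sub>R e"
      by (simp add: reflect_diff reflect_scaleR fe inn)
    then show ?thesis
      by (rule steinerI[rotated 2])
         (use u(1,2) K u(4) reflect_commute[OF i e ne] in \<open>auto simp: reflect_add reflect_scaleR\<close>)
  qed
  then have "x \<in> reflect i ` steiner e K" if "x \<in> steiner e K" for x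
    using that i by (intro image_eqI[of _ _ "reflect i x"]) auto
  with sub show ?thesis by blast
qed

text \<open>The statement quantifies over all admissible translations \<open>w\<close> of the
  symmetrized body because the next direction decides which one is used. For a new direction
  \<open>e\<close>, balancing the translate by \<open>w\<close> replaces \<open>w\<close> by
  \<open>w + t e\<close>, which is still orthogonal to the earlier directions. Once all directions
  are treated, only \<open>w = 0\<close> remains.\<close>

lemma exists_unconditional:
  fixes K I :: "'a::euclidean_space set"
  assumes "finite I" "I \<subseteq> Basis" and K: "body K" and p: "0 < p"
  shows "\<exists>C. body C \<and> emeasure lborel C = emeasure lborel K \<and> (\<forall>i\<in>I. reflect i ` C = C) \<and>
    (\<forall>w\<in>interior C. (\<forall>i\<in>I. w \<bullet> i = 0) \<longrightarrow>
      (\<exists>z. Phi p ((\<lambda>x. x - z) ` K) \<le> Phi p ((\<lambda>x. x - w) ` C)))"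
  using assms(1,2)
proof (induction I rule: finite_induct)
  case empty
  show ?case by (intro exI[of _ K]) (use K in auto)
next
  case (insert e I)
  then obtain C where C: "body C" "emeasure lborel C = emeasure lborel K" "\<forall>i\<in>I. reflect i ` C = C"
    "\<And>w. w \<in> interior C \<Longrightarrow> (\<forall>i\<in>I. w \<bullet> i = 0) \<Longrightarrow> \<exists>z. Phi p ((\<lambda>x. x - z) ` K) \<le> Phi p ((\<lambda>x. x - w) ` C)"
    by auto
  have e: "e \<in> Basis" using insert by auto
  show ?case
  proof (intro exI[of _ "steiner e C"] conjI ballI impI)
    show "body (steiner e C)" by (rule body_steiner[OF e C(1)])
    show "emeasure lborel (steiner e C) = emeasure lborel K"
      using emeasure_steiner[OF e bodyD(1,2)[OF C(1)]] C(2) by simp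
    show "reflect i ` steiner e C = steiner e C" if "i \<in> insert e I" for i
    proof (cases "i = e")
      case True
      then show ?thesis using reflect_steiner[OF e] by simp
    next
      case False
      then have "i \<in> I" "i \<in> Basis" using that insert by auto
      then show ?thesis using reflect_steiner_other[OF _ e False] C(3) by blast
    qed
    fix w assume w: "w \<in> interior (steiner e C)" "\<forall>i\<in>insert e I. w \<bullet> i = 0"
    let ?C = "(\<lambda>x. x - w) ` C"
    have eq: "steiner e ?C = (\<lambda>x. x - w) ` steiner e C"
      unfolding steiner_translate[OF e] using w(2) by simp
    have "0 \<in> interior (steiner e ?C)"
      unfolding eq interior_translate using w(1) by auto
    then obtain t where t: "t *\<^sub>R e \<in> interior ?C"
      "Phi p ((\<lambda>x. x - t *\<^sub>R e) ` ?C) \<le> Phi p (steiner e ?C)"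
      using balancing_translation[OF e body_translate[OF C(1)] p] by blast
    have "w + t *\<^sub>R e \<in> interior C" using t(1) unfolding interior_translate by (auto simp: algebra_simps)
    moreover have "\<forall>i\<in>I. (w + t *\<^sub>R e) \<bullet> i = 0"
      using w(2) insert e by (auto simp: inner_add_left inner_Basis)
    ultimately obtain z where z: "Phi p ((\<lambda>x. x - z) ` K) \<le> Phi p ((\<lambda>x. x - (w + t *\<^sub>R e)) ` C)"
      using C(4) by blast
    also have "(\<lambda>x. x - (w + t *\<^sub>R e)) ` C = (\<lambda>x. x - t *\<^sub>R e) ` ?C"
      by (simp add: image_image algebra_simps)
    also note t(2)
    finally show "\<exists>z. Phi p ((\<lambda>x. x - z) ` K) \<le> Phi p ((\<lambda>x. x - w) ` steiner e C)"
      unfolding eq by blast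
  qed
qed

lemma unconditional_imp_symmetric:
  fixes C :: "'a::euclidean_space set"
  assumes C: "\<And>i. i \<in> Basis \<Longrightarrow> reflect i ` C = C"
  shows "uminus ` C = C"
proof -
  \<comment> \<open>The reflections in the directions of \<open>F\<close>, applied one after another
    to \<open>x\<close>, give this sum, since basis vectors are orthogonal; with the whole basis the
    result is \<open>- x\<close>.\<close>
  have part: "x - (\<Sum>b\<in>F. (2 * (x \<bullet> b)) *\<^sub>R b) \<in> C" if "finite F" "F \<subseteq> Basis" "x \<in> C" for F x
    using that
  proof (induction F rule: finite_induct)
    case (insert b F)
    define w where "w = x - (\<Sum>b\<in>F. (2 * (x \<bullet> b)) *\<^sub>R b)"
    have "(\<Sum>a\<in>F. (2 * (x \<bullet> a)) * (a \<bullet> b)) = 0"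
    proof (intro sum.neutral ballI)
      fix a assume "a \<in> F"
      then have "a \<in> Basis" "b \<in> Basis" "a \<noteq> b" using insert by auto
      then show "2 * (x \<bullet> a) * (a \<bullet> b) = 0" by (simp add: inner_not_same_Basis)
    qed
    then have "w \<bullet> b = x \<bullet> b" by (simp add: w_def inner_diff_left inner_sum_left)
    then have "reflect b w = x - (\<Sum>b\<in>insert b F. (2 * (x \<bullet> b)) *\<^sub>R b)"
      using insert by (simp add: reflect_def w_def algebra_simps)
    moreover have "reflect b w \<in> C" using insert C[of b] unfolding w_def by blast
    ultimately show ?case by simp
  qed simp
  have "- x \<in> C" if "x \<in> C" for x
  proof -
    have "(\<Sum>b\<in>Basis. (2 * (x \<bullet> b)) *\<^sub>R b) = 2 *\<^sub>R (\<Sum>b\<in>Basis. (x \<bullet> b) *\<^sub>R b)"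
      by (simp add: scaleR_sum_right)
    then have "x - (\<Sum>b\<in>Basis. (2 * (x \<bullet> b)) *\<^sub>R b) = - x"
      by (simp add: euclidean_representation scaleR_2)
    then show ?thesis using part[OF finite_Basis subset_refl that] by simp
  qed
  then show ?thesis by (force simp: image_iff)
qed

lemma symmetric_zero_interior:
  fixes C :: "'a::euclidean_space set"
  assumes C: "body C" "uminus ` C = C"
  shows "0 \<in> interior C"
proof -
  obtain c where c: "c \<in> interior C" using bodyD(3)[OF C(1)] by blast
  then have "- c \<in> interior C" using interior_negations[of C] C(2) by auto
  then have "(1 / 2) *\<^sub>R c + (1 / 2) *\<^sub>R (- c) \<in> interior C"
    using c convex_interior[OF bodyD(2)[OF C(1)]] by (intro convexD) auto
  then show ?thesis by simp
qed

lemma exists_symmetric: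
  fixes K :: "'a::euclidean_space set"
  assumes K: "body K" and p: "0 < p"
  obtains C :: "'a set" and z where "body C" "uminus ` C = C" "emeasure lborel C = emeasure lborel K"
    "Phi p ((\<lambda>x. x - z) ` K) \<le> Phi p C"
proof -
  obtain C :: "'a set" where C: "body C" "emeasure lborel C = emeasure lborel K" "\<forall>i\<in>Basis. reflect i ` C = C"
    "\<forall>w\<in>interior C. (\<forall>i\<in>Basis. w \<bullet> i = 0) \<longrightarrow> (\<exists>z. Phi p ((\<lambda>x. x - z) ` K) \<le> Phi p ((\<lambda>x. x - w) ` C))"
    using exists_unconditional[OF finite_Basis subset_refl K p] by blast
  have "uminus ` C = C" by (rule unconditional_imp_symmetric) (use C(3) in blast)
  moreover from this have "0 \<in> interior C" by (rule symmetric_zero_interior[OF C(1)])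
  then obtain z where "Phi p ((\<lambda>x. x - z) ` K) \<le> Phi p ((\<lambda>x. x - 0) ` C)" using C(4) by force
  ultimately show ?thesis using that C(1,2) by simp
qed

section \<open>Selection of convergent subsequences\<close>

text \<open>Choose the subsequence so that membership of every point of a countable dense set is eventually
  constant. The uniform inner ball then forces convergence at all points off the frontier of the
  closure of the limit inferior.\<close>

lemma convex_selection:
  fixes C :: "nat \<Rightarrow> 'a::euclidean_space set"
  assumes r: "0 < r" and C: "\<And>k. convex (C k)" "\<And>k. cball 0 r \<subseteq> C k" "\<And>k. C k \<subseteq> cball 0 R"
  obtains s L where "strict_mono (s :: nat \<Rightarrow> nat)" "compact L" "convex L" "cball 0 r \<subseteq> L" "L \<subseteq> cball 0 R"
    "\<forall>x. x \<notin> frontier L \<longrightarrow> (\<forall>\<^sub>F k in sequentially. (x \<in> C (s k)) = (x \<in> L))"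
    "(\<forall>k. uminus ` C k = C k) \<longrightarrow> uminus ` L = L"
proof -
  obtain D :: "'a set" where D: "countable D" "\<And>X. open X \<Longrightarrow> X \<noteq> {} \<Longrightarrow> \<exists>d\<in>D. d \<in> X"
    using countable_dense_exists[where 'a='a] by auto
  \<comment> \<open>Diagonal selection for the indicator functions, viewed as bounded functions on
    the countable set \<open>D\<close>.\<close>
  obtain s where s: "strict_mono (s :: nat \<Rightarrow> nat)"
    "\<And>x. x \<in> D \<Longrightarrow> \<exists>l. (\<lambda>k. indicat_real (C (s k)) x) \<longlonglongrightarrow> l"
    using function_convergent_subsequence[of D "\<lambda>k. indicat_real (C k)" 1] D(1) by (auto simp: indicator_def)
  define U where "U = {x. \<forall>\<^sub>F k in sequentially. x \<in> C (s k)}"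
  define L where "L = closure U"
  \<comment> \<open>A convergent sequence with values 0 and 1 is eventually constant; on
    \<open>D\<close> frequent membership is therefore eventual membership.\<close>
  have freq: "d \<in> U" if dD: "d \<in> D" and dC: "\<exists>\<^sub>F k in sequentially. d \<in> C (s k)" for d
  proof -
    obtain l where l: "(\<lambda>k. indicat_real (C (s k)) d) \<longlonglongrightarrow> l" using s(2)[OF dD] by blast
    then have ev: "\<forall>\<^sub>F k in sequentially. dist (indicat_real (C (s k)) d) l < 1 / 2"
      by (rule tendstoD) simp
    then have "\<exists>\<^sub>F k in sequentially. d \<in> C (s k) \<and> dist (indicat_real (C (s k)) d) l < 1 / 2"
      by (rule frequently_eventually_frequently[OF dC])
    then obtain k where "d \<in> C (s k)" "dist (indicat_real (C (s k)) d) l < 1 / 2"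
      using frequently_ex by blast
    then have l1: "1 / 2 < l" by (simp add: dist_real_def abs_if split: if_splits)
    show ?thesis unfolding U_def mem_Collect_eq
      using ev
    proof eventually_elim
      case (elim k)
      then show ?case using l1 by (cases "d \<in> C (s k)") (auto simp: dist_real_def)
    qed
  qed
  have cU: "convex U"
  proof (rule convexI)
    fix x y u v assume "x \<in> U" "y \<in> U" and uv: "0 \<le> u" "0 \<le> v" "u + v = (1 :: real)"
    then have "\<forall>\<^sub>F k in sequentially. x \<in> C (s k) \<and> y \<in> C (s k)" by (simp add: U_def eventually_conj)
    then show "u *\<^sub>R x + v *\<^sub>R y \<in> U" unfolding U_def mem_Collect_eq
      by eventually_elim (use C(1) uv in \<open>auto simp: convex_def\<close>)
  qed
  have rU: "cball 0 r \<subseteq> U" unfolding U_def using C(2) by (auto intro!: always_eventually)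
  have UR: "U \<subseteq> cball 0 R"
  proof
    fix x assume "x \<in> U"
    then obtain k where "x \<in> C (s k)" unfolding U_def using eventually_happens[of _ sequentially] by auto
    then show "x \<in> cball 0 R" using C(3) by blast
  qed
  have notL: "\<forall>\<^sub>F k in sequentially. x \<notin> C (s k)" if "x \<notin> L" for x
  proof (rule ccontr)
    assume "\<not> ?thesis"
    then have fr: "\<exists>\<^sub>F k in sequentially. x \<in> C (s k)" by (simp add: frequently_def)
    have "x \<in> closure U"
      unfolding closure_approachable
    proof (intro allI impI)
      fix \<epsilon> :: real assume eps: "0 < \<epsilon>"
      \<comment> \<open>Shrinking \<open>x\<close> towards the origin by the factor
        \<open>1 - \<delta>\<close> leaves room for a ball of radius \<open>\<delta> * r\<close> in
        every convex set that contains \<open>x\<close> and the inner ball. A point \<open>w\<close>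
        of \<open>D\<close> in this room belongs to \<open>C (s k)\<close> whenever \<open>x\<close>
        does, and it differs from \<open>x\<close> by less than
        \<open>\<delta> * (norm x + r)\<close>, which is at most \<epsilon>.\<close>
      define \<delta> where "\<delta> = min (1 / 2) (\<epsilon> / (norm x + r))"
      have nr: "0 < norm x + r" using r by (simp add: add_nonneg_pos)
      have d: "0 < \<delta>" "\<delta> < 1" using eps nr by (auto simp: \<delta>_def)
      have de: "\<delta> * (norm x + r) \<le> \<epsilon>" using nr by (simp add: \<delta>_def min_mult_distrib_right)
      obtain w where w: "w \<in> D" "w \<in> ball ((1 - \<delta>) *\<^sub>R x) (\<delta> * r)"
        using D(2)[OF open_ball, of "(1 - \<delta>) *\<^sub>R x" "\<delta> * r"] mult_pos_pos[OF d(1) r] by force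
      define v where "v = (w - (1 - \<delta>) *\<^sub>R x) /\<^sub>R \<delta>"
      have "norm (w - (1 - \<delta>) *\<^sub>R x) < \<delta> * r"
        using w(2) by (simp add: dist_norm norm_minus_commute)
      then have "norm (w - (1 - \<delta>) *\<^sub>R x) / \<delta> \<le> r"
        using d by (simp add: pos_divide_le_eq mult.commute)
      then have nv: "norm v \<le> r" using d by (simp add: v_def divide_inverse mult.commute)
      have wv: "w = (1 - \<delta>) *\<^sub>R x + \<delta> *\<^sub>R v" using d by (simp add: v_def)
      have "\<exists>\<^sub>F k in sequentially. w \<in> C (s k)"
        using fr
      proof (rule frequently_elim1)
        fix k assume "x \<in> C (s k)"
        moreover have "v \<in> C (s k)" using C(2)[of "s k"] nv by auto
        ultimately show "w \<in> C (s k)" unfolding wv using C(1)[of "s k"] d by (intro convexD) auto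
      qed
      then have "w \<in> U" using freq w(1) by blast
      moreover have "dist w x < \<epsilon>"
      proof -
        have "w - x = (w - (1 - \<delta>) *\<^sub>R x) - \<delta> *\<^sub>R x" by (simp add: algebra_simps)
        then have "norm (w - x) \<le> norm (w - (1 - \<delta>) *\<^sub>R x) + norm (\<delta> *\<^sub>R x)" by (metis norm_triangle_ineq4)
        moreover have "norm (w - (1 - \<delta>) *\<^sub>R x) < \<delta> * r" using w(2) by (simp add: dist_norm norm_minus_commute)
        ultimately have "norm (w - x) < \<delta> * (norm x + r)" using d by (simp add: algebra_simps)
        then show ?thesis using de by (simp add: dist_norm)
      qed
      ultimately show "\<exists>y\<in>U. dist y x < \<epsilon>" by blast
    qed
    then show False using that by (simp add: L_def)
  qed
  show ?thesis
  proof (rule that[OF s(1), of L])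
    show "compact L" unfolding L_def using UR bounded_cball bounded_subset by (auto simp: compact_closure)
    show "convex L" unfolding L_def using cU by (rule convex_closure)
    show "cball 0 r \<subseteq> L" unfolding L_def using rU closure_subset by blast
    show "L \<subseteq> cball 0 R" unfolding L_def by (rule closure_minimal[OF UR]) simp
    have "\<forall>\<^sub>F k in sequentially. (x \<in> C (s k)) = (x \<in> L)" if "x \<notin> frontier L" for x
    proof (cases "x \<in> L")
      case True
      then have "x \<in> interior L" using that by (simp add: frontier_def L_def)
      \<comment> \<open>Taking the closure does not enlarge the interior of a convex set, so
        interior points of \<open>L\<close> already lie in \<open>U\<close>.\<close>
      then have "x \<in> U" unfolding L_def convex_interior_closure[OF cU] using interior_subset by blast
      then show ?thesis unfolding U_def using True by simp
    next
      case False
      then show ?thesis using notL by simp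
    qed
    then show "\<forall>x. x \<notin> frontier L \<longrightarrow> (\<forall>\<^sub>F k in sequentially. (x \<in> C (s k)) = (x \<in> L))"
      by blast
    show "(\<forall>k. uminus ` C k = C k) \<longrightarrow> uminus ` L = L"
    proof
      assume sym: "\<forall>k. uminus ` C k = C k"
      have "(- x \<in> C k) = (x \<in> C k)" for x k using sym by force
      then have neg: "(- x \<in> U) = (x \<in> U)" for x by (simp add: U_def)
      have "uminus ` U = U"
      proof (intro equalityI subsetI)
        fix x assume "x \<in> uminus ` U" then show "x \<in> U" using neg by auto
      next
        fix x assume "x \<in> U" then show "x \<in> uminus ` U" using neg[of x] by (intro image_eqI[of _ _ "- x"]) auto
      qed
      then show "uminus ` L = L"
        unfolding L_def using closure_injective_linear_image[of uminus U] by (simp add: linear_uminus)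
    qed
  qed
qed

section \<open>Continuity of integrals along a convergent sequence of convex sets\<close>

lemma AE_notin_frontier_convex:
  fixes L :: "'a::euclidean_space set"
  assumes "convex L" shows "AE x in lborel. x \<notin> frontier L"
proof -
  have "frontier L \<in> null_sets lborel"
    using negligible_convex_frontier[OF assms]
    by (simp add: negligible_iff_null_sets null_sets_completion_iff)
  then show ?thesis by (rule AE_not_in)
qed

text \<open>The frontier of a convex set is a null set, so the indicator functions converge almost
  everywhere; the ball of radius \<open>R\<close> supplies the dominating function.\<close>

lemma nn_integral_convex_limit:
  fixes C :: "nat \<Rightarrow> 'a::euclidean_space set"
  assumes C: "\<And>k. compact (C k)" "\<And>k. C k \<subseteq> cball 0 R" and L: "compact L" "convex L"
    and lim: "\<And>x. x \<notin> frontier L \<Longrightarrow> \<forall>\<^sub>F k in sequentially. (x \<in> C k) = (x \<in> L)"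
    and [measurable]: "\<phi> \<in> borel_measurable borel"
    and fin: "(\<integral>\<^sup>+x\<in>(cball 0 R). \<phi> x \<partial>lborel) < \<infinity>"
  shows "(\<lambda>k. \<integral>\<^sup>+x. \<phi> x * indicator (C k) x \<partial>lborel) \<longlonglongrightarrow> (\<integral>\<^sup>+x\<in>L. \<phi> x \<partial>lborel)"
proof (rule nn_integral_dominated_convergence[where w="\<lambda>x. \<phi> x * indicator (cball 0 R) x"])
  have [measurable]: "C k \<in> sets borel" "L \<in> sets borel" "cball (0::'a) R \<in> sets borel" for k using C L by auto
  show "(\<lambda>x. \<phi> x * indicator (C k) x) \<in> borel_measurable lborel"
    "(\<lambda>x. \<phi> x * indicator L x) \<in> borel_measurable lborel"
    "(\<lambda>x. \<phi> x * indicator (cball 0 R) x) \<in> borel_measurable lborel" for k by measurable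
  show "AE x in lborel. \<phi> x * indicator (C k) x \<le> \<phi> x * indicator (cball 0 R) x" for k
    using C(2)[of k] by (intro AE_I2 mult_left_mono) (auto simp: indicator_def)
  show "AE x in lborel. (\<lambda>k. \<phi> x * indicator (C k) x) \<longlonglongrightarrow> \<phi> x * indicator L x"
    using AE_notin_frontier_convex[OF L(2)]
  proof eventually_elim
    case (elim x)
    have "\<forall>\<^sub>F k in sequentially. \<phi> x * indicator L x = \<phi> x * indicator (C k) x"
      using lim[OF elim] by eventually_elim (simp add: indicator_def)
    then show ?case by (rule Lim_transform_eventually[OF tendsto_const])
  qed
qed (rule fin)

lemma lap_convex_limit:
  fixes C :: "nat \<Rightarrow> 'a::euclidean_space set"
  assumes C: "\<And>k. compact (C k)" "\<And>k. C k \<subseteq> cball 0 R" and L: "compact L" "convex L"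
    and lim: "\<And>x. x \<notin> frontier L \<Longrightarrow> \<forall>\<^sub>F k in sequentially. (x \<in> C k) = (x \<in> L)"
  shows "(\<lambda>k. lap (C k) y) \<longlonglongrightarrow> lap L y"
proof -
  have "(\<lambda>k. ennreal (lap (C k) y)) \<longlonglongrightarrow> ennreal (lap L y)"
    unfolding nn_integral_lap[OF C(1), symmetric] nn_integral_lap[OF L(1), symmetric]
    by (rule nn_integral_convex_limit[OF C L lim]) (auto simp: nn_integral_lap)
  then show ?thesis by (simp add: lap_nonneg)
qed

text \<open>All integrands are dominated by the one of the common inner ball, which is integrable. A
  uniform inner radius is what prevents mass from escaping to infinity.\<close>

lemma Phi_convex_limit:
  fixes C :: "nat \<Rightarrow> 'a::euclidean_space set"
  assumes r: "0 < r" and p: "0 < p"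
    and C: "\<And>k. compact (C k)" "\<And>k. C k \<subseteq> cball 0 R" "\<And>k. cball 0 r \<subseteq> C k"
    and L: "compact L" "convex L" "cball 0 r \<subseteq> L"
    and lim: "\<And>x. x \<notin> frontier L \<Longrightarrow> \<forall>\<^sub>F k in sequentially. (x \<in> C k) = (x \<in> L)"
  shows "(\<lambda>k. Phi p (C k)) \<longlonglongrightarrow> Phi p L"
  unfolding Phi_def
proof (rule nn_integral_dominated_convergence[where w="\<lambda>y. ennreal (psi p (cball 0 r) y)"])
  have B: "body (cball (0::'a) r)" using r by (simp add: body_def)
  have [measurable]: "C k \<in> sets borel" "L \<in> sets borel" for k using C L by auto
  show "(\<lambda>y. ennreal (psi p (C k) y)) \<in> borel_measurable lborel"
    "(\<lambda>y. ennreal (psi p L y)) \<in> borel_measurable lborel"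
    "(\<lambda>y. ennreal (psi p (cball 0 r) y)) \<in> borel_measurable lborel" for k by measurable
  show "AE y in lborel. ennreal (psi p (C k) y) \<le> ennreal (psi p (cball 0 r) y)" for k
    using psi_antimono[OF B C(1) C(3) p] by (intro AE_I2 ennreal_leI)
  show "(\<integral>\<^sup>+y. ennreal (psi p (cball (0::'a) r) y) \<partial>lborel) < \<infinity>"
    using Phi_finite[OF compact_cball subset_refl r p] unfolding Phi_def .
  have "interior L \<noteq> {}" using L(3) r by (metis ball_eq_empty ball_subset_cball empty_subsetI interior_maximal
      not_le open_ball order_trans subset_empty)
  then have "lap L (p *\<^sub>R y) \<noteq> 0" for y using lap_pos[OF L(1), of "p *\<^sub>R y"] by simp
  then show "AE y in lborel. (\<lambda>k. ennreal (psi p (C k) y)) \<longlonglongrightarrow> ennreal (psi p L y)"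
    unfolding psi_def
    by (intro AE_I2 tendsto_ennrealI tendsto_powr lap_convex_limit[OF C(1,2) L(1,2) lim] tendsto_const) auto
qed

text \<open>The Householder reflection along \<open>w\<close>, the difference of \<open>d\<close>
  and its target. Since both have the same norm, \<open>w \<bullet> w = 2 * (d \<bullet> w)\<close>,
  and the reflection sends \<open>d\<close> to \<open>d - w\<close>.\<close>

lemma exists_orthogonal_to_Basis:
  fixes d e :: "'a::euclidean_space"
  assumes "e \<in> Basis"
  obtains Q where "orthogonal_transformation Q" "Q d = norm d *\<^sub>R e"
proof (cases "d = norm d *\<^sub>R e")
  case True
  then show ?thesis using that[of "\<lambda>x. x"] by (simp add: orthogonal_transformation_def linear_ident)
next
  case False
  define w where "w = d - norm d *\<^sub>R e"
  have w0: "w \<bullet> w \<noteq> 0" using False by (simp add: w_def)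
  define Q where "Q x = x - (2 * (x \<bullet> w) / (w \<bullet> w)) *\<^sub>R w" for x
  have lin: "linear Q" unfolding Q_def
    by (rule linearI) (auto simp: inner_add_left algebra_simps add_divide_distrib)
  have "Q x \<bullet> Q y = x \<bullet> y" for x y
  proof -
    have "Q x \<bullet> Q y = x \<bullet> y - 2 * (y \<bullet> w) / (w \<bullet> w) * (x \<bullet> w) - 2 * (x \<bullet> w) / (w \<bullet> w) * (w \<bullet> y)
        + 2 * (x \<bullet> w) / (w \<bullet> w) * (2 * (y \<bullet> w) / (w \<bullet> w)) * (w \<bullet> w)"
      by (simp add: Q_def inner_diff_left inner_diff_right)
    then show ?thesis using w0 by (simp add: inner_commute[of w y])
  qed
  then have "orthogonal_transformation Q" using lin by (simp add: orthogonal_transformation_def)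
  moreover have "Q d = norm d *\<^sub>R e"
  proof -
    have "d \<bullet> d = norm d * norm d" by (simp add: power2_norm_eq_inner[symmetric] power2_eq_square)
    then have "w \<bullet> w = 2 * (d \<bullet> w)"
      using assms by (simp add: w_def inner_diff_left inner_diff_right inner_commute[of e d] algebra_simps)
    then have ratio: "2 * (d \<bullet> w) / (w \<bullet> w) = 1" using w0 by (metis divide_self)
    have "Q d = d - w" unfolding Q_def ratio by simp
    then show ?thesis by (simp add: w_def)
  qed
  ultimately show ?thesis by (rule that)
qed

section \<open>The maximizing body is a ball\<close>

lemma ball_fibre:
  fixes e :: "'a::euclidean_space"
  assumes e: "e \<in> Basis" and x: "x \<bullet> e = 0" and s: "0 \<le> s" "s\<^sup>2 = \<rho>\<^sup>2 - (norm x)\<^sup>2" and \<rho>: "0 \<le> \<rho>"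
  shows "x + t *\<^sub>R e \<in> cball 0 \<rho> \<longleftrightarrow> \<bar>t\<bar> \<le> s" and "x + t *\<^sub>R e \<in> ball 0 \<rho> \<longleftrightarrow> \<bar>t\<bar> < s"
proof -
  have n: "(norm (x + t *\<^sub>R e))\<^sup>2 = (norm x)\<^sup>2 + t\<^sup>2"
    unfolding power2_norm_eq_inner using e x
    by (simp add: inner_add_left inner_add_right inner_commute[of e x] power2_eq_square)
  have "norm (x + t *\<^sub>R e) \<le> \<rho> \<longleftrightarrow> (norm (x + t *\<^sub>R e))\<^sup>2 \<le> \<rho>\<^sup>2"
    using \<rho> by (simp add: power2_le_iff_abs_le)
  also have "\<dots> \<longleftrightarrow> t\<^sup>2 \<le> s\<^sup>2" unfolding n s(2) by linarith
  also have "\<dots> \<longleftrightarrow> \<bar>t\<bar> \<le> s" using s(1) by (simp add: power2_le_iff_abs_le)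
  finally show "x + t *\<^sub>R e \<in> cball 0 \<rho> \<longleftrightarrow> \<bar>t\<bar> \<le> s" by simp
  have "norm (x + t *\<^sub>R e) < \<rho> \<longleftrightarrow> \<not> \<rho>\<^sup>2 \<le> (norm (x + t *\<^sub>R e))\<^sup>2"
    using \<rho> by (metis abs_le_square_iff abs_norm_cancel abs_of_nonneg not_le)
  also have "\<dots> \<longleftrightarrow> \<not> s\<^sup>2 \<le> t\<^sup>2" unfolding n s(2) by linarith
  also have "\<dots> \<longleftrightarrow> \<bar>t\<bar> < s" using s(1) by (metis abs_le_square_iff abs_of_nonneg not_le)
  finally show "x + t *\<^sub>R e \<in> ball 0 \<rho> \<longleftrightarrow> \<bar>t\<bar> < s" by simp
qed

lemma steiner_subset_cball:
  fixes e :: "'a::euclidean_space"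
  assumes e: "e \<in> Basis" and K: "K \<subseteq> cball 0 R"
  shows "steiner e K \<subseteq> cball 0 R"
proof
  fix x assume "x \<in> steiner e K"
  then obtain u v where u: "u \<in> K" "v \<in> K" "x = (1 / 2) *\<^sub>R (u + reflect e v)" by (rule steinerE)
  have "norm u \<le> R" "norm v \<le> R" using K u(1,2) by auto
  then have "norm (u + reflect e v) \<le> 2 * R"
    using norm_triangle_ineq[of u "reflect e v"] e by simp
  then show "x \<in> cball 0 R" by (simp add: u(3))
qed

lemma cball_subset_steiner:
  fixes e :: "'a::euclidean_space"
  assumes e: "e \<in> Basis" and K: "cball 0 r \<subseteq> K"
  shows "cball 0 r \<subseteq> steiner e K"
proof
  fix x :: 'a assume x: "x \<in> cball 0 r"
  show "x \<in> steiner e K"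
  proof (rule steinerI)
    show "x \<in> K" "reflect e x \<in> K" using x K e by auto
    show "x - (x \<bullet> e) *\<^sub>R e = reflect e x - (reflect e x \<bullet> e) *\<^sub>R e"
      using e by (simp add: reflect_inner) (simp add: reflect_def algebra_simps flip: scaleR_2)
    show "x = (1 / 2) *\<^sub>R (x + reflect e (reflect e x))" using e by (simp flip: scaleR_2)
  qed
qed

lemma steiner_uminus:
  fixes e :: "'a::euclidean_space"
  assumes "uminus ` K = K" shows "uminus ` steiner e K = steiner e K"
proof -
  have sub: "- x \<in> steiner e K" if "x \<in> steiner e K" for x
    using that
  proof (rule steinerE)
    fix u v assume u: "u \<in> K" "v \<in> K" "u - (u \<bullet> e) *\<^sub>R e = v - (v \<bullet> e) *\<^sub>R e" "x = (1 / 2) *\<^sub>R (u + reflect e v)"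
    show ?thesis
    proof (rule steinerI)
      show "- u \<in> K" "- v \<in> K" using u(1,2) assms by auto
      show "- u - (- u \<bullet> e) *\<^sub>R e = - v - (- v \<bullet> e) *\<^sub>R e"
        using arg_cong[OF u(3), of uminus] by simp
      show "- x = (1 / 2) *\<^sub>R (- u + reflect e (- v))"
        unfolding u(4) reflect_minus by (simp add: scaleR_diff_right scaleR_add_right)
    qed
  qed
  then show ?thesis by (force simp: image_iff)
qed

text \<open>Symmetrizing \<open>L \<inter> cball 0 \<rho>\<close> preserves its volume and stays
  inside \<open>steiner e L \<inter> cball 0 \<rho>\<close>, which gives the weak inequality. On the
  line through \<open>x\<close> and \<open>y\<close> neither chord contains the other, so their
  common part is strictly shorter than both; after centring, both chords extend beyond it. A point
  \<open>w\<close> in the gap has an open neighbourhood of positive volume that was not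
  counted.\<close>

lemma emeasure_steiner_Int_ball_less:
  fixes e :: "'a::euclidean_space"
  assumes e: "e \<in> Basis" and L: "body L" and x: "x \<in> interior L" "x \<notin> cball 0 \<rho>"
    and y: "y \<in> ball 0 \<rho>" "y \<notin> L" and xy: "x - y = c *\<^sub>R e"
  shows "emeasure lborel (L \<inter> cball 0 \<rho>) < emeasure lborel (steiner e L \<inter> cball 0 \<rho>)"
proof -
  have ee: "e \<bullet> e = 1" using e by simp
  define z where "z = x - (x \<bullet> e) *\<^sub>R e"
  have ze: "z \<bullet> e = 0" using ee by (simp add: z_def inner_diff_left)
  define \<alpha> \<beta> where "\<alpha> = x \<bullet> e" and "\<beta> = y \<bullet> e"
  have xz: "x = z + \<alpha> *\<^sub>R e" by (simp add: z_def \<alpha>_def)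
  have c: "c = \<alpha> - \<beta>" using arg_cong[OF xy, of "\<lambda>v. v \<bullet> e"] ee by (simp add: \<alpha>_def \<beta>_def inner_diff_left)
  have "y = x - (\<alpha> - \<beta>) *\<^sub>R e" by (simp add: c[symmetric] xy[symmetric])
  also have "\<dots> = z + \<beta> *\<^sub>R e" by (subst xz) (simp add: algebra_simps)
  finally have yz: "y = z + \<beta> *\<^sub>R e" .
  have \<rho>: "0 < \<rho>" using y(1) by (auto intro: le_less_trans[OF norm_ge_zero])
  have "(norm z)\<^sup>2 \<le> (norm y)\<^sup>2"
    unfolding yz power2_norm_eq_inner using ze ee by (simp add: inner_add_left inner_add_right inner_commute[of e z])
  then have "norm z \<le> norm y" by (simp add: power2_le_iff_abs_le)
  then have "norm z < \<rho>" using y(1) by simp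
  then have "(norm z)\<^sup>2 < \<rho>\<^sup>2" by (simp add: power_strict_mono)
  define s where "s = sqrt (\<rho>\<^sup>2 - (norm z)\<^sup>2)"
  have s: "0 < s" "s\<^sup>2 = \<rho>\<^sup>2 - (norm z)\<^sup>2" using \<open>(norm z)\<^sup>2 < \<rho>\<^sup>2\<close> by (simp_all add: s_def)
  note bf = ball_fibre[OF e ze less_imp_le[OF s(1)] s(2) less_imp_le[OF \<rho>]]
  obtain a b where ab: "{t. z + t *\<^sub>R e \<in> L} = {a..b}" by (rule fibre_interval[OF e bodyD(1,2)[OF L]])
  have mem: "z + t *\<^sub>R e \<in> L \<longleftrightarrow> a \<le> t \<and> t \<le> b" for t using ab by (auto simp: set_eq_iff)
  have \<alpha>s: "s < \<bar>\<alpha>\<bar>" using x(2) bf(1)[of \<alpha>] unfolding xz by simp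
  have \<beta>s: "\<bar>\<beta>\<bar> < s" using y(1) bf(2)[of \<beta>] unfolding yz by simp
  have \<beta>ab: "\<not> (a \<le> \<beta> \<and> \<beta> \<le> b)" using y(2) mem[of \<beta>] unfolding yz by simp
  obtain \<delta> where \<delta>: "0 < \<delta>" "cball x \<delta> \<subseteq> L" using x(1) mem_interior_cball by blast
  have "x + \<delta> *\<^sub>R e \<in> L" "x - \<delta> *\<^sub>R e \<in> L" using \<delta> ee e by (auto intro!: subsetD[OF \<delta>(2)] simp: dist_norm)
  then have "z + (\<alpha> + \<delta>) *\<^sub>R e \<in> L" "z + (\<alpha> - \<delta>) *\<^sub>R e \<in> L" unfolding xz by (simp_all add: algebra_simps)
  then have \<alpha>ab: "a < \<alpha>" "\<alpha> < b" using \<delta>(1) unfolding mem by auto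
  define l where "l = (b - a) / 2"
  define h where "h = (min b s - max a (- s)) / 2"
  have l: "0 < l" using \<alpha>ab by (simp add: l_def)
  \<comment> \<open>The chord of \<open>L\<close> has more than the common part because of \<alpha>,
    which is interior to it but outside the ball; the chord of the ball has more because of \<beta>,
    which it contains while \<open>L\<close> does not.\<close>
  have h: "h < l" "h < s"
    using \<alpha>s \<beta>s \<beta>ab \<alpha>ab s(1) unfolding h_def l_def by (auto simp: min_def max_def abs_if split: if_splits)
  \<comment> \<open>The two chords may be disjoint, in which case \<open>h\<close> can be negative;
    the maximum with 0 keeps \<open>t\<close> positive.\<close>
  obtain t where t: "max 0 h < t" "t < min l s" using dense[of "max 0 h" "min l s"] h l s(1) by auto
  define w where "w = z + t *\<^sub>R e"
  have w_ball: "w \<in> ball 0 \<rho>" unfolding w_def bf(2) using t by auto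
  \<comment> \<open>\<open>w\<close> lies strictly between the interior point \<open>z\<close> and
    the upper end of the symmetrized chord, hence in the interior.\<close>
  have w_int: "w \<in> interior (steiner e L)"
  proof -
    have "ball (x - (x \<bullet> e) *\<^sub>R e) \<delta> \<subseteq> steiner e L"
      using ball_subset_steiner[OF e, of x \<delta> L] \<delta>(2) ball_subset_cball by blast
    then have zi: "z \<in> interior (steiner e L)"
      unfolding z_def[symmetric] using \<delta>(1) by (meson centre_in_ball interior_maximal open_ball subsetD)
    have le: "z + l *\<^sub>R e \<in> steiner e L"
      using steiner_fibre_interval[OF e ze ab] l by (auto simp: set_eq_iff l_def)
    have "(z + l *\<^sub>R e) - (1 - t / l) *\<^sub>R ((z + l *\<^sub>R e) - z) \<in> interior (steiner e L)"
      by (rule mem_interior_convex_shrink[OF convex_steiner[OF bodyD(2)[OF L]] zi le]) (use t l in auto)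
    also have "(z + l *\<^sub>R e) - (1 - t / l) *\<^sub>R ((z + l *\<^sub>R e) - z) = w"
      using l by (simp add: w_def algebra_simps)
    finally show ?thesis .
  qed
  have LB: "compact (L \<inter> cball 0 \<rho>)" "convex (L \<inter> cball 0 \<rho>)"
    using bodyD[OF L] by (auto intro: convex_Int compact_Int)
  have "{t. z + t *\<^sub>R e \<in> L \<inter> cball 0 \<rho>} = {max a (- s)..min b s}"
    by (auto simp: mem bf(1) simp del: mem_cball mem_cball_0)
  then have "{t. z + t *\<^sub>R e \<in> steiner e (L \<inter> cball 0 \<rho>)} = {- (min b s - max a (- s)) / 2..(min b s - max a (- s)) / 2}"
    by (rule steiner_fibre_interval[OF e ze])
  then have "z + t *\<^sub>R e \<in> steiner e (L \<inter> cball 0 \<rho>) \<longleftrightarrow> - (min b s - max a (- s)) / 2 \<le> t \<and> t \<le> h"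
    by (simp add: set_eq_iff h_def)
  then have w_not: "w \<notin> steiner e (L \<inter> cball 0 \<rho>)"
    using t(1) unfolding w_def by auto
  define V where "V = (interior (steiner e L) \<inter> ball 0 \<rho>) - steiner e (L \<inter> cball 0 \<rho>)"
  have cS: "compact (steiner e (L \<inter> cball 0 \<rho>))" by (rule compact_steiner[OF LB(1)])
  have oV: "open V" unfolding V_def using compact_imp_closed[OF cS] by (intro open_Diff open_Int) auto
  have wV: "w \<in> V" using w_int w_ball w_not by (simp add: V_def)
  have V0: "emeasure lborel V > 0"
    using emeasure_interior_pos[of V] oV wV interior_open[OF oV] by auto
  have sub: "steiner e (L \<inter> cball 0 \<rho>) \<union> V \<subseteq> steiner e L \<inter> cball 0 \<rho>"
    using steiner_mono[of "L \<inter> cball 0 \<rho>" L e] steiner_subset_cball[OF e, of "L \<inter> cball 0 \<rho>" \<rho>]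
      interior_subset[of "steiner e L"] ball_subset_cball[of 0 \<rho>] unfolding V_def by blast
  have fin: "emeasure lborel (L \<inter> cball 0 \<rho>) \<noteq> \<infinity>" using emeasure_compact_finite[OF LB(1)] by simp
  have "emeasure lborel (L \<inter> cball 0 \<rho>) + 0 < emeasure lborel (L \<inter> cball 0 \<rho>) + emeasure lborel V"
    using fin V0 by (subst ennreal_add_left_cancel_less) auto
  also have "\<dots> = emeasure lborel (steiner e (L \<inter> cball 0 \<rho>) \<union> V)"
    using emeasure_steiner[OF e LB] cS oV by (subst plus_emeasure[symmetric]) (auto simp: V_def)
  also have "\<dots> \<le> emeasure lborel (steiner e L \<inter> cball 0 \<rho>)"
    using compact_steiner[OF bodyD(1)[OF L], of e] by (intro emeasure_mono sub) auto
  finally show ?thesis by simp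
qed

lemma subset_eq_measure_imp_eq:
  fixes A B :: "'a::euclidean_space set"
  assumes A: "compact A" and B: "body B" and sub: "A \<subseteq> B" and eq: "emeasure lborel A = emeasure lborel B"
  shows "A = B"
proof (rule equalityI[OF sub])
  have "interior B \<subseteq> A"
  proof (rule ccontr)
    assume "\<not> ?thesis"
    then have ne: "interior B - A \<noteq> {}" by blast
    have o: "open (interior B - A)" using compact_imp_closed[OF A] by (intro open_Diff) auto
    have V0: "0 < emeasure lborel (interior B - A)"
      using emeasure_interior_pos[of "interior B - A"] o ne interior_open[OF o] by auto
    have "emeasure lborel A + 0 < emeasure lborel A + emeasure lborel (interior B - A)"
      using V0 emeasure_compact_finite[OF A] by (subst ennreal_add_left_cancel_less) auto
    also have "\<dots> = emeasure lborel (A \<union> (interior B - A))"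
      using A o by (subst plus_emeasure[symmetric]) auto
    also have "\<dots> \<le> emeasure lborel B"
      using sub interior_subset[of B] bodyD(1)[OF B] by (intro emeasure_mono) auto
    finally show False using eq by simp
  qed
  then have "closure (interior B) \<subseteq> A" using compact_imp_closed[OF A] by (rule closure_minimal)
  moreover have "closure (interior B) = B"
    using convex_closure_interior[OF bodyD(2,3)[OF B]] compact_imp_closed[OF bodyD(1)[OF B]] by simp
  ultimately show "B \<subseteq> A" by simp
qed

text \<open>Every condition survives orthogonal maps, symmetrization in a coordinate direction and
  limits of convergent subsequences. Symmetry about the origin makes each symmetrization admissible
  without a translation; the two balls provide compactness.\<close>

definition competitors :: "real \<Rightarrow> real \<Rightarrow> real \<Rightarrow> 'a::euclidean_space set \<Rightarrow> 'a set set" where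
  "competitors r R p K = {C. compact C \<and> convex C \<and> uminus ` C = C \<and> cball 0 r \<subseteq> C \<and> C \<subseteq> cball 0 R \<and>
      emeasure lborel C = emeasure lborel K \<and> Phi p K \<le> Phi p C}"

text \<open>Along the selected subsequence of a maximizing sequence the volume, \<open>Phi\<close>
  and the volume of the intersection with the ball all converge to their values at \<open>L\<close>,
  so \<open>L\<close> is a competitor and attains the supremum.\<close>

lemma exists_maximizing_competitor:
  fixes K :: "'a::euclidean_space set"
  assumes r: "0 < r" and p: "0 < p" and K: "K \<in> competitors r R p K"
  obtains L where "L \<in> competitors r R p K"
    "\<forall>C\<in>competitors r R p K. emeasure lborel (C \<inter> cball 0 \<rho>) \<le> emeasure lborel (L \<inter> cball 0 \<rho>)"
proof -
  let ?F = "competitors r R p K"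
  let ?m = "\<lambda>C :: 'a set. emeasure lborel (C \<inter> cball 0 \<rho>)"
  have ne: "?m ` ?F \<noteq> {}" using K by auto
  obtain g where g: "incseq g" "range g \<subseteq> ?m ` ?F" "Sup (?m ` ?F) = (SUP i::nat. g i)"
    using ennreal_Sup_countable_SUP[OF ne] by auto
  have "\<exists>C. \<forall>k. C k \<in> ?F \<and> g k = ?m (C k)" using g(2) by (intro choice) blast
  then obtain C where C: "\<And>k. C k \<in> ?F" "\<And>k. g k = ?m (C k)" by blast
  have Ck: "compact (C k)" "convex (C k)" "uminus ` C k = C k" "cball 0 r \<subseteq> C k" "C k \<subseteq> cball 0 R"
    "emeasure lborel (C k) = emeasure lborel K" "Phi p K \<le> Phi p (C k)" for k
    using C(1)[of k] unfolding competitors_def by auto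
  obtain s L where sL: "strict_mono (s :: nat \<Rightarrow> nat)" "compact L" "convex L" "cball 0 r \<subseteq> L" "L \<subseteq> cball 0 R"
    and lim0: "\<forall>x. x \<notin> frontier L \<longrightarrow> (\<forall>\<^sub>F k in sequentially. (x \<in> C (s k)) = (x \<in> L))"
    and sym: "(\<forall>k. uminus ` C k = C k) \<longrightarrow> uminus ` L = L"
    by (rule convex_selection[of r C R, OF r Ck(2,4,5)])
  have lim: "\<And>x. x \<notin> frontier L \<Longrightarrow> \<forall>\<^sub>F k in sequentially. (x \<in> C (s k)) = (x \<in> L)"
    using lim0 by blast
  have [measurable]: "C k \<in> sets borel" "L \<in> sets borel" "cball (0::'a) R \<in> sets borel" "cball (0::'a) \<rho> \<in> sets borel" for k
    using Ck(1) sL(2) by auto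
  have Rfin: "emeasure lborel (cball (0::'a) R) < \<infinity>" by (rule emeasure_lborel_cball_finite)
  have meas_lim: "(\<lambda>k. emeasure lborel (C (s k) \<inter> B)) \<longlonglongrightarrow> emeasure lborel (L \<inter> B)"
    if [measurable]: "B \<in> sets borel" for B
  proof -
    have "(\<integral>\<^sup>+x. indicator B x * indicator (cball 0 R) x \<partial>lborel) \<le> (\<integral>\<^sup>+x. indicator (cball (0::'a) R) x \<partial>lborel)"
      by (rule nn_integral_mono) (auto simp: indicator_def)
    then have fin: "(\<integral>\<^sup>+x. indicator B x * indicator (cball 0 R) x \<partial>lborel) < \<infinity>"
      using Rfin by (auto intro: le_less_trans)
    have eq: "(\<integral>\<^sup>+x. indicator B x * indicator A x \<partial>lborel) = emeasure lborel (A \<inter> B)" if "A \<in> sets borel" for A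
    proof -
      have "(\<integral>\<^sup>+x. indicator B x * indicator A x \<partial>lborel) = (\<integral>\<^sup>+x. indicator (A \<inter> B) x \<partial>lborel)"
        by (rule nn_integral_cong) (auto simp: indicator_def)
      then show ?thesis using that by simp
    qed
    have "(\<lambda>k. \<integral>\<^sup>+x. indicator B x * indicator (C (s k)) x \<partial>lborel) \<longlonglongrightarrow> (\<integral>\<^sup>+x. indicator B x * indicator L x \<partial>lborel)"
      by (rule nn_integral_convex_limit[OF Ck(1,5) sL(2,3) lim _ fin]) measurable
    then show ?thesis by (simp add: eq)
  qed
  have "L \<in> ?F"
  proof -
    have "(\<lambda>k. emeasure lborel K) \<longlonglongrightarrow> emeasure lborel L"
      using meas_lim[of UNIV] by (simp add: Ck(6))
    then have "emeasure lborel L = emeasure lborel K" by (simp add: LIMSEQ_const_iff)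
    moreover have "(\<lambda>k. Phi p (C (s k))) \<longlonglongrightarrow> Phi p L"
      by (rule Phi_convex_limit[OF r p Ck(1,5,4) sL(2,3,4) lim])
    then have "Phi p K \<le> Phi p L"
      by (rule LIMSEQ_le_const) (use Ck(7) in auto)
    ultimately show ?thesis using sL sym Ck(3) unfolding competitors_def by auto
  qed
  moreover have "\<forall>C'\<in>?F. ?m C' \<le> ?m L"
  proof
    fix C' assume "C' \<in> ?F"
    have "g \<longlonglongrightarrow> (SUP i. g i)" by (rule LIMSEQ_SUP[OF g(1)])
    then have "(g \<circ> s) \<longlonglongrightarrow> (SUP i. g i)" by (rule LIMSEQ_subseq_LIMSEQ[OF _ sL(1)])
    moreover have "(g \<circ> s) \<longlonglongrightarrow> ?m L" using meas_lim[of "cball 0 \<rho>"] by (simp add: o_def C(2))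
    ultimately have "?m L = Sup (?m ` ?F)" unfolding g(3) by (rule LIMSEQ_unique[rotated])
    then show "?m C' \<le> ?m L" using \<open>C' \<in> ?F\<close> by (metis SUP_upper)
  qed
  ultimately show ?thesis by (rule that)
qed

lemma indicator_orthogonal_image:
  fixes Q :: "'a::euclidean_space \<Rightarrow> 'a"
  assumes "orthogonal_transformation Q"
  shows "indicator (Q ` A) (Q x) = indicator A x"
  using orthogonal_transformation_inj[OF assms] by (auto simp: indicator_def inj_image_mem_iff)

lemma emeasure_orthogonal_image:
  fixes Q :: "'a::euclidean_space \<Rightarrow> 'a"
  assumes Q: "orthogonal_transformation Q" and A: "compact A"
  shows "emeasure lborel (Q ` A) = emeasure lborel A"
proof -
  have "(\<integral>\<^sup>+x. indicator (Q ` A) (Q x) \<partial>lborel) = (\<integral>\<^sup>+x. indicator (Q ` A) x \<partial>lborel)"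
    by (rule nn_integral_lborel_orthogonal[OF Q]) (use compact_orthogonal_image[OF A Q] in simp)
  then show ?thesis
    using A compact_orthogonal_image[OF A Q] by (simp add: indicator_orthogonal_image[OF Q])
qed

lemma orthogonal_image_cball:
  fixes Q :: "'a::euclidean_space \<Rightarrow> 'a"
  assumes Q: "orthogonal_transformation Q"
  shows "Q ` cball 0 r = cball 0 r"
proof (intro equalityI subsetI)
  fix x assume "x \<in> Q ` cball 0 r"
  then show "x \<in> cball 0 r" by (auto simp: orthogonal_transformation_norm[OF Q])
next
  fix x :: 'a assume x: "x \<in> cball 0 r"
  obtain z where "x = Q z" using orthogonal_transformation_surj[OF Q] by (metis surjD)
  then show "x \<in> Q ` cball 0 r" using x by (auto simp: orthogonal_transformation_norm[OF Q])
qed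

lemma competitors_body:
  assumes "0 < r" "C \<in> competitors r R p K" shows "body C"
proof -
  have "ball 0 r \<subseteq> interior C"
    using assms by (intro interior_maximal) (auto simp: competitors_def subset_eq)
  then show ?thesis using assms by (auto simp: competitors_def body_def)
qed

lemma competitors_orthogonal_image:
  fixes Q :: "'a::euclidean_space \<Rightarrow> 'a"
  assumes Q: "orthogonal_transformation Q" and C: "C \<in> competitors r R p K"
  shows "Q ` C \<in> competitors r R p K"
proof -
  have lin: "linear Q" using Q by (rule orthogonal_transformation_linear)
  have c: "compact C" "convex C" "uminus ` C = C" "cball 0 r \<subseteq> C" "C \<subseteq> cball 0 R"
    "emeasure lborel C = emeasure lborel K" "Phi p K \<le> Phi p C"
    using C by (auto simp: competitors_def)
  have "uminus ` Q ` C = Q ` uminus ` C" by (simp add: image_image linear_neg[OF lin])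
  moreover have "cball 0 r \<subseteq> Q ` C" "Q ` C \<subseteq> cball 0 R"
    using image_mono[OF c(4), of Q] image_mono[OF c(5), of Q] by (simp_all add: orthogonal_image_cball[OF Q])
  ultimately show ?thesis
    using c compact_orthogonal_image[OF c(1) Q] convex_linear_image[OF lin c(2)]
    by (simp add: competitors_def emeasure_orthogonal_image[OF Q c(1)] Phi_orthogonal_image[OF c(1) Q])
qed

lemma competitors_steiner:
  fixes C :: "'a::euclidean_space set"
  assumes e: "e \<in> Basis" and r: "0 < r" and p: "0 < p" and C: "C \<in> competitors r R p K"
  shows "steiner e C \<in> competitors r R p K"
proof -
  have c: "compact C" "convex C" "uminus ` C = C" "cball 0 r \<subseteq> C" "C \<subseteq> cball 0 R"
    "emeasure lborel C = emeasure lborel K" "Phi p K \<le> Phi p C"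
    using C by (auto simp: competitors_def)
  have "Phi p C \<le> Phi p (steiner e C)"
    by (rule Phi_steiner_symmetric[OF e competitors_body[OF r C] p Phi_finite[OF c(1,4) r p] c(3)])
  then show ?thesis
    using c compact_steiner[OF c(1)] convex_steiner[OF c(2)] steiner_uminus[OF c(3)] cball_subset_steiner[OF e c(4)]
      steiner_subset_cball[OF e c(5)] emeasure_steiner[OF e c(1,2)]
    by (auto simp: competitors_def)
qed

text \<open>If one of the maximizer \<open>L\<close> and the ball contains the other, equal volume
  makes them equal. Otherwise there are \<open>x\<close> in the interior of \<open>L\<close> outside
  the ball and \<open>y\<close> in the open ball outside \<open>L\<close>, and symmetrizing along
  \<open>x - y\<close> contradicts maximality.\<close>

lemma symmetric_Phi_le_ball:
  fixes K :: "'a::euclidean_space set"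
  assumes K: "body K" "uminus ` K = K" and p: "0 < p" and \<rho>: "0 < \<rho>"
    and eq: "emeasure lborel K = emeasure lborel (cball (0::'a) \<rho>)"
  shows "Phi p K \<le> Phi p (cball (0::'a) \<rho>)"
proof -
  obtain r where r: "0 < r" "cball 0 r \<subseteq> K"
    using symmetric_zero_interior[OF K] mem_interior_cball by blast
  obtain R where "\<And>x. x \<in> K \<Longrightarrow> norm x \<le> R"
    using compact_imp_bounded[OF bodyD(1)[OF K(1)]] by (auto simp: bounded_iff)
  then have R: "K \<subseteq> cball 0 R" by auto
  have "K \<in> competitors r R p K" using K r R by (simp add: competitors_def body_def)
  then obtain L where L: "L \<in> competitors r R p K"
    and max: "\<forall>C\<in>competitors r R p K. emeasure lborel (C \<inter> cball 0 \<rho>) \<le> emeasure lborel (L \<inter> cball 0 \<rho>)"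
    by (rule exists_maximizing_competitor[OF r(1) p, where \<rho>=\<rho>])
  have bL: "body L" by (rule competitors_body[OF r(1) L])
  have bB: "body (cball (0::'a) \<rho>)" using \<rho> by (simp add: body_def)
  have eqL: "emeasure lborel L = emeasure lborel (cball (0::'a) \<rho>)" using L eq by (simp add: competitors_def)
  have "L = cball 0 \<rho>"
  proof (cases "L \<subseteq> cball 0 \<rho> \<or> cball 0 \<rho> \<subseteq> L")
    case True
    then show ?thesis
      using subset_eq_measure_imp_eq[OF bodyD(1)[OF bL] bB _ eqL]
        subset_eq_measure_imp_eq[OF bodyD(1)[OF bB] bL _ eqL[symmetric]] by blast
  next
    case False
    have "\<not> interior L \<subseteq> cball 0 \<rho>"
    proof
      assume "interior L \<subseteq> cball 0 \<rho>"
      then have "closure (interior L) \<subseteq> cball 0 \<rho>" by (rule closure_minimal) simp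
      then show False using False convex_closure_interior[OF bodyD(2,3)[OF bL]] closure_subset[of L] by auto
    qed
    then obtain x where x: "x \<in> interior L" "x \<notin> cball 0 \<rho>" by blast
    have "\<not> ball 0 \<rho> \<subseteq> L"
    proof
      assume "ball 0 \<rho> \<subseteq> L"
      then have "closure (ball 0 \<rho>) \<subseteq> L" by (rule closure_minimal) (rule compact_imp_closed[OF bodyD(1)[OF bL]])
      then show False using False \<rho> by (simp add: closure_ball)
    qed
    then obtain y where y: "y \<in> ball 0 \<rho>" "y \<notin> L" by blast
    obtain e :: 'a where e: "e \<in> Basis" using nonempty_Basis by blast
    \<comment> \<open>Symmetrization is available in coordinate directions, so \<open>x - y\<close>
      is first rotated onto one; the ball and the class of competitors are invariant under the
      rotation.\<close>
    obtain Q where Q: "orthogonal_transformation Q" "Q (x - y) = norm (x - y) *\<^sub>R e"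
      by (rule exists_orthogonal_to_Basis[OF e])
    have lin: "linear Q" and inj: "inj Q"
      using Q(1) by (auto intro: orthogonal_transformation_linear orthogonal_transformation_inj)
    have QL: "Q ` L \<in> competitors r R p K" by (rule competitors_orthogonal_image[OF Q(1) L])
    have "emeasure lborel (Q ` L \<inter> cball 0 \<rho>) < emeasure lborel (steiner e (Q ` L) \<inter> cball 0 \<rho>)"
    proof (rule emeasure_steiner_Int_ball_less[OF e competitors_body[OF r(1) QL]])
      show "Q x \<in> interior (Q ` L)" using x(1) by (simp add: interior_injective_linear_image[OF lin inj])
      show "Q x \<notin> cball 0 \<rho>" "Q y \<in> ball 0 \<rho>" using x(2) y(1) by (simp_all add: orthogonal_transformation_norm[OF Q(1)])
      show "Q y \<notin> Q ` L" using y(2) by (simp add: inj_image_mem_iff[OF inj])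
      show "Q x - Q y = norm (x - y) *\<^sub>R e" using Q(2) by (simp add: linear_diff[OF lin])
    qed
    also have "\<dots> \<le> emeasure lborel (L \<inter> cball 0 \<rho>)"
      by (rule bspec[OF max competitors_steiner[OF e r(1) p QL]])
    also have "\<dots> = emeasure lborel (Q ` (L \<inter> cball 0 \<rho>))"
      using bodyD(1)[OF bL] by (intro emeasure_orthogonal_image[OF Q(1), symmetric]) auto
    also have "Q ` (L \<inter> cball 0 \<rho>) = Q ` L \<inter> cball 0 \<rho>"
      by (simp add: image_Int[OF inj] orthogonal_image_cball[OF Q(1)])
    finally show ?thesis by simp
  qed
  then show ?thesis using L by (simp add: competitors_def)
qed

lemma exists_translate_Phi_le_ball:
  fixes K :: "'a::euclidean_space set"
  assumes K: "body K" and p: "0 < p" and \<rho>: "0 < \<rho>"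
    and eq: "emeasure lborel K = emeasure lborel (cball (0::'a) \<rho>)"
  shows "\<exists>z. Phi p ((\<lambda>x. x - z) ` K) \<le> Phi p (cball (0::'a) \<rho>)"
proof -
  obtain C :: "'a set" and z where C: "body C" "uminus ` C = C" "emeasure lborel C = emeasure lborel K"
    "Phi p ((\<lambda>x. x - z) ` K) \<le> Phi p C"
    by (rule exists_symmetric[OF K p])
  note C(4)
  also have "Phi p C \<le> Phi p (cball (0::'a) \<rho>)"
    by (rule symmetric_Phi_le_ball[OF C(1,2) p \<rho>]) (simp add: C(3) eq)
  finally show ?thesis by blast
qed

lemma exists_equal_volume_ball:
  fixes K :: "'a::euclidean_space set"
  assumes K: "body K"
  obtains \<rho> where "0 < \<rho>" "emeasure lborel K = emeasure lborel (cball (0::'a) \<rho>)"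
proof -
  define n where "n = DIM('a)"
  define w where "w = unit_ball_vol (real n)"
  define m where "m = measure lborel K"
  have fin: "emeasure lborel K = ennreal m"
    using emeasure_compact_finite[OF bodyD(1)[OF K]] by (simp add: m_def emeasure_eq_ennreal_measure)
  have m: "0 < m" using emeasure_interior_pos[OF bodyD(3)[OF K]] bodyD(1)[OF K] by (simp add: fin)
  have w: "0 < w" by (simp add: w_def)
  define \<rho> where "\<rho> = root n (m / w)"
  have n: "0 < n" by (simp add: n_def)
  have \<rho>: "0 < \<rho>" "\<rho> ^ n = m / w" using m w n by (simp_all add: \<rho>_def)
  have "emeasure lborel (cball (0::'a) \<rho>) = ennreal (w * \<rho> ^ n)"
    using emeasure_cball[of \<rho> "0::'a"] \<rho>(1) by (simp add: n_def w_def)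
  then show ?thesis using that[OF \<rho>(1)] \<rho>(2) w by (simp add: fin)
qed

section \<open>Mahler volumes\<close>

lemma nn_integral_lborel_scale:
  fixes f :: "'a::euclidean_space \<Rightarrow> ennreal"
  assumes [measurable]: "f \<in> borel_measurable borel" and c: "0 < c"
  shows "(\<integral>\<^sup>+x. f x \<partial>lborel) = ennreal (c ^ DIM('a)) * (\<integral>\<^sup>+x. f (c *\<^sub>R x) \<partial>lborel)"
proof -
  have "(\<integral>\<^sup>+x. f x \<partial>lborel) = (\<integral>\<^sup>+x. f x \<partial>density (distr lborel borel (\<lambda>x. 0 + c *\<^sub>R x)) (\<lambda>_. ennreal (\<bar>c\<bar> ^ DIM('a))))"
    using c by (subst lborel_affine[of c 0]) auto
  also have "\<dots> = ennreal (c ^ DIM('a)) * (\<integral>\<^sup>+x. f (c *\<^sub>R x) \<partial>lborel)"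
    using c by (simp add: nn_integral_density nn_integral_distr nn_integral_cmult)
  finally show ?thesis .
qed

lemma lap_cball:
  assumes \<rho>: "0 < \<rho>"
  shows "lap (cball (0::'a::euclidean_space) \<rho>) y = \<rho> ^ DIM('a) * lap (cball 0 1) (\<rho> *\<^sub>R y)"
proof -
  have [measurable]: "cball (0::'a) \<rho> \<in> sets borel" by simp
  have "ennreal (lap (cball (0::'a) \<rho>) y)
    = ennreal (\<rho> ^ DIM('a)) * (\<integral>\<^sup>+x. ennreal (exp (\<rho> *\<^sub>R x \<bullet> y)) * indicator (cball 0 \<rho>) (\<rho> *\<^sub>R x) \<partial>lborel)"
    unfolding nn_integral_lap[OF compact_cball, symmetric]
    by (rule nn_integral_lborel_scale[OF _ \<rho>]) measurable
  also have "(\<integral>\<^sup>+x. ennreal (exp (\<rho> *\<^sub>R x \<bullet> y)) * indicator (cball 0 \<rho>) (\<rho> *\<^sub>R x) \<partial>lborel)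
    = ennreal (lap (cball (0::'a) 1) (\<rho> *\<^sub>R y))"
    unfolding nn_integral_lap[OF compact_cball, symmetric]
    by (rule nn_integral_cong) (use \<rho> in \<open>auto simp: indicator_def mult_le_cancel_left1\<close>)
  finally show ?thesis using \<rho> by (simp add: lap_nonneg flip: ennreal_mult)
qed

text \<open>Dilation invariance for centred balls: in the exponent \<open>1 + 1 / p\<close> the 1
  stems from rescaling \<open>y\<close>, and \<open>1 / p\<close> from the volume factor inside
  \<open>psi\<close>.\<close>

lemma Phi_cball:
  assumes \<rho>: "0 < \<rho>" and p: "0 < p"
  shows "ennreal ((\<rho> ^ DIM('a)) powr (1 + 1 / p)) * Phi p (cball (0::'a::euclidean_space) \<rho>) = Phi p (cball (0::'a) 1)"
proof -
  define k where "k = \<rho> ^ DIM('a)"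
  have k: "0 < k" using \<rho> by (simp add: k_def)
  have psi: "psi p (cball (0::'a) \<rho>) y = k powr (- (1 / p)) * psi p (cball 0 1) (\<rho> *\<^sub>R y)" for y
    unfolding psi_def lap_cball[OF \<rho>] k_def[symmetric]
    using k by (simp add: powr_mult lap_nonneg mult.commute)
  have [measurable]: "cball (0::'a) 1 \<in> sets borel" by simp
  have "Phi p (cball (0::'a) 1) = ennreal k * (\<integral>\<^sup>+y. ennreal (psi p (cball (0::'a) 1) (\<rho> *\<^sub>R y)) \<partial>lborel)"
    unfolding Phi_def k_def by (rule nn_integral_lborel_scale[OF _ \<rho>]) measurable
  moreover have "Phi p (cball (0::'a) \<rho>) = ennreal (k powr (- (1 / p))) * (\<integral>\<^sup>+y. ennreal (psi p (cball (0::'a) 1) (\<rho> *\<^sub>R y)) \<partial>lborel)"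
    unfolding Phi_def psi
    by (subst nn_integral_cmult[symmetric]) (auto simp: psi_def ennreal_mult)
  moreover have "k powr (1 + 1 / p) * k powr (- (1 / p)) = k" using k by (simp flip: powr_add)
  ultimately show ?thesis
    unfolding k_def[symmetric] by (simp add: mult.assoc[symmetric] flip: ennreal_mult)
qed

lemma convex_body_eq_body: "convex_body K = body K"
  by (simp add: convex_body_def body_def)

lemma LINT_exp_eq_lap:
  fixes K :: "'a::euclidean_space set"
  assumes K: "compact K"
  shows "(LINT x:K|lborel. exp (p * (x \<bullet> y))) = lap K (p *\<^sub>R y)"
proof -
  have [measurable]: "K \<in> sets borel" using K by simp
  show ?thesis
    unfolding set_lebesgue_integral_def lap_def
    by (subst integral_eq_nn_integral)
       (auto intro!: arg_cong[where f=enn2real] nn_integral_cong simp: indicator_def)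
qed

text \<open>One power of the volume is the outer factor of the Mahler volume; the additional
  \<open>1 / p\<close> comes from the normalized measure inside the logarithm. This separates the
  volume, which symmetrization preserves, from \<open>Phi\<close>, which it does not decrease after
  balancing.\<close>

lemma Lp_mahler_ereal:
  fixes K :: "(real ^ 'n) set"
  assumes K: "body K" and p: "0 < p"
  shows "Lp_mahler (ereal p) K = ennreal (measure lborel K powr (1 + 1 / p)) * Phi p K"
proof -
  define m where "m = measure lborel K"
  have eK: "emeasure lborel K = ennreal m"
    using emeasure_compact_finite[OF bodyD(1)[OF K]] by (simp add: m_def emeasure_eq_ennreal_measure)
  have m: "0 < m" using emeasure_interior_pos[OF bodyD(3)[OF K]] bodyD(1)[OF K] by (simp add: eK)
  have [measurable]: "K \<in> sets borel" using bodyD(1)[OF K] by simp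
  have "exp (- Lp_support (ereal p) K y) = m powr (1 / p) * psi p K y" for y
  proof -
    have L: "0 < lap K (p *\<^sub>R y)" using lap_pos[OF bodyD(1,3)[OF K]] .
    have "exp (- Lp_support (ereal p) K y) = (lap K (p *\<^sub>R y) / m) powr (- (1 / p))"
      using L m by (simp add: Lp_support_def LINT_exp_eq_lap[OF bodyD(1)[OF K]] powr_def flip: m_def)
    then show ?thesis using L m by (simp add: psi_def powr_divide powr_minus_divide)
  qed
  then have "Lp_mahler (ereal p) K = ennreal m * (\<integral>\<^sup>+y. ennreal (m powr (1 / p)) * ennreal (psi p K y) \<partial>lborel)"
    using m by (simp add: Lp_mahler_def eK ennreal_mult psi_def)
  also have "\<dots> = ennreal m * (ennreal (m powr (1 / p)) * Phi p K)"
    unfolding Phi_def by (subst nn_integral_cmult) auto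
  also have "\<dots> = ennreal (m * m powr (1 / p)) * Phi p K"
    using m by (simp add: mult.assoc ennreal_mult)
  also have "m * m powr (1 / p) = m powr (1 + 1 / p)" using m by (simp add: powr_add)
  finally show ?thesis by (simp add: m_def)
qed

lemma body_cball: "0 < r \<Longrightarrow> body (cball (c :: 'a::euclidean_space) r)"
  by (simp add: body_def)

lemma Lp_mahler_cball:
  assumes r: "0 < r" and p: "0 < p"
  shows "Lp_mahler (ereal p) (cball (0 :: real ^ 'n) r) = Lp_mahler (ereal p) (cball (0 :: real ^ 'n) 1)"
proof -
  define w where "w = unit_ball_vol (real DIM(real ^ 'n))"
  have w: "0 \<le> w" by (simp add: w_def)
  have m: "measure lborel (cball (0 :: real ^ 'n) r) = w * r ^ DIM(real ^ 'n)"
    "measure lborel (cball (0 :: real ^ 'n) 1) = w"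
    using content_cball[of r "0 :: real ^ 'n"] content_cball[of 1 "0 :: real ^ 'n"] r by (simp_all add: w_def)
  have "Lp_mahler (ereal p) (cball (0 :: real ^ 'n) r)
    = ennreal (w powr (1 + 1 / p)) * (ennreal ((r ^ DIM(real ^ 'n)) powr (1 + 1 / p)) * Phi p (cball (0 :: real ^ 'n) r))"
    unfolding Lp_mahler_ereal[OF body_cball[OF r] p] m
    using w r by (simp add: powr_mult ennreal_mult mult.assoc)
  also have "\<dots> = Lp_mahler (ereal p) (cball (0 :: real ^ 'n) 1)"
    unfolding Phi_cball[OF r p] by (simp add: Lp_mahler_ereal[OF body_cball p] m)
  finally show ?thesis .
qed

lemma measure_translate:
  fixes K :: "'a::euclidean_space set"
  assumes "compact K"
  shows "emeasure lborel ((\<lambda>x. x - z) ` K) = emeasure lborel K"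
proof -
  have K': "compact ((\<lambda>x. x - z) ` K)" using compact_translation_subtract[OF assms] .
  have "(\<integral>\<^sup>+x. indicator ((\<lambda>x. x - z) ` K) (- z + x) \<partial>lborel) = (\<integral>\<^sup>+x. indicator ((\<lambda>x. x - z) ` K) x \<partial>lborel)"
    using K' by (intro nn_integral_lborel_translate) auto
  moreover have "indicator ((\<lambda>x. x - z) ` K) (- z + x) = (indicator K x :: ennreal)" for x
    by (auto simp: indicator_def image_iff)
  ultimately show ?thesis using assms K' by simp
qed

lemma santalo_finite_exponent:
  fixes K :: "(real ^ 'n) set"
  assumes K: "body K" and p: "0 < p"
  shows "(INF x. Lp_mahler (ereal p) ((\<lambda>z. z - x) ` K)) \<le> Lp_mahler (ereal p) (cball (0 :: real ^ 'n) 1)"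
proof -
  obtain \<rho> where \<rho>: "0 < \<rho>" "emeasure lborel K = emeasure lborel (cball (0 :: real ^ 'n) \<rho>)"
    by (rule exists_equal_volume_ball[OF K])
  obtain x where x: "Phi p ((\<lambda>z. z - x) ` K) \<le> Phi p (cball (0 :: real ^ 'n) \<rho>)"
    using exists_translate_Phi_le_ball[OF K p \<rho>] by blast
  have "(INF x. Lp_mahler (ereal p) ((\<lambda>z. z - x) ` K)) \<le> Lp_mahler (ereal p) ((\<lambda>z. z - x) ` K)"
    by (rule INF_lower) simp
  also have "\<dots> = ennreal (measure lborel (cball (0 :: real ^ 'n) \<rho>) powr (1 + 1 / p)) * Phi p ((\<lambda>z. z - x) ` K)"
    unfolding Lp_mahler_ereal[OF body_translate[OF K] p]
    by (simp add: measure_def measure_translate[OF bodyD(1)[OF K]] \<rho>(2))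
  also have "\<dots> \<le> ennreal (measure lborel (cball (0 :: real ^ 'n) \<rho>) powr (1 + 1 / p)) * Phi p (cball (0 :: real ^ 'n) \<rho>)"
    by (rule mult_left_mono[OF x]) simp
  also have "\<dots> = Lp_mahler (ereal p) (cball (0 :: real ^ 'n) 1)"
    by (simp add: Lp_mahler_ereal[OF body_cball[OF \<rho>(1)] p, symmetric] Lp_mahler_cball[OF \<rho>(1) p])
  finally show ?thesis .
qed

text \<open>An average of exponentials over \<open>K\<close> is at most their supremum, so the
  support functions of finite exponent lie below that of exponent \<infinity>.\<close>

lemma Lp_mahler_infinity_le:
  fixes K :: "(real ^ 'n) set"
  assumes K: "body K" and p: "0 < p"
  shows "Lp_mahler \<infinity> K \<le> Lp_mahler (ereal p) K"
proof -
  define m where "m = measure lborel K"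
  have eK: "emeasure lborel K = ennreal m"
    using emeasure_compact_finite[OF bodyD(1)[OF K]] by (simp add: m_def emeasure_eq_ennreal_measure)
  have m: "0 < m" using emeasure_interior_pos[OF bodyD(3)[OF K]] bodyD(1)[OF K] by (simp add: eK)
  obtain R where R: "\<And>x. x \<in> K \<Longrightarrow> norm x \<le> R"
    using compact_imp_bounded[OF bodyD(1)[OF K]] by (auto simp: bounded_iff)
  have "Lp_support (ereal p) K y \<le> Lp_support \<infinity> K y" for y
  proof -
    define h where "h = (SUP x\<in>K. x \<bullet> y)"
    have "bdd_above ((\<lambda>x. x \<bullet> y) ` K)"
    proof (rule bdd_aboveI2)
      fix x assume "x \<in> K"
      then show "x \<bullet> y \<le> R * norm y"
        using R by (intro order_trans[OF norm_cauchy_schwarz mult_right_mono]) auto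
    qed
    then have h: "x \<bullet> y \<le> h" if "x \<in> K" for x unfolding h_def using that by (intro cSUP_upper)
    have L: "0 < lap K (p *\<^sub>R y)" using lap_pos[OF bodyD(1,3)[OF K]] .
    have "ennreal (lap K (p *\<^sub>R y)) \<le> (\<integral>\<^sup>+x\<in>K. ennreal (exp (p * h)) \<partial>lborel)"
      unfolding nn_integral_lap[OF bodyD(1)[OF K], symmetric]
      by (rule nn_integral_mono) (use h p in \<open>auto simp: indicator_def intro!: ennreal_leI\<close>)
    also have "\<dots> = ennreal (exp (p * h) * m)"
      using bodyD(1)[OF K] m by (simp add: nn_integral_cmult eK ennreal_mult)
    finally have "lap K (p *\<^sub>R y) / m \<le> exp (p * h)"
      using m by (simp add: pos_divide_le_eq lap_nonneg)
    then have "ln (lap K (p *\<^sub>R y) / m) \<le> p * h" 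
      using L m by (metis divide_pos_pos exp_gt_zero ln_exp ln_le_cancel_iff)
    then show ?thesis using p
      by (simp add: Lp_support_def LINT_exp_eq_lap[OF bodyD(1)[OF K]] pos_divide_le_eq mult.commute flip: m_def h_def)
  qed
  then show ?thesis unfolding Lp_mahler_def
    by (intro mult_left_mono nn_integral_mono ennreal_leI) auto
qed

text \<open>From the exponential bound with rate \<open>1 - d\<close>. The volume of the small ball
  carries the exponent \<open>- (1 / p)\<close> and so disappears for large \<open>p\<close>; the
  power of \<open>1 - d\<close> comes from rescaling the rate to 1.\<close>

lemma Lp_mahler_ball_upper:
  assumes p: "0 < p" and d: "0 < d" "d < 1"
  shows "Lp_mahler (ereal p) (cball (0 :: real ^ 'n) 1)
    \<le> ennreal (measure lborel (cball (0 :: real ^ 'n) 1) powr (1 + 1 / p)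
        * measure lborel (cball (0 :: real ^ 'n) (d / 2)) powr (- (1 / p)) * (1 / (1 - d) ^ DIM(real ^ 'n)))
      * (\<integral>\<^sup>+y. ennreal (exp (- norm (y :: real ^ 'n))) \<partial>lborel)"
proof -
  define c where "c = measure lborel (cball (0 :: real ^ 'n) (d / 2)) powr (- (1 / p))"
  define m where "m = measure lborel (cball (0 :: real ^ 'n) 1) powr (1 + 1 / p)"
  define q where "q = (1 - d) ^ DIM(real ^ 'n)"
  define I where "I = (\<integral>\<^sup>+y. ennreal (exp (- norm (y :: real ^ 'n))) \<partial>lborel)"
  have nn: "0 \<le> c" "0 \<le> m" "0 < q" using d by (auto simp: c_def m_def q_def)
  have "Phi p (cball (0 :: real ^ 'n) 1) \<le> (\<integral>\<^sup>+y. ennreal c * ennreal (exp (- (1 - d) * norm (y :: real ^ 'n))) \<partial>lborel)"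
    unfolding Phi_def
  proof (rule nn_integral_mono)
    fix y :: "real ^ 'n"
    show "ennreal (psi p (cball 0 1) y) \<le> ennreal c * ennreal (exp (- (1 - d) * norm y))"
      using psi_upper_bound[OF compact_cball subset_refl d(1) less_imp_le[OF d(2)] p, of y] nn
      by (simp add: c_def ennreal_leI flip: ennreal_mult)
  qed
  also have "\<dots> = ennreal c * (\<integral>\<^sup>+y. ennreal (exp (- (1 - d) * norm (y :: real ^ 'n))) \<partial>lborel)"
    by (rule nn_integral_cmult) measurable
  also have "(\<integral>\<^sup>+y. ennreal (exp (- (1 - d) * norm (y :: real ^ 'n))) \<partial>lborel) = ennreal (1 / q) * I"
  proof -
    have "I = ennreal q * (\<integral>\<^sup>+y. ennreal (exp (- norm ((1 - d) *\<^sub>R y :: real ^ 'n))) \<partial>lborel)"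
      unfolding I_def q_def by (rule nn_integral_lborel_scale) (use d in auto)
    moreover have "ennreal (1 / q) * ennreal q = 1" using nn by (simp flip: ennreal_mult)
    ultimately have "ennreal (1 / q) * I = (\<integral>\<^sup>+y. ennreal (exp (- norm ((1 - d) *\<^sub>R y :: real ^ 'n))) \<partial>lborel)"
      by (simp add: mult.assoc[symmetric] del: norm_scaleR)
    moreover have "norm ((1 - d) *\<^sub>R y :: real ^ 'n) = (1 - d) * norm y" for y using d by simp
    ultimately show ?thesis by (simp only: mult_minus_left)
  qed
  finally have "ennreal m * Phi p (cball (0 :: real ^ 'n) 1) \<le> ennreal m * (ennreal c * (ennreal (1 / q) * I))"
    by (rule mult_left_mono) simp
  also have "\<dots> = ennreal (m * c * (1 / q)) * I"
  proof -
    have "ennreal (m * c * (1 / q)) = ennreal m * ennreal c * ennreal (1 / q)"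
      using nn ennreal_mult[of "m * c" "1 / q"] ennreal_mult[of m c] by simp
    then show ?thesis by (simp only: mult.assoc)
  qed
  finally show ?thesis
    unfolding Lp_mahler_ereal[OF body_cball[OF zero_less_one] p] m_def c_def q_def I_def .
qed

lemma Lp_mahler_infinity_ball:
  "emeasure lborel (cball (0 :: real ^ 'n) 1) * (\<integral>\<^sup>+y. ennreal (exp (- norm (y :: real ^ 'n))) \<partial>lborel)
    \<le> Lp_mahler \<infinity> (cball (0 :: real ^ 'n) 1)"
  unfolding Lp_mahler_def
proof (intro mult_left_mono nn_integral_mono ennreal_leI)
  fix y :: "real ^ 'n"
  have "(SUP x\<in>cball 0 1. x \<bullet> y) \<le> norm y"
  proof (rule cSUP_least)
    fix x :: "real ^ 'n" assume "x \<in> cball 0 1"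
    then have "norm x * norm y \<le> 1 * norm y" by (intro mult_right_mono) auto
    then show "x \<bullet> y \<le> norm y" using norm_cauchy_schwarz[of x y] by simp
  qed simp
  then show "exp (- norm y) \<le> exp (- Lp_support \<infinity> (cball 0 1) y)" by (simp add: Lp_support_def)
qed simp

text \<open>The limits are taken in this order because the volume of the ball of radius
  \<open>d / 2\<close> tends to 0 with \<open>d\<close>: its power \<open>- (1 / p)\<close> tends to
  1 for fixed \<open>d\<close> as \<open>p\<close> grows, and only then may \<open>d\<close> tend to
  0.\<close>

lemma santalo_infinite_exponent:
  fixes K :: "(real ^ 'n) set"
  assumes K: "body K"
  shows "(INF x. Lp_mahler \<infinity> ((\<lambda>z. z - x) ` K)) \<le> Lp_mahler \<infinity> (cball (0 :: real ^ 'n) 1)"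
proof -
  define X where "X = (INF x. Lp_mahler \<infinity> ((\<lambda>z. z - x) ` K))"
  define I where "I = (\<integral>\<^sup>+y. ennreal (exp (- norm (y :: real ^ 'n))) \<partial>lborel)"
  define m where "m = measure lborel (cball (0 :: real ^ 'n) 1)"
  have m: "0 < m" unfolding m_def by (simp add: content_cball_pos)
  have "I < \<infinity>" using nn_integral_exp_norm_finite[of 1, where 'a="real ^ 'n"] by (simp add: I_def)
  then obtain J where J: "0 \<le> J" "I = ennreal J" by (cases I) auto
  have step: "X \<le> ennreal (m powr (1 + 1 / p) * measure lborel (cball (0 :: real ^ 'n) (d / 2)) powr (- (1 / p))
      * (1 / (1 - d) ^ DIM(real ^ 'n)) * J)" if "0 < p" "0 < d" "d < 1" for p d
  proof -
    have "X \<le> (INF x. Lp_mahler (ereal p) ((\<lambda>z. z - x) ` K))"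
      unfolding X_def by (rule INF_mono) (use Lp_mahler_infinity_le[OF body_translate[OF K] that(1)] in blast)
    also have "\<dots> \<le> Lp_mahler (ereal p) (cball (0 :: real ^ 'n) 1)" by (rule santalo_finite_exponent[OF K that(1)])
    also note Lp_mahler_ball_upper[OF that]
    finally show ?thesis
      unfolding m_def[symmetric] I_def[symmetric] J(2) ennreal_mult''[OF J(1), symmetric] .
  qed
  have step2: "X \<le> ennreal (m * (1 / (1 - d) ^ DIM(real ^ 'n)) * J)" if d: "0 < d" "d < 1" for d
  proof -
    define c where "c = measure lborel (cball (0 :: real ^ 'n) (d / 2))"
    have c: "0 < c" unfolding c_def using d by (simp add: content_cball_pos)
    have "(\<lambda>k. m powr (1 + inverse (real (Suc k))) * c powr (- inverse (real (Suc k))) * (1 / (1 - d) ^ DIM(real ^ 'n)) * J)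
      \<longlonglongrightarrow> m powr (1 + 0) * c powr (- 0) * (1 / (1 - d) ^ DIM(real ^ 'n)) * J"
      by (intro tendsto_intros LIMSEQ_inverse_real_of_nat) (use m c in auto)
    then have "(\<lambda>k. ennreal (m powr (1 + inverse (real (Suc k))) * c powr (- inverse (real (Suc k))) * (1 / (1 - d) ^ DIM(real ^ 'n)) * J))
      \<longlonglongrightarrow> ennreal (m * (1 / (1 - d) ^ DIM(real ^ 'n)) * J)"
      using m c by (intro tendsto_ennrealI) simp
    then show ?thesis
    proof (rule LIMSEQ_le_const, intro exI allI impI)
      fix k :: nat
      show "X \<le> ennreal (m powr (1 + inverse (real (Suc k))) * c powr (- inverse (real (Suc k))) * (1 / (1 - d) ^ DIM(real ^ 'n)) * J)"
        using step[of "real (Suc k)" d] d by (simp add: c_def inverse_eq_divide)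
    qed
  qed
  have "(\<lambda>k. m * (1 / (1 - inverse (real (Suc k))) ^ DIM(real ^ 'n)) * J) \<longlonglongrightarrow> m * (1 / (1 - 0) ^ DIM(real ^ 'n)) * J"
    by (intro tendsto_intros LIMSEQ_inverse_real_of_nat) auto
  then have "(\<lambda>k. ennreal (m * (1 / (1 - inverse (real (Suc k))) ^ DIM(real ^ 'n)) * J)) \<longlonglongrightarrow> ennreal (m * J)"
    by (intro tendsto_ennrealI) simp
  then have "X \<le> ennreal (m * J)"
  \<comment> \<open>The index 0 would give \<open>d = 1\<close>, where \<open>step2\<close> does not
    apply.\<close>
  proof (rule LIMSEQ_le_const, intro exI[of _ 1] allI impI)
    fix k :: nat assume "1 \<le> k"
    then show "X \<le> ennreal (m * (1 / (1 - inverse (real (Suc k))) ^ DIM(real ^ 'n)) * J)"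
      by (intro step2) (auto simp: inverse_eq_divide)
  qed
  also have "ennreal (m * J) = emeasure lborel (cball (0 :: real ^ 'n) 1) * I"
    using m J emeasure_lborel_cball_finite[of "0 :: real ^ 'n" 1]
    by (simp add: m_def ennreal_mult emeasure_eq_ennreal_measure)
  also have "\<dots> \<le> Lp_mahler \<infinity> (cball (0 :: real ^ 'n) 1)"
    unfolding I_def by (rule Lp_mahler_infinity_ball)
  finally show ?thesis unfolding X_def .
qed

theorem theorem1p2:
  fixes p :: ereal and K :: "(real ^ 'n) set"
  assumes "0 < p" and "convex_body K"
  shows "(INF x. Lp_mahler p ((\<lambda>z. z - x) ` K))
           \<le> Lp_mahler p (euclidean_unit_ball :: (real ^ 'n) set)"
proof (cases p)
  case (real r)
  then show ?thesis
    using santalo_finite_exponent[of K r] assms by (simp add: convex_body_eq_body euclidean_unit_ball_eq_cball)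
next
  case PInf
  then show ?thesis
    using santalo_infinite_exponent[of K] assms by (simp add: convex_body_eq_body euclidean_unit_ball_eq_cball)
qed (use assms in auto)

end
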